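(* Let $m\ge3$ and $n\ge2$, and let $Z_m*Z_n=\langle a,b\mid a^m=b^n=1\rangle$ be the free product of a cyclic group of order $m$ and a cyclic group of order $n$. Then the graph $X_{m,n}=\mathrm{Cay}(Z_m*Z_n;\{a^{\pm1},(ab)^{\pm1}\})$ has a unique hamiltonian circle, namely $\mathrm{Cay}(Z_m*Z_n;\{(ab)^{\pm1}\})$.
   Context: For symmetric $S\subseteq G$, $\mathrm{Cay}(G;S)$ has vertex set $G$, with $x$ adjacent to $y$ iff $x^{-1}y\in S$. For a connected locally finite graph $X$, $|X|$ is its Freudenthal compactification (add one point per end to $X$ viewed as a 1-complex), and a hamiltonian circle is a subspace of $|X|$ homeomorphic to $S^1$ containing all vertices, identified with the spanning 2-regular subgraph it meets $X$ in. *)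

theory Defs
  imports "HOL-Analysis.Analysis" "HOL-Algebra.Group"
begin

section \<open>Groups given by generators and relators\<close>

text \<open>In a word, the letter \<open>(x, True)\<close> stands for the generator \<open>x\<close> and
  \<open>(x, False)\<close> for its formal inverse.\<close>

type_synonym 'x word = "('x \<times> bool) list"

inductive pres_eq :: "'x word set \<Rightarrow> 'x word \<Rightarrow> 'x word \<Rightarrow> bool" for R where
  pres_refl: "pres_eq R u u"
| pres_sym: "pres_eq R u v \<Longrightarrow> pres_eq R v u"
| pres_trans: "pres_eq R u v \<Longrightarrow> pres_eq R v w \<Longrightarrow> pres_eq R u w"
| pres_ctxt: "pres_eq R u v \<Longrightarrow> pres_eq R (p @ u @ q) (p @ v @ q)"
| pres_cancel: "pres_eq R [(x, s), (x, \<not> s)] []"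
| pres_relator: "r \<in> R \<Longrightarrow> pres_eq R r []"

definition pres_class :: "'x word set \<Rightarrow> 'x word \<Rightarrow> 'x word set" where
  "pres_class R u = {v. pres_eq R u v}"

definition presented_group :: "'x word set \<Rightarrow> 'x word set monoid" where
  "presented_group R =
     \<lparr>carrier = range (pres_class R),
      mult = (\<lambda>A B. \<Union>u\<in>A. \<Union>v\<in>B. pres_class R (u @ v)),
      one = pres_class R []\<rparr>"

lemma pres_class_eq_iff: "pres_class R u = pres_class R v \<longleftrightarrow> pres_eq R u v"
proof
  assume "pres_class R u = pres_class R v"
  then have "v \<in> pres_class R u"
    by (simp add: pres_class_def pres_refl)
  then show "pres_eq R u v"
    by (simp add: pres_class_def)
next
  assume "pres_eq R u v"
  then have "pres_eq R u w \<longleftrightarrow> pres_eq R v w" for w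
    by (meson pres_sym pres_trans)
  then show "pres_class R u = pres_class R v"
    by (simp add: pres_class_def)
qed

lemma pres_eq_append:
  assumes "pres_eq R u u'" "pres_eq R v v'"
  shows "pres_eq R (u @ v) (u' @ v')"
proof (rule pres_trans)
  show "pres_eq R (u @ v) (u' @ v)"
    using pres_ctxt[OF assms(1), of "[]" v] by simp
  show "pres_eq R (u' @ v) (u' @ v')"
    using pres_ctxt[OF assms(2), of u' "[]"] by simp
qed

lemma mult_pres_class:
  "pres_class R u \<otimes>\<^bsub>presented_group R\<^esub> pres_class R v = pres_class R (u @ v)"
proof -
  have "pres_class R (u' @ v') = pres_class R (u @ v)"
    if "u' \<in> pres_class R u" "v' \<in> pres_class R v" for u' v'
  proof -
    have "pres_eq R u u'" "pres_eq R v v'"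
      using that by (simp_all add: pres_class_def)
    then show ?thesis
      by (metis pres_class_eq_iff pres_eq_append)
  qed
  moreover have "u \<in> pres_class R u" "v \<in> pres_class R v"
    by (simp_all add: pres_class_def pres_refl)
  ultimately have "(\<Union>u'\<in>pres_class R u. \<Union>v'\<in>pres_class R v. pres_class R (u' @ v'))
      = pres_class R (u @ v)"
    by blast
  then show ?thesis
    by (simp add: presented_group_def)
qed

lemma group_presented_group: "group (presented_group R)"
proof (rule groupI)
  fix A B assume "A \<in> carrier (presented_group R)" "B \<in> carrier (presented_group R)"
  then obtain u v where "A = pres_class R u" "B = pres_class R v"
    by (auto simp: presented_group_def)
  then show "A \<otimes>\<^bsub>presented_group R\<^esub> B \<in> carrier (presented_group R)"
    by (simp add: mult_pres_class) (simp add: presented_group_def)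
next
  fix A B C
  assume "A \<in> carrier (presented_group R)" "B \<in> carrier (presented_group R)"
    "C \<in> carrier (presented_group R)"
  then obtain u v w where "A = pres_class R u" "B = pres_class R v" "C = pres_class R w"
    by (auto simp: presented_group_def)
  then show "A \<otimes>\<^bsub>presented_group R\<^esub> B \<otimes>\<^bsub>presented_group R\<^esub> C =
      A \<otimes>\<^bsub>presented_group R\<^esub> (B \<otimes>\<^bsub>presented_group R\<^esub> C)"
    by (simp add: mult_pres_class)
next
  have one: "\<one>\<^bsub>presented_group R\<^esub> = pres_class R []"
    by (simp add: presented_group_def)
  show "\<one>\<^bsub>presented_group R\<^esub> \<in> carrier (presented_group R)"
    by (simp add: presented_group_def)
  fix A assume "A \<in> carrier (presented_group R)"
  then obtain u where A: "A = pres_class R u"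
    by (auto simp: presented_group_def)
  show "\<one>\<^bsub>presented_group R\<^esub> \<otimes>\<^bsub>presented_group R\<^esub> A = A"
    by (simp add: one A mult_pres_class)
  have "\<exists>v. pres_eq R (v @ u) []"
  proof (induction u)
    case Nil
    have "pres_eq R ([] @ []) []" by (simp add: pres_refl)
    then show ?case by blast
  next
    case (Cons l u)
    then obtain v where v: "pres_eq R (v @ u) []" by blast
    obtain x s where l: "l = (x, s)" by (cases l)
    have "pres_eq R (v @ [(x, \<not> s), (x, \<not> \<not> s)] @ u) (v @ [] @ u)"
      by (rule pres_ctxt) (rule pres_cancel)
    then have "pres_eq R ((v @ [(x, \<not> s)]) @ l # u) (v @ u)"
      by (simp add: l)
    then have "pres_eq R ((v @ [(x, \<not> s)]) @ l # u) []"
      using v by (rule pres_trans)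
    then show ?case by blast
  qed
  then obtain v where "pres_eq R (v @ u) []" by blast
  then have "pres_class R v \<otimes>\<^bsub>presented_group R\<^esub> A = \<one>\<^bsub>presented_group R\<^esub>"
    by (simp add: A one mult_pres_class pres_class_eq_iff)
  moreover have "pres_class R v \<in> carrier (presented_group R)"
    by (simp add: presented_group_def)
  ultimately show "\<exists>B\<in>carrier (presented_group R).
      B \<otimes>\<^bsub>presented_group R\<^esub> A = \<one>\<^bsub>presented_group R\<^esub>"
    by blast
qed

text \<open>The free product of cyclic groups of orders \<open>m\<close> and \<open>n\<close>,
  as \<open>\<langle>a, b | a^m = b^n = 1\<rangle>\<close>.\<close>

datatype gen = GenA | GenB

definition cyclic_relators :: "nat \<Rightarrow> nat \<Rightarrow> gen word set" where
  "cyclic_relators m n = {replicate m (GenA, True), replicate n (GenB, True)}"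

definition free_prod_cyclic :: "nat \<Rightarrow> nat \<Rightarrow> gen word set monoid" where
  "free_prod_cyclic m n = presented_group (cyclic_relators m n)"

definition elt_a :: "nat \<Rightarrow> nat \<Rightarrow> gen word set" where
  "elt_a m n = pres_class (cyclic_relators m n) [(GenA, True)]"

definition elt_b :: "nat \<Rightarrow> nat \<Rightarrow> gen word set" where
  "elt_b m n = pres_class (cyclic_relators m n) [(GenB, True)]"


section \<open>Cayley graphs\<close>

text \<open>An undirected graph; an edge is the set of its two ends.\<close>

record 'v ugraph =
  verts :: "'v set"
  edges :: "'v set set"

definition cayley_graph :: "('v, 'z) monoid_scheme \<Rightarrow> 'v set \<Rightarrow> 'v ugraph" where
  "cayley_graph G S =
     \<lparr>verts = carrier G,
      edges = {{x, y} | x y. x \<in> carrier G \<and> y \<in> carrier G \<and> inv\<^bsub>G\<^esub> x \<otimes>\<^bsub>G\<^esub> y \<in> S}\<rparr>"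

definition spanning_subgraph :: "'v ugraph \<Rightarrow> 'v ugraph \<Rightarrow> bool" where
  "spanning_subgraph Y X \<longleftrightarrow> verts Y = verts X \<and> edges Y \<subseteq> edges X"

definition two_regular :: "'v ugraph \<Rightarrow> bool" where
  "two_regular Y \<longleftrightarrow> (\<forall>v\<in>verts Y. card {e \<in> edges Y. v \<in> e} = 2)"


section \<open>A graph as a 1-complex\<close>

text \<open>Points are given by barycentric coordinates: the closed cell spanned by a finite
  vertex set consists of the formal convex combinations of its elements. The space
  carries the weak topology with respect to its closed edges.\<close>

definition cell :: "'v set \<Rightarrow> ('v \<Rightarrow> real) set" where
  "cell s = {p. (\<forall>v. 0 \<le> p v) \<and> (\<forall>v. v \<notin> s \<longrightarrow> p v = 0) \<and> (\<Sum>v\<in>s. p v) = 1}"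

definition vertex_point :: "'v \<Rightarrow> 'v \<Rightarrow> real" where
  "vertex_point v = (\<lambda>w. if w = v then 1 else 0)"

definition complex_points :: "'v ugraph \<Rightarrow> ('v \<Rightarrow> real) set" where
  "complex_points X = vertex_point ` verts X \<union> (\<Union>e\<in>edges X. cell e)"

definition one_complex :: "'v ugraph \<Rightarrow> ('v \<Rightarrow> real) topology" where
  "one_complex X = topology (\<lambda>U. U \<subseteq> complex_points X \<and>
     (\<forall>e\<in>edges X. openin (top_of_set (cell e)) (U \<inter> cell e)))"

lemma openin_one_complex:
  "openin (one_complex X) U \<longleftrightarrow> U \<subseteq> complex_points X \<and>
     (\<forall>e\<in>edges X. openin (top_of_set (cell e)) (U \<inter> cell e))"
proof -
  have "istopology (\<lambda>U. U \<subseteq> complex_points X \<and>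
     (\<forall>e\<in>edges X. openin (top_of_set (cell e)) (U \<inter> cell e)))" (is "istopology ?P")
    unfolding istopology_def
  proof (intro conjI allI impI)
    fix S T assume ST: "?P S" "?P T"
    then show "S \<inter> T \<subseteq> complex_points X"
      by blast
    have "S \<inter> T \<inter> cell e = (S \<inter> cell e) \<inter> (T \<inter> cell e)" for e
      by blast
    then show "\<forall>e\<in>edges X. openin (top_of_set (cell e)) (S \<inter> T \<inter> cell e)"
      using ST by (simp add: openin_Int)
  next
    fix \<K> assume "\<forall>K\<in>\<K>. ?P K"
    then show "\<Union>\<K> \<subseteq> complex_points X"
      by blast
    show "\<forall>e\<in>edges X. openin (top_of_set (cell e)) (\<Union>\<K> \<inter> cell e)"
    proof
      fix e assume "e \<in> edges X"
      with \<open>\<forall>K\<in>\<K>. ?P K\<close> have "openin (top_of_set (cell e)) (\<Union>K\<in>\<K>. K \<inter> cell e)"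
        by (intro openin_Union) blast
      then show "openin (top_of_set (cell e)) (\<Union>\<K> \<inter> cell e)"
        by (simp only: Int_Union2)
    qed
  qed
  then show ?thesis
    by (simp add: one_complex_def topology_inverse')
qed

lemma topspace_one_complex [simp]: "topspace (one_complex X) = complex_points X"
proof -
  have "openin (one_complex X) (complex_points X)"
  proof -
    have "complex_points X \<inter> cell e = cell e" if "e \<in> edges X" for e
      using that unfolding complex_points_def by blast
    then show ?thesis
      by (simp add: openin_one_complex)
  qed
  moreover have "topspace (one_complex X) \<subseteq> complex_points X"
    using openin_topspace[of "one_complex X"] by (simp only: openin_one_complex)
  ultimately show ?thesis
    using openin_subset by blast
qed


section \<open>Freudenthal compactification\<close>

text \<open>An end chooses, compatibly, a component of the complement of each compact set;
  that is, it is an element of the inverse limit of these sets of components.\<close>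

definition space_ends :: "'p topology \<Rightarrow> ('p set \<Rightarrow> 'p set) set" where
  "space_ends T =
     {\<omega> \<in> (\<Pi>\<^sub>E K\<in>{K. compactin T K}. connected_components_of (subtopology T (topspace T - K))).
        \<forall>K L. compactin T K \<and> compactin T L \<and> K \<subseteq> L \<longrightarrow> \<omega> L \<subseteq> \<omega> K}"

definition freudenthal :: "'p topology \<Rightarrow> ('p + ('p set \<Rightarrow> 'p set)) topology" where
  "freudenthal T = topology_generated_by
     ({Inl ` U | U. openin T U} \<union>
      {Inl ` C \<union> Inr ` {\<omega> \<in> space_ends T. \<omega> K = C} | K C.
         compactin T K \<and> C \<in> connected_components_of (subtopology T (topspace T - K))})"

lemma topspace_freudenthal:
  "topspace (freudenthal T) = Inl ` topspace T \<union> Inr ` space_ends T"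
proof (intro subset_antisym subsetI)
  fix z assume "z \<in> topspace (freudenthal T)"
  then show "z \<in> Inl ` topspace T \<union> Inr ` space_ends T"
    by (fastforce simp: freudenthal_def dest: openin_subset connected_components_of_subset)
next
  fix z assume "z \<in> Inl ` topspace T \<union> Inr ` space_ends T"
  then consider (pt) "z \<in> Inl ` topspace T" | (lim) \<omega> where "z = Inr \<omega>" "\<omega> \<in> space_ends T"
    by blast
  then show "z \<in> topspace (freudenthal T)"
  proof cases
    case pt
    then show ?thesis by (auto simp: freudenthal_def)
  next
    case lim
    then have "\<omega> {} \<in> connected_components_of (subtopology T (topspace T - {}))"
      unfolding space_ends_def by (auto simp: PiE_def Pi_def)
    moreover have "compactin T {}"
      by simp
    ultimately have "Inl ` \<omega> {} \<union> Inr ` {\<omega>' \<in> space_ends T. \<omega>' {} = \<omega> {}} \<in>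
      {Inl ` C \<union> Inr ` {\<omega> \<in> space_ends T. \<omega> K = C} | K C.
         compactin T K \<and> C \<in> connected_components_of (subtopology T (topspace T - K))}"
      by blast
    moreover have "z \<in> Inl ` \<omega> {} \<union> Inr ` {\<omega>' \<in> space_ends T. \<omega>' {} = \<omega> {}}"
      using lim by simp
    ultimately show ?thesis
      unfolding freudenthal_def topology_generated_by_topspace by blast
  qed
qed


section \<open>Hamiltonian circles\<close>

abbreviation graph_compactification ::
    "'v ugraph \<Rightarrow> (('v \<Rightarrow> real) + (('v \<Rightarrow> real) set \<Rightarrow> ('v \<Rightarrow> real) set)) topology" where
  "graph_compactification X \<equiv> freudenthal (one_complex X)"

definition hamiltonian_circle ::
    "'v ugraph \<Rightarrow> (('v \<Rightarrow> real) + (('v \<Rightarrow> real) set \<Rightarrow> ('v \<Rightarrow> real) set)) set \<Rightarrow> bool" where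
  "hamiltonian_circle X C \<longleftrightarrow>
     C \<subseteq> topspace (graph_compactification X) \<and>
     subtopology (graph_compactification X) C homeomorphic_space top_of_set (sphere (0::complex) 1) \<and>
     (\<forall>v\<in>verts X. Inl (vertex_point v) \<in> C)"

text \<open>The identification of a hamiltonian circle \<open>C\<close> of \<open>X\<close> with the spanning 2-regular
  subgraph \<open>Y\<close> in which it meets \<open>X\<close>.\<close>

definition circle_meets_in ::
    "'v ugraph \<Rightarrow> (('v \<Rightarrow> real) + (('v \<Rightarrow> real) set \<Rightarrow> ('v \<Rightarrow> real) set)) set \<Rightarrow> 'v ugraph \<Rightarrow> bool" where
  "circle_meets_in X C Y \<longleftrightarrow>
     spanning_subgraph Y X \<and> two_regular Y \<and>
     C \<inter> Inl ` complex_points X = Inl ` complex_points Y"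

end

(*
  The graph is a tree of m-gons (the cosets of <a>) and 2n-gons (one for each coset of <b>), glued
  along the a-edges; each edge of the second kind, x -- x a b, lies on a single 2n-gon.  Deleting both
  ends of an a-edge therefore leaves vertices on either side, and a circle through all vertices that
  contained the a-edge would fall into three pieces when two of its points are removed.  A circle
  cannot stop inside an edge or at a vertex, so it contains every ab-edge, and being closed it contains
  every end.

  Conversely the ab-edges and the ends form a circle.  The group acts on the circle R/mZ: a is the
  rotation by 1, and b is the rotation by m in a second chart of length nm, in which the arc [m-1, m]
  is stretched to (n-1)m + 1 pieces.  In this picture an a-edge {g, ga} cuts off the arc g [0,1]; the
  2n-gon behind it divides the arc into (n-1)m + 1 equal pieces, which are alternately one ab-edge
  and m-1 smaller arcs of the same kind.  A point of the circle lies on an ab-edge or in an infinite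
  nested sequence of arcs, and in the latter case it is sent to the end that the arcs converge to.
  Since the action is defined on generators, no normal form theorem for the free product is needed.
*)
theory Submission
  imports Defs "HOL-Library.Real_Mod"
begin

section \<open>Circles\<close>

text \<open>The number (n-1)m + 1 is n + (n-1)(m-1): the 2n-gon behind an a-edge has n ab-edges, and
  each of its n-1 other a-edges is replaced by the m-1 remaining edges of its m-gon. The arc
  [m-1, m] belongs to the edge from a^-1 to 1, whose 2n-gon has the vertices b^j and b^j a^-1 and is
  the one that b turns. Once stretched, this arc and the m-1 other unit arcs have total length nm,
  and the turn by m takes each m-gon on this 2n-gon to the next. Distinctness of group elements is
  always read off from positions on the circle. The obstacle is at the boundaries. Arcs are
  half-open, so that those of one level are disjoint. Hence position m, where the last arc ends,
  needs a separate alternative that identifies it with 0, and a nested sequence of arcs might shrink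
  to an excluded right end. The latter does not happen because the last piece of every arc is an
  ab-edge. That vertices come arbitrarily near to every end is also read off from the loop, so the
  uniqueness proof rests on the circle built for existence.\<close>

lemma cis_eq_iff: "cis x = cis y \<longleftrightarrow> (\<exists>k::int. x = y + 2 * pi * k)"
  using sin_cos_eq_iff[of x y] by (auto simp: complex_eq_iff)

lemma cis_inj_on_half_open: "inj_on cis {t..<t + 2 * pi}"
proof (rule inj_onI)
  fix x y assume x: "x \<in> {t..<t + 2 * pi}" and y: "y \<in> {t..<t + 2 * pi}" and "cis x = cis y"
  then obtain k :: int where k: "x = y + 2 * pi * k" by (auto simp: cis_eq_iff)
  have "\<bar>2 * pi * real_of_int k\<bar> < 2 * pi * 1" using x y k by auto
  then have "\<bar>real_of_int k\<bar> < 1" by (simp add: abs_mult)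
  then have "k = 0" by linarith
  then show "x = y" using k by simp
qed

lemma cis_surj_half_open: "cis ` {t..<t + 2 * pi} = sphere 0 1"
proof
  show "cis ` {t..<t + 2 * pi} \<subseteq> sphere 0 1" by auto
  show "sphere 0 1 \<subseteq> cis ` {t..<t + 2 * pi}"
  proof
    fix z :: complex assume "z \<in> sphere 0 1"
    then have "cmod z = 1" by simp
    then have z: "z = cis (Arg z)" by (metis cis_Arg norm_zero sgn_eq zero_neq_one div_by_1 of_real_1)
    define k where "k = \<lfloor>(Arg z - t) / (2 * pi)\<rfloor>"
    have "k \<le> (Arg z - t) / (2 * pi)" "(Arg z - t) / (2 * pi) < k + 1" unfolding k_def by linarith+
    then have "2 * pi * k \<le> Arg z - t" "Arg z - t < 2 * pi * (k + 1)" by (simp_all add: field_simps)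
    then have "Arg z - 2 * pi * k \<in> {t..<t + 2 * pi}" by (auto simp: algebra_simps)
    moreover have "cis (Arg z - 2 * pi * k) = z"
      by (subst (2) z, subst cis_eq_iff) (auto intro!: exI[of _ "-k"])
    ultimately show "z \<in> cis ` {t..<t + 2 * pi}" by (metis image_eqI)
  qed
qed

text \<open>The map \<open>e\<close> wraps the interval onto the unit circle and identifies the same
  points as \<open>\<gamma>\<close>, namely the two ends. So \<open>\<gamma>\<close> factors through
  the circle, and a continuous injection of a compact space into a Hausdorff space is an
  embedding.\<close>

lemma loop_homeomorphic_circle:
  fixes \<gamma> :: "real \<Rightarrow> 'p" and r :: real
  assumes T: "Hausdorff_space T" and cont: "continuous_map (top_of_set {0..r}) T \<gamma>"
    and r: "0 < r" and loop: "\<gamma> 0 = \<gamma> r" and inj: "inj_on \<gamma> {0..<r}"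
  shows "subtopology T (\<gamma> ` {0..r}) homeomorphic_space top_of_set (sphere (0::complex) 1)"
proof -
  let ?I = "top_of_set {0..r}" and ?S = "top_of_set (sphere (0::complex) 1)"
  define e where "e t = cis (2 * pi * t / r)" for t
  have comp: "compact_space ?I"
    by (simp add: compact_space_subtopology)
  have e_cont: "continuous_map ?I ?S e"
    unfolding e_def using r by (auto intro!: continuous_intros)
  have e_eq: "e s = e t \<longleftrightarrow> s = t" if "s \<in> {0..<r}" "t \<in> {0..<r}" for s t
  proof -
    have "2 * pi * s / r \<in> {0..<0 + 2 * pi}" "2 * pi * t / r \<in> {0..<0 + 2 * pi}"
      using that r by (auto simp: field_simps)
    then show ?thesis
      unfolding e_def using inj_onD[OF cis_inj_on_half_open[of 0]] r by fastforce
  qed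
  have e0: "e 0 = e r" using r by (simp add: e_def complex_eq_iff)
  have e_surj: "e ` {0..r} = sphere 0 1"
  proof
    show "e ` {0..r} \<subseteq> sphere 0 1" by (auto simp: e_def)
    show "sphere 0 1 \<subseteq> e ` {0..r}"
    proof
      fix z :: complex assume "z \<in> sphere 0 1"
      then obtain u where u: "u \<in> {0..<0 + 2 * pi}" "z = cis u"
        using cis_surj_half_open[of 0] by blast
      have "z = e (u * r / (2 * pi))" using r u by (simp add: e_def)
      moreover have "u * r / (2 * pi) \<in> {0..r}" using u r by (auto simp: field_simps)
      ultimately show "z \<in> e ` {0..r}" by blast
    qed
  qed
  have fib: "e s = e t \<longleftrightarrow> \<gamma> s = \<gamma> t" if "s \<in> {0..r}" "t \<in> {0..r}" for s t
  proof -
    \<comment> \<open>Moving the right end to the left one reduces both identifications to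
      injectivity on the half-open interval.\<close>
    define w where "w x = (if x = r then 0 else x)" for x
    have w: "w x \<in> {0..<r}" "e (w x) = e x" "\<gamma> (w x) = \<gamma> x" if "x \<in> {0..r}" for x
      using that r e0 loop by (auto simp: w_def)
    have "e s = e t \<longleftrightarrow> w s = w t" using w that e_eq by metis
    also have "\<dots> \<longleftrightarrow> \<gamma> s = \<gamma> t" using w that inj by (metis inj_on_eq_iff)
    finally show ?thesis .
  qed
  have qe: "quotient_map ?I ?S e"
    by (rule continuous_imp_quotient_map[OF e_cont comp])
      (auto simp: e_surj Hausdorff_space_subtopology simp del: sphere_def)
  obtain h where h: "continuous_map ?S T h" "h ` topspace ?S = \<gamma> ` topspace ?I"
    "\<And>x. x \<in> topspace ?I \<Longrightarrow> h (e x) = \<gamma> x"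
    by (rule quotient_map_lift_exists[OF qe cont]) (use fib in auto)
  have "homeomorphic_map ?S (subtopology T (\<gamma> ` {0..r})) h"
  proof (rule continuous_imp_homeomorphic_map)
    show "continuous_map ?S (subtopology T (\<gamma> ` {0..r})) h"
      using h by (auto simp: continuous_map_in_subtopology)
    show "compact_space ?S" by (simp add: compact_space_subtopology)
    show "Hausdorff_space (subtopology T (\<gamma> ` {0..r}))" using T by (simp add: Hausdorff_space_subtopology)
    have "\<gamma> ` {0..r} \<subseteq> topspace T" using continuous_map_image_subset_topspace[OF cont] by simp
    then show "h ` topspace ?S = topspace (subtopology T (\<gamma> ` {0..r}))" using h(2) by auto
    show "inj_on h (topspace ?S)"
    proof (rule inj_onI)
      fix x y assume "x \<in> topspace ?S" "y \<in> topspace ?S" "h x = h y"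
      moreover from this obtain s t where "s \<in> {0..r}" "t \<in> {0..r}" "x = e s" "y = e t"
        using e_surj by (metis imageE topspace_euclidean_subtopology)
      ultimately show "x = y" using h(3) fib by simp
    qed
  qed
  then show ?thesis
    using homeomorphic_map_imp_homeomorphic_space homeomorphic_space_sym by blast
qed

lemma connected_punctured_circle:
  assumes "z \<in> sphere (0::complex) 1"
  shows "connected (sphere 0 1 - {z})"
proof -
  obtain t where t: "z = cis t" using assms cis_surj_half_open[of 0] by blast
  have "sphere 0 1 - {z} = cis ` {t..<t + 2 * pi} - cis ` {t}"
    by (simp add: cis_surj_half_open t)
  also have "\<dots> = cis ` ({t..<t + 2 * pi} - {t})"
    by (rule inj_on_image_set_diff[OF cis_inj_on_half_open, symmetric]) auto
  also have "{t..<t + 2 * pi} - {t} = {t<..<t + 2 * pi}" by auto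
  finally show ?thesis
    by (auto intro!: connected_continuous_image continuous_intros)
qed

text \<open>The pieces are the two open arcs between the points, the first of them empty if the
  points coincide. What counts later is that there are at most two.\<close>

lemma twice_punctured_circle:
  assumes "z \<in> sphere (0::complex) 1" "w \<in> sphere 0 1"
  obtains A B where "connected A" "connected B" "sphere 0 1 - {z, w} = A \<union> B"
proof -
  obtain t where t: "z = cis t" using assms cis_surj_half_open[of 0] by blast
  obtain s where s: "s \<in> {t..<t + 2 * pi}" "w = cis s"
    using assms(2) cis_surj_half_open[of t] by blast
  have "sphere 0 1 - {z, w} = cis ` {t..<t + 2 * pi} - cis ` {t, s}"
    by (simp add: cis_surj_half_open t s)
  also have "\<dots> = cis ` ({t..<t + 2 * pi} - {t, s})"
    using s by (intro inj_on_image_set_diff[OF cis_inj_on_half_open, symmetric]) auto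
  also have "{t..<t + 2 * pi} - {t, s} = {t<..<s} \<union> {s<..<t + 2 * pi}" using s by auto
  finally have "sphere 0 1 - {z, w} = cis ` {t<..<s} \<union> cis ` {s<..<t + 2 * pi}"
    by (simp add: image_Un)
  then show ?thesis
    by (rule that[rotated 2]) (auto intro!: connected_continuous_image continuous_intros)
qed

section \<open>Removing one or two points from a circle inside a space\<close>

locale circle_in =
  fixes T :: "'p topology" and C :: "'p set"
  assumes sub: "C \<subseteq> topspace T"
    and homeo: "subtopology T C homeomorphic_space top_of_set (sphere (0::complex) 1)"
begin

lemma compactin_circle: "compactin T C"
proof -
  have "compact_space (top_of_set (sphere (0::complex) 1))"
    by (simp add: compact_space_subtopology)
  then have "compact_space (subtopology T C)"
    using homeo homeomorphic_compact_space by blast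
  then show ?thesis using sub by (simp add: compactin_subspace)
qed

lemma obtain_homeo:
  obtains h where "homeomorphic_map (top_of_set (sphere (0::complex) 1)) (subtopology T C) h"
    "h ` sphere 0 1 = C" "inj_on h (sphere 0 1)"
proof -
  obtain h where h: "homeomorphic_map (top_of_set (sphere (0::complex) 1)) (subtopology T C) h"
    using homeo by (meson homeomorphic_space homeomorphic_space_sym)
  moreover have "h ` sphere 0 1 = C"
    using homeomorphic_imp_surjective_map[OF h] sub by (simp add: inf.absorb2)
  moreover have "inj_on h (sphere 0 1)"
    using homeomorphic_imp_injective_map[OF h] by simp
  ultimately show ?thesis using that by blast
qed

text \<open>The point may lie off the circle: the applications remove a point of an edge without
  knowing whether the circle contains it.\<close>

lemma connectedin_punctured: "connectedin T (C - {x})"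
proof (cases "x \<in> C")
  case x: True
  obtain h where h: "homeomorphic_map (top_of_set (sphere (0::complex) 1)) (subtopology T C) h"
    "h ` sphere 0 1 = C" "inj_on h (sphere 0 1)" by (rule obtain_homeo)
  obtain z where z: "z \<in> sphere 0 1" "h z = x" using h x by blast
  have "C - {x} = h ` (sphere 0 1 - {z})"
    using h z by (auto simp: inj_on_def)
  moreover have "connectedin (subtopology T C) (h ` (sphere 0 1 - {z}))"
    by (rule connectedin_continuous_map_image[OF homeomorphic_imp_continuous_map[OF h(1)]])
      (use connected_punctured_circle[OF z(1)] in \<open>auto simp: connectedin_subtopology\<close>)
  ultimately show ?thesis by (simp add: connectedin_subtopology)
next
  case False
  have "connected_space (top_of_set (sphere (0::complex) 1))"
    using connected_sphere[of "0::complex" 1] by (simp add: connected_space_subtopology)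
  then have "connected_space (subtopology T C)"
    using homeo homeomorphic_connected_space by blast
  then show ?thesis using sub False by (simp add: connectedin_def)
qed

lemma twice_punctured:
  assumes "x \<in> C" "y \<in> C"
  obtains A B where "connectedin T A" "connectedin T B" "C - {x, y} = A \<union> B"
proof -
  obtain h where h: "homeomorphic_map (top_of_set (sphere (0::complex) 1)) (subtopology T C) h"
    "h ` sphere 0 1 = C" "inj_on h (sphere 0 1)" by (rule obtain_homeo)
  obtain z w where zw: "z \<in> sphere 0 1" "h z = x" "w \<in> sphere 0 1" "h w = y" using h assms by blast
  obtain A B where AB: "connected A" "connected B" "sphere 0 1 - {z, w} = A \<union> B"
    using twice_punctured_circle zw by metis
  have "C - {x, y} = h ` (sphere 0 1 - {z, w})"
    using h zw by (auto simp: inj_on_def)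
  then have "C - {x, y} = h ` A \<union> h ` B" by (simp add: AB image_Un)
  moreover have "connectedin T (h ` A)" if "A \<subseteq> sphere 0 1" "connected A" for A
    using connectedin_continuous_map_image[OF homeomorphic_imp_continuous_map[OF h(1)], of A] that
    by (simp add: connectedin_subtopology)
  ultimately show ?thesis using AB that by (metis Diff_subset le_sup_iff)
qed

end

section \<open>The 1-complex of a locally finite graph\<close>

definition edge_point :: "'v \<Rightarrow> 'v \<Rightarrow> real \<Rightarrow> 'v \<Rightarrow> real" where
  "edge_point x y u = (\<lambda>w. (1 - u) * vertex_point x w + u * vertex_point y w)"

lemma vertex_point_inject [simp]: "vertex_point v = vertex_point w \<longleftrightarrow> v = w"
  by (auto simp: vertex_point_def fun_eq_iff split: if_splits)

lemma vertex_point_same [simp]: "vertex_point v v = 1"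
  by (simp add: vertex_point_def)

lemma edge_point_0 [simp]: "edge_point x y 0 = vertex_point x"
  and edge_point_1 [simp]: "edge_point x y 1 = vertex_point y"
  by (auto simp: edge_point_def)

lemma edge_point_sym: "edge_point x y u = edge_point y x (1 - u)"
  by (auto simp: edge_point_def)

lemma edge_point_apply:
  assumes "x \<noteq> y"
  shows "edge_point x y u x = 1 - u" "edge_point x y u y = u"
  using assms by (auto simp: edge_point_def vertex_point_def)

lemma edge_point_apply_other: "w \<noteq> x \<Longrightarrow> w \<noteq> y \<Longrightarrow> edge_point x y u w = 0"
  by (auto simp: edge_point_def vertex_point_def)

lemma cell_pair:
  assumes "x \<noteq> y"
  shows "cell {x, y} = edge_point x y ` {0..1}"
proof
  show "cell {x, y} \<subseteq> edge_point x y ` {0..1}"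
  proof
    fix p assume p: "p \<in> cell {x, y}"
    then have p1: "p x + p y = 1" "0 \<le> p x" "0 \<le> p y" "\<And>w. w \<noteq> x \<Longrightarrow> w \<noteq> y \<Longrightarrow> p w = 0"
      using assms by (auto simp: cell_def)
    have "p w = edge_point x y (p y) w" for w
      using edge_point_apply[OF assms] edge_point_apply_other[of w x y] p1
      by (cases "w = x"; cases "w = y") auto
    then have "p = edge_point x y (p y)" by blast
    moreover have "p y \<in> {0..1}" using p1 by auto
    ultimately show "p \<in> edge_point x y ` {0..1}" by blast
  qed
  show "edge_point x y ` {0..1} \<subseteq> cell {x, y}"
    using assms by (auto simp: cell_def edge_point_def vertex_point_def)
qed

lemma vertex_in_cell:
  assumes "x \<noteq> y"
  shows "vertex_point x \<in> cell {x, y}" "vertex_point y \<in> cell {x, y}"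
  using assms by (auto simp: cell_def vertex_point_def)

lemma continuous_on_edge_point: "continuous_on S (edge_point x y)"
  unfolding edge_point_def by (intro continuous_on_coordinatewise_then_product continuous_intros)

lemma continuous_on_apply: "continuous_on S (\<lambda>p::'v \<Rightarrow> real. p v)"
  by (rule continuous_on_subset[OF continuous_on_product_coordinates]) simp

lemma open_apply_greater: "open {p::'v \<Rightarrow> real. c < p v}"
  and open_apply_less: "open {p::'v \<Rightarrow> real. p v < c}"
  by (intro open_Collect_less continuous_on_apply continuous_on_const)+

text \<open>The weak topology is finer than that of pointwise convergence, so every coordinate is
  continuous on the complex. Hausdorffness and the open stars come from this.\<close>

lemma openin_one_complex_Int:
  assumes "open W"
  shows "openin (one_complex X) (complex_points X \<inter> W)"
proof -
  have "complex_points X \<inter> W \<inter> cell e = cell e \<inter> W" if "e \<in> edges X" for e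
    using that by (auto simp: complex_points_def)
  then show ?thesis using assms by (auto simp: openin_one_complex)
qed

lemma openin_apply_greater: "openin (one_complex X) {p \<in> complex_points X. c < p v}"
  using openin_one_complex_Int[OF open_apply_greater] by (simp add: Int_def)

lemma openin_apply_less: "openin (one_complex X) {p \<in> complex_points X. p v < c}"
  using openin_one_complex_Int[OF open_apply_less] by (simp add: Int_def)

lemma closedin_apply_ge: "closedin (one_complex X) {p \<in> complex_points X. c \<le> p v}"
proof -
  have "complex_points X - {p \<in> complex_points X. c \<le> p v} = {p \<in> complex_points X. p v < c}" by auto
  then show ?thesis using openin_apply_less by (auto simp: closedin_def)
qed

lemma Hausdorff_one_complex: "Hausdorff_space (one_complex X)"
  unfolding Hausdorff_space_def
proof (intro allI impI)
  have less: "\<exists>U V. openin (one_complex X) U \<and> openin (one_complex X) V \<and> p \<in> U \<and> q \<in> V \<and> disjnt U V"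
    if pq: "p \<in> complex_points X" "q \<in> complex_points X" "p v < q v" for p q v
  proof -
    obtain c where "p v < c" "c < q v" using dense[OF pq(3)] by blast
    then show ?thesis
      using pq openin_apply_less[of X v c] openin_apply_greater[of X c v]
      by (intro exI[of _ "{p \<in> complex_points X. p v < c}"] exI[of _ "{p \<in> complex_points X. c < p v}"])
        (auto simp: disjnt_def)
  qed
  fix p q assume "p \<in> topspace (one_complex X) \<and> q \<in> topspace (one_complex X) \<and> p \<noteq> q"
  moreover from this obtain v where "p v \<noteq> q v" by (auto simp: fun_eq_iff)
  then have "p v < q v \<or> q v < p v" by linarith
  ultimately show "\<exists>U V. openin (one_complex X) U \<and> openin (one_complex X) V \<and> p \<in> U \<and> q \<in> V \<and> disjnt U V"
    using less[of p q v] less[of q p v] unfolding topspace_one_complex by (meson disjnt_sym)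
qed

text \<open>The full subcomplex on \<open>V\<close>. It is the complement of the union of the open
  stars of all other vertices, and therefore closed.\<close>

definition subcomplex :: "'v ugraph \<Rightarrow> 'v set \<Rightarrow> ('v \<Rightarrow> real) set" where
  "subcomplex X V = {p \<in> complex_points X. \<forall>w. p w \<noteq> 0 \<longrightarrow> w \<in> V}"

definition star :: "'v ugraph \<Rightarrow> 'v set \<Rightarrow> ('v \<Rightarrow> real) set" where
  "star X V = {p \<in> complex_points X. \<exists>w\<in>V. 0 < p w}"

lemma openin_star: "openin (one_complex X) (star X V)"
proof -
  have "star X V = (\<Union>w\<in>V. {p \<in> complex_points X. 0 < p w})" by (auto simp: star_def)
  then show ?thesis by (auto intro: openin_apply_greater)
qed

section \<open>Compact and connected sets in the complex of a locally finite graph\<close>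

locale lf_graph =
  fixes X :: "'v ugraph"
  assumes edge: "e \<in> edges X \<Longrightarrow> \<exists>x\<in>verts X. \<exists>y\<in>verts X. x \<noteq> y \<and> e = {x, y}"
    and loc_fin: "finite {e \<in> edges X. v \<in> e}"
begin

abbreviation "T \<equiv> one_complex X"
abbreviation "P \<equiv> complex_points X"

lemma edge_neq: "{x, y} \<in> edges X \<Longrightarrow> x \<noteq> y"
  using edge[of "{x, y}"] by (auto simp: doubleton_eq_iff)

lemma edge_verts: "{x, y} \<in> edges X \<Longrightarrow> x \<in> verts X" "{x, y} \<in> edges X \<Longrightarrow> y \<in> verts X"
  using edge[of "{x, y}"] by (auto simp: doubleton_eq_iff)

lemma vertex_point_in [simp]: "vertex_point v \<in> P \<longleftrightarrow> v \<in> verts X"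
proof
  assume "vertex_point v \<in> P"
  then consider "v \<in> verts X" | e where "e \<in> edges X" "vertex_point v \<in> cell e"
    by (auto simp: complex_points_def)
  then show "v \<in> verts X"
  proof cases
    case 2
    then have "v \<in> e" by (auto simp: cell_def)
    then show ?thesis using 2 edge by blast
  qed
qed (auto simp: complex_points_def)

lemma cell_subset: "e \<in> edges X \<Longrightarrow> cell e \<subseteq> P"
  by (auto simp: complex_points_def)

lemma edge_point_in:
  assumes "{x, y} \<in> edges X" "0 \<le> u" "u \<le> 1"
  shows "edge_point x y u \<in> P"
  using cell_subset[OF assms(1)] cell_pair[OF edge_neq[OF assms(1)]] assms by auto

lemma point_cases:
  assumes "p \<in> P"
  obtains v where "v \<in> verts X" "p = vertex_point v"
  | x y u where "{x, y} \<in> edges X" "x \<noteq> y" "0 < u" "u < 1" "p = edge_point x y u"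
proof -
  consider "p \<in> vertex_point ` verts X" | e where "e \<in> edges X" "p \<in> cell e"
    using assms by (auto simp: complex_points_def)
  then show ?thesis
  proof cases
    case 1
    then show ?thesis using that by blast
  next
    case 2
    then obtain x y where xy: "x \<in> verts X" "y \<in> verts X" "x \<noteq> y" "e = {x, y}" using edge by blast
    then obtain u where u: "0 \<le> u" "u \<le> 1" "p = edge_point x y u"
      using 2 cell_pair[of x y] by auto
    consider "u = 0" | "u = 1" | "0 < u" "u < 1" using u by linarith
    then show ?thesis by cases (use that xy u 2 in auto)
  qed
qed

lemma point_nonneg:
  assumes "p \<in> P"
  shows "0 \<le> p v"
  using assms by (cases rule: point_cases) (simp_all add: vertex_point_def edge_point_def)

lemma point_pos_iff: "p \<in> P \<Longrightarrow> 0 < p v \<longleftrightarrow> p v \<noteq> 0"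
  using point_nonneg[of p v] by linarith

lemma point_support:
  assumes "p \<in> P"
  obtains v where "v \<in> verts X" "0 < p v"
  using assms
proof (cases rule: point_cases)
  case (1 v)
  then show ?thesis using that[of v] by simp
next
  case (2 x y u)
  then show ?thesis using that[of y] edge_verts edge_point_apply[of x y u] by simp
qed

text \<open>The support of a point of a 1-complex has at most two vertices, so two positive
  coordinates determine the edge.\<close>

lemma point_support_pair:
  assumes "p \<in> P" "0 < p x" "0 < p y" "x \<noteq> y"
  shows "{x, y} \<in> edges X \<and> p = edge_point x y (p y)"
  using assms(1)
proof (cases rule: point_cases)
  case (1 v)
  then have "x = v" "y = v" using assms by (auto simp: vertex_point_def split: if_splits)
  then show ?thesis using assms by auto
next
  case (2 x' y' u)
  have "x \<in> {x', y'}" "y \<in> {x', y'}"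
    using assms 2(5) edge_point_apply_other[of _ x' y' u] by fastforce+
  then consider "x = x'" "y = y'" | "x = y'" "y = x'" using assms by auto
  then show ?thesis
  proof cases
    case 1
    then show ?thesis using 2 edge_point_apply[of x' y' u] by simp
  next
    case swap: 2
    then have "p y = 1 - u" using 2 edge_point_apply[of x' y' u] by simp
    then show ?thesis using 2 swap edge_point_sym[of x' y' u] by (simp add: insert_commute)
  qed
qed

lemma cell_continuous:
  assumes "e \<in> edges X"
  shows "continuous_map (top_of_set (cell e)) T id"
  unfolding continuous_map_def
proof (intro conjI allI impI)
  show "id \<in> topspace (top_of_set (cell e)) \<rightarrow> topspace T" using cell_subset[OF assms] by auto
  fix U assume "openin T U"
  then have "openin (top_of_set (cell e)) (U \<inter> cell e)" using assms by (auto simp: openin_one_complex)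
  moreover have "{x \<in> topspace (top_of_set (cell e)). id x \<in> U} = U \<inter> cell e" by auto
  ultimately show "openin (top_of_set (cell e)) {x \<in> topspace (top_of_set (cell e)). id x \<in> U}" by simp
qed

lemma edge_path:
  assumes "{x, y} \<in> edges X"
  shows "continuous_map (top_of_set {0..1}) T (edge_point x y)"
proof -
  have "continuous_map (top_of_set {0..1}) (top_of_set (cell {x, y})) (edge_point x y)"
    by (auto simp: cell_pair[OF edge_neq[OF assms]] continuous_on_edge_point)
  then have "continuous_map (top_of_set {0..1}) T (id \<circ> edge_point x y)"
    by (rule continuous_map_compose[OF _ cell_continuous[OF assms]])
  then show ?thesis by simp
qed

lemma compactin_edge:
  assumes "{x, y} \<in> edges X" "0 \<le> s" "t \<le> 1"
  shows "compactin T (edge_point x y ` {s..t})"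
  by (rule image_compactin[OF _ edge_path[OF assms(1)]])
    (use assms in \<open>auto simp: compactin_subtopology\<close>)

lemma connectedin_edge:
  assumes "{x, y} \<in> edges X" "S \<subseteq> {0..1}" "connected S"
  shows "connectedin T (edge_point x y ` S)"
  by (rule connectedin_continuous_map_image[OF edge_path[OF assms(1)]])
    (use assms in \<open>auto simp: connectedin_subtopology\<close>)

lemma
  assumes "e \<in> edges X"
  shows compactin_cell: "compactin T (cell e)" and connectedin_cell: "connectedin T (cell e)"
proof -
  obtain x y where "x \<noteq> y" "e = {x, y}" using edge[OF assms] by blast
  then show "compactin T (cell e)" "connectedin T (cell e)"
    using compactin_edge[of x y 0 1] connectedin_edge[of x y "{0..1}"] assms
    by (simp_all add: cell_pair)
qed

text \<open>Positive coordinates at both ends force a point onto this edge, so a set that is open in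
  the whole function space cuts out the segment.\<close>

lemma open_segment:
  assumes e: "{x, y} \<in> edges X" and st: "0 \<le> s" "t \<le> 1"
  shows "openin T (edge_point x y ` {s<..<t})"
proof -
  let ?W = "{p. s < p y} \<inter> {p. p y < t} \<inter> {p. 0 < p x}"
  have xy: "x \<noteq> y" by (rule edge_neq[OF e])
  have "edge_point x y ` {s<..<t} = P \<inter> ?W"
  proof
    show "edge_point x y ` {s<..<t} \<subseteq> P \<inter> ?W"
      using edge_point_in[OF e] edge_point_apply[OF xy] st by auto
    show "P \<inter> ?W \<subseteq> edge_point x y ` {s<..<t}"
    proof
      fix p assume p: "p \<in> P \<inter> ?W"
      then have "p \<in> P" "0 < p x" "0 < p y" using st by auto
      then have "p = edge_point x y (p y)" using point_support_pair xy by blast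
      moreover have "p y \<in> {s<..<t}" using p by simp
      ultimately show "p \<in> edge_point x y ` {s<..<t}" by (rule image_eqI)
    qed
  qed
  moreover have "open ?W" by (intro open_Int open_apply_greater open_apply_less)
  ultimately show ?thesis using openin_one_complex_Int by metis
qed

text \<open>Local finiteness enters here: the set is a closed part of the finitely many cells at
  \<open>v\<close>.\<close>

lemma compactin_closed_star:
  assumes "0 < c" "v \<in> verts X"
  shows "compactin T {p \<in> P. c \<le> p v}"
proof -
  define K where "K = {vertex_point v} \<union> \<Union> (cell ` {e \<in> edges X. v \<in> e})"
  have "compactin T (\<Union> (cell ` {e \<in> edges X. v \<in> e}))"
    by (rule compactin_Union) (auto simp: loc_fin compactin_cell)
  then have K: "compactin T K"
    unfolding K_def using assms(2) by (intro compactin_Un) simp_all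
  have "p \<in> K" if p: "p \<in> P" "c \<le> p v" for p
    using p(1)
  proof (cases rule: point_cases)
    case (1 w)
    then have "w = v" using p(2) assms(1) by (simp add: vertex_point_def split: if_splits)
    then show ?thesis using 1 by (simp add: K_def)
  next
    case (2 x y u)
    have "p v \<noteq> 0" using p(2) assms(1) by linarith
    then have "v \<in> {x, y}" using edge_point_apply_other[of v x y u] unfolding 2(5) by blast
    moreover have "p \<in> cell {x, y}" using 2 by (simp add: cell_pair)
    ultimately show ?thesis using 2(1) unfolding K_def by blast
  qed
  then have "{p \<in> P. c \<le> p v} \<subseteq> K" by blast
  then have "K \<inter> {p \<in> P. c \<le> p v} = {p \<in> P. c \<le> p v}" by (rule Int_absorb1)
  then show ?thesis using compact_Int_closedin[OF K closedin_apply_ge[of X c v]] by simp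
qed

lemma closedin_subcomplex: "closedin T (subcomplex X V)"
proof -
  have "P - subcomplex X V = star X (- V)"
    by (auto simp: subcomplex_def star_def dest: point_pos_iff)
  then show ?thesis using openin_star[of X "- V"] by (auto simp: closedin_def subcomplex_def)
qed

text \<open>The open stars of single vertices cover the complex, and finitely many of them cover
  \<open>K\<close>. A subcomplex that contains none of these vertices then misses
  \<open>K\<close>.\<close>

lemma compact_finite_support:
  assumes "compactin T K"
  obtains F where "finite F" "F \<subseteq> verts X" "K \<subseteq> star X F"
proof -
  define \<U> where "\<U> = (\<lambda>w. star X {w}) ` verts X"
  have "K \<subseteq> \<Union>\<U>"
  proof
    fix p assume "p \<in> K"
    then have p: "p \<in> P" using compactin_subset_topspace[OF assms] by auto
    obtain v where "v \<in> verts X" "0 < p v" using point_support[OF p] by blast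
    then show "p \<in> \<Union>\<U>" using p by (auto simp: star_def \<U>_def)
  qed
  moreover have "openin T U" if "U \<in> \<U>" for U
    using that openin_star by (auto simp: \<U>_def)
  ultimately obtain \<F> where "finite \<F>" "\<F> \<subseteq> \<U>" "K \<subseteq> \<Union>\<F>"
    using compactinD[OF assms, of \<U>] by blast
  then obtain F where "F \<subseteq> verts X" "finite F" "\<F> = (\<lambda>w. star X {w}) ` F"
    unfolding \<U>_def by (meson finite_subset_image)
  moreover have "\<Union> ((\<lambda>w. star X {w}) ` F) = star X F" by (auto simp: star_def)
  ultimately show ?thesis using that \<open>K \<subseteq> \<Union>\<F>\<close> by simp
qed

text \<open>The complex is locally connected: a short segment of a cell around a point of
  \<open>D\<close> stays in \<open>U\<close>, is connected, and so stays in
  \<open>D\<close>.\<close>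

lemma openin_component:
  assumes U: "openin T U" and D: "D \<in> connected_components_of (subtopology T U)"
  shows "openin T D"
proof -
  have DU: "D \<subseteq> U" using connected_components_of_subset[OF D] by auto
  have "openin (top_of_set (cell e)) (D \<inter> cell e)" if e: "e \<in> edges X" for e
  proof -
    obtain x y where xy: "x \<noteq> y" "e = {x, y}" using edge[OF e] by blast
    have Ue: "openin (top_of_set (cell e)) (U \<inter> cell e)" using U e by (auto simp: openin_one_complex)
    then obtain W where W: "open W" "U \<inter> cell e = cell e \<inter> W" by (auto simp: openin_open)
    have "\<exists>V. openin (top_of_set (cell e)) V \<and> p \<in> V \<and> V \<subseteq> D \<inter> cell e" if p: "p \<in> D \<inter> cell e" for p
    proof -
      obtain u where u: "0 \<le> u" "u \<le> 1" "p = edge_point x y u" using p xy cell_pair[of x y] by auto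
      have "p \<in> W" using p W DU by blast
      moreover have "open (edge_point x y -` W)"
        using W(1) continuous_on_edge_point[of UNIV x y] by (simp add: open_vimage)
      ultimately obtain d where d: "0 < d" "ball u d \<subseteq> edge_point x y -` W"
        using u by (metis openE vimageI)
      \<comment> \<open>A ball in the parameter is cut out of the cell by bounds on the coordinate
        at \<open>y\<close>, which makes it relatively open.\<close>
      let ?B = "edge_point x y ` (ball u d \<inter> {0..1})"
      have B: "?B = cell e \<inter> ({q. u - d < q y} \<inter> {q. q y < u + d})"
        using xy by (auto simp: cell_pair edge_point_apply dist_real_def)
      then have open_B: "openin (top_of_set (cell e)) ?B"
        by (simp only: B) (intro openin_open_Int open_Int open_apply_greater open_apply_less)
      have "?B \<subseteq> W" using d(2) by blast
      moreover have "?B \<subseteq> cell e" by (simp only: B Int_lower1)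
      ultimately have "?B \<subseteq> U" using W(2) by blast
      moreover have "connectedin T ?B"
        using e xy by (intro connectedin_edge) (auto intro!: convex_connected convex_Int)
      moreover have "p \<in> ?B" using u d by auto
      ultimately have "?B \<subseteq> D"
        using p by (intro connected_components_of_maximal[OF D])
          (auto simp: connectedin_subtopology disjnt_iff)
      then show ?thesis using open_B \<open>p \<in> ?B\<close> B by blast
    qed
    then show ?thesis by (subst openin_subopen) blast
  qed
  moreover have "D \<subseteq> P" using DU openin_subset[OF U] by auto
  ultimately show ?thesis by (auto simp: openin_one_complex)
qed

lemma cell_subcomplex: "e \<in> edges X \<Longrightarrow> e \<subseteq> V \<Longrightarrow> cell e \<subseteq> subcomplex X V"
  by (auto simp: subcomplex_def cell_def complex_points_def)

lemma compactin_subcomplex: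
  assumes "finite V" "V \<subseteq> verts X"
  shows "compactin T (subcomplex X V)"
proof -
  define K where "K = vertex_point ` V \<union> \<Union> (cell ` (\<Union>v\<in>V. {e \<in> edges X. v \<in> e}))"
  have "compactin T (\<Union> (cell ` (\<Union>v\<in>V. {e \<in> edges X. v \<in> e})))"
    using assms(1) by (intro compactin_Union) (auto simp: loc_fin compactin_cell)
  moreover have "compactin T (vertex_point ` V)"
    using assms by (intro finite_imp_compactin) auto
  ultimately have K: "compactin T K" unfolding K_def by (intro compactin_Un)
  have "p \<in> K" if p: "p \<in> subcomplex X V" for p
  proof -
    have "p \<in> P" using p by (simp add: subcomplex_def)
    then show ?thesis
    proof (cases rule: point_cases)
      case (1 v)
      then show ?thesis using p by (auto simp: subcomplex_def vertex_point_def K_def)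
    next
      case (2 x y u)
      then have "x \<in> V" using p edge_point_apply(1)[OF 2(2), of u] by (auto simp: subcomplex_def)
      moreover have "p \<in> cell {x, y}" using 2 by (simp add: cell_pair)
      ultimately show ?thesis unfolding K_def using 2(1) by blast
    qed
  qed
  then have "K \<inter> subcomplex X V = subcomplex X V" by blast
  then show ?thesis using compact_Int_closedin[OF K closedin_subcomplex[of V]] by simp
qed

lemma vertex_in_subcomplex: "vertex_point v \<in> subcomplex X V \<longleftrightarrow> v \<in> verts X \<and> v \<in> V"
  by (auto simp: subcomplex_def) (auto simp: vertex_point_def split: if_splits)

text \<open>The connected subsets that contain the vertex \<open>g\<close> have a connected union;
  adding one cell at a time along paths shows that this union is everything.\<close>

lemma connectedin_subcomplex:
  assumes g: "g \<in> V" "g \<in> verts X"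
    and reach: "\<And>h. h \<in> V \<Longrightarrow> (\<lambda>x y. x \<in> V \<and> y \<in> V \<and> {x, y} \<in> edges X)\<^sup>*\<^sup>* g h"
  shows "connectedin T (subcomplex X V)"
proof -
  define \<C> where "\<C> = {S. connectedin T S \<and> vertex_point g \<in> S \<and> S \<subseteq> subcomplex X V}"
  have vert: "\<exists>S\<in>\<C>. vertex_point h \<in> S" if "h \<in> V" for h
    using reach[OF that]
  proof induction
    case base
    have "{vertex_point g} \<in> \<C>" using g by (simp add: \<C>_def vertex_in_subcomplex)
    then show ?case by blast
  next
    case (step y z)
    then obtain S where S: "S \<in> \<C>" "vertex_point y \<in> S" by blast
    have e: "{y, z} \<in> edges X" "{y, z} \<subseteq> V" using step by auto
    have yz: "vertex_point y \<in> cell {y, z}" "vertex_point z \<in> cell {y, z}"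
      using edge_neq[OF e(1)] by (auto simp: cell_def vertex_point_def)
    have "S \<union> cell {y, z} \<in> \<C>"
      using S yz(1) cell_subcomplex[OF e] connectedin_Un[of T S "cell {y, z}"] connectedin_cell[OF e(1)]
      by (auto simp: \<C>_def)
    then show ?case using yz(2) by (metis UnI2)
  qed
  have "\<Union>\<C> = subcomplex X V"
  proof
    show "\<Union>\<C> \<subseteq> subcomplex X V" by (auto simp: \<C>_def)
    show "subcomplex X V \<subseteq> \<Union>\<C>"
    proof
      fix p assume p: "p \<in> subcomplex X V"
      then have "p \<in> P" by (simp add: subcomplex_def)
      then show "p \<in> \<Union>\<C>"
      proof (cases rule: point_cases)
        case (1 v)
        then show ?thesis using p vert vertex_in_subcomplex by blast
      next
        case (2 x y u)
        then have "{x, y} \<subseteq> V" using p edge_point_apply[OF 2(2), of u] by (auto simp: subcomplex_def)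
        then obtain S where S: "S \<in> \<C>" "vertex_point x \<in> S" using vert by blast
        have x: "vertex_point x \<in> cell {x, y}"
          using 2 by (auto simp: cell_def vertex_point_def)
        have "S \<union> cell {x, y} \<in> \<C>"
          using S x cell_subcomplex[OF 2(1) \<open>{x, y} \<subseteq> V\<close>] connectedin_Un[of T S "cell {x, y}"]
            connectedin_cell[OF 2(1)]
          by (auto simp: \<C>_def)
        moreover have "p \<in> cell {x, y}" using 2 cell_pair[of x y] by auto
        ultimately show ?thesis by blast
      qed
    qed
  qed
  moreover have "connectedin T (\<Union>\<C>)"
    by (rule connectedin_Union) (auto simp: \<C>_def)
  ultimately show ?thesis by simp
qed

end

section \<open>Ends and the Freudenthal compactification\<close>

lemma connectedin_subset_disjoint_open:
  assumes "connectedin S D" "openin S U" "openin S V" "D \<subseteq> U \<union> V" "U \<inter> V \<inter> D = {}"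
  shows "D \<subseteq> U \<or> D \<subseteq> V"
  using assms unfolding connectedin by blast

lemma space_ends_component:
  assumes "\<omega> \<in> space_ends S" "compactin S K"
  shows "\<omega> K \<in> connected_components_of (subtopology S (topspace S - K))"
  using assms by (auto simp: space_ends_def PiE_def Pi_def)

lemma space_ends_mono:
  assumes "\<omega> \<in> space_ends S" "compactin S K" "compactin S L" "K \<subseteq> L"
  shows "\<omega> L \<subseteq> \<omega> K"
  using assms by (auto simp: space_ends_def)

lemma component_off_compact:
  assumes "C \<in> connected_components_of (subtopology S (topspace S - K))"
  shows "C \<subseteq> topspace S - K" "connectedin S C" "C \<noteq> {}"
  using connected_components_of_subset[OF assms] connectedin_connected_components_of[OF assms]
    nonempty_connected_components_of[OF assms]
  by (auto simp: connectedin_subtopology)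

lemma component_off_compact_maximal:
  assumes "C \<in> connected_components_of (subtopology S (topspace S - K))"
    and "connectedin S D" "D \<inter> K = {}" "C \<inter> D \<noteq> {}"
  shows "D \<subseteq> C"
  using assms connectedin_subset_topspace[OF assms(2)]
  by (intro connected_components_of_maximal[OF assms(1)]) (auto simp: connectedin_subtopology disjnt_def)

text \<open>Two components of one complement that meet are equal. On sets that are not compact both
  ends are \<open>undefined\<close>, being elements of an extensional product.\<close>

lemma space_ends_eqI:
  assumes "\<omega> \<in> space_ends S" "\<omega>' \<in> space_ends S" "\<And>K. compactin S K \<Longrightarrow> \<omega> K \<inter> \<omega>' K \<noteq> {}"
  shows "\<omega> = \<omega>'"
proof
  fix K
  show "\<omega> K = \<omega>' K"
  proof (cases "compactin S K")
    case True
    note c = space_ends_component[OF assms(1) True] and c' = space_ends_component[OF assms(2) True]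
    show ?thesis
      using component_off_compact_maximal[OF c component_off_compact(2)[OF c']]
        component_off_compact_maximal[OF c' component_off_compact(2)[OF c]]
        component_off_compact(1)[OF c] component_off_compact(1)[OF c'] assms(3)[OF True] by blast
  next
    case False
    then show ?thesis using assms(1,2) by (auto simp: space_ends_def PiE_def extensional_def)
  qed
qed

lemma openin_freudenthal_Inl: "openin S U \<Longrightarrow> openin (freudenthal S) (Inl ` U)"
  unfolding freudenthal_def by (rule topology_generated_by_Basis) blast

lemma openin_freudenthal_end:
  assumes "compactin S K" "C \<in> connected_components_of (subtopology S (topspace S - K))"
  shows "openin (freudenthal S) (Inl ` C \<union> Inr ` {\<omega> \<in> space_ends S. \<omega> K = C})"
  unfolding freudenthal_def by (rule topology_generated_by_Basis) (use assms in blast)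

text \<open>The set \<open>A\<close> together with the ends that live in it. This extends a
  separation of the complement of \<open>K\<close> from the space to its ends.\<close>

definition off_compact :: "'p topology \<Rightarrow> 'p set \<Rightarrow> 'p set \<Rightarrow> ('p + ('p set \<Rightarrow> 'p set)) set" where
  "off_compact S K A = Inl ` A \<union> Inr ` {\<omega> \<in> space_ends S. \<omega> K \<subseteq> A}"

lemma component_in_part:
  assumes "openin S A" "openin S B" "A \<inter> B = {}" "A \<union> B = topspace S - K"
    and C: "C \<in> connected_components_of (subtopology S (topspace S - K))"
  shows "C \<subseteq> A \<or> C \<subseteq> B"
  using assms component_off_compact(1)[OF C]
  by (intro connectedin_subset_disjoint_open[OF component_off_compact(2)[OF C]]) auto

lemma openin_off_compact:
  assumes K: "compactin S K" and "openin S A" "openin S B" "A \<inter> B = {}" "A \<union> B = topspace S - K"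
  shows "openin (freudenthal S) (off_compact S K A)"
proof -
  define \<C> where "\<C> = {C \<in> connected_components_of (subtopology S (topspace S - K)). C \<subseteq> A}"
  have "\<Union>\<C> = A"
  proof
    show "A \<subseteq> \<Union>\<C>"
    proof
      fix p assume "p \<in> A"
      moreover from this have "p \<in> \<Union> (connected_components_of (subtopology S (topspace S - K)))"
        unfolding Union_connected_components_of using assms by auto
      ultimately show "p \<in> \<Union>\<C>"
        using component_in_part[OF assms(2-5)] assms(4) unfolding \<C>_def by blast
    qed
  qed (auto simp: \<C>_def)
  moreover have "{\<omega> \<in> space_ends S. \<omega> K \<subseteq> A} = {\<omega> \<in> space_ends S. \<omega> K \<in> \<C>}"
    using space_ends_component[OF _ K] by (auto simp: \<C>_def)
  ultimately have "off_compact S K A = Inl ` \<Union>\<C> \<union> Inr ` {\<omega> \<in> space_ends S. \<omega> K \<in> \<C>}"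
    by (simp only: off_compact_def)
  then have "off_compact S K A = (\<Union>C\<in>\<C>. Inl ` C \<union> Inr ` {\<omega> \<in> space_ends S. \<omega> K = C})"
    by auto
  moreover have "openin (freudenthal S) (\<Union>C\<in>\<C>. Inl ` C \<union> Inr ` {\<omega> \<in> space_ends S. \<omega> K = C})"
    by (rule openin_Union) (auto simp: \<C>_def intro!: openin_freudenthal_end[OF K])
  ultimately show ?thesis by simp
qed

text \<open>Every end chooses a nonempty connected component off \<open>K\<close>, which lies in
  exactly one of the two parts.\<close>

lemma off_compact_cover:
  assumes K: "compactin S K" and "openin S A" "openin S B" "A \<inter> B = {}" "A \<union> B = topspace S - K"
  shows "off_compact S K A \<union> off_compact S K B = topspace (freudenthal S) - Inl ` K"
    "off_compact S K A \<inter> off_compact S K B = {}"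
proof -
  have "\<omega> K \<subseteq> A \<or> \<omega> K \<subseteq> B" "\<omega> K \<noteq> {}" if "\<omega> \<in> space_ends S" for \<omega>
    using component_in_part[OF assms(2-5) space_ends_component[OF that K]]
      component_off_compact(3)[OF space_ends_component[OF that K]] by auto
  then have ends: "{\<omega> \<in> space_ends S. \<omega> K \<subseteq> A} \<union> {\<omega> \<in> space_ends S. \<omega> K \<subseteq> B} = space_ends S" by blast
  have un: "Inl ` A \<union> Inr ` EA \<union> (Inl ` B \<union> Inr ` EB) = Inl ` (A \<union> B) \<union> Inr ` (EA \<union> EB)" for EA EB
    by auto
  have "off_compact S K A \<union> off_compact S K B = Inl ` (A \<union> B) \<union> Inr ` space_ends S"
    by (simp only: off_compact_def un ends)
  then show "off_compact S K A \<union> off_compact S K B = topspace (freudenthal S) - Inl ` K"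
    using compactin_subset_topspace[OF K] by (auto simp: assms(5) topspace_freudenthal)
  have "\<omega> K \<noteq> {}" if "\<omega> \<in> space_ends S" for \<omega>
    using component_off_compact(3)[OF space_ends_component[OF that K]] .
  then show "off_compact S K A \<inter> off_compact S K B = {}"
    using assms(4) by (fastforce simp: off_compact_def)
qed

section \<open>The compactification of a locally finite graph is Hausdorff\<close>

context lf_graph
begin

abbreviation "F \<equiv> freudenthal T"

lemma openin_compact_component:
  assumes K: "compactin T K" and C: "C \<in> connected_components_of (subtopology T (P - K))"
  shows "openin T C"
proof -
  have "closedin T K" using compactin_imp_closedin[OF Hausdorff_one_complex K] .
  then have "openin T (P - K)" by (simp add: closedin_def)
  then show ?thesis using openin_component C by blast
qed

text \<open>A basic neighbourhood of an end meets the complex in a component off a compact set, and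
  such a component is open by local connectedness.\<close>

lemma continuous_map_Inl: "continuous_map T F Inl"
  unfolding freudenthal_def continuous_on_generated_topo_iff
proof (intro conjI allI impI)
  let ?B = "{Inl ` U |U. openin T U} \<union>
     {Inl ` C \<union> Inr ` {\<omega> \<in> space_ends T. \<omega> K = C} |K C.
      compactin T K \<and> C \<in> connected_components_of (subtopology T (topspace T - K))}"
  fix W :: "(('v \<Rightarrow> real) + (('v \<Rightarrow> real) set \<Rightarrow> ('v \<Rightarrow> real) set)) set"
  assume "W \<in> ?B"
  then consider U where "openin T U" "W = Inl ` U"
    | K C where "compactin T K" "C \<in> connected_components_of (subtopology T (P - K))"
      "W = Inl ` C \<union> Inr ` {\<omega> \<in> space_ends T. \<omega> K = C}"
    unfolding topspace_one_complex by blast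
  then have "\<exists>U. openin T U \<and> Inl -` W = U"
  proof cases
    case 1
    then show ?thesis by (auto simp: vimage_def image_iff)
  next
    case 2
    then have "Inl -` W = C" by auto
    then show ?thesis using openin_compact_component[OF 2(1,2)] by blast
  qed
  then obtain U where U: "openin T U" "Inl -` W = U" by blast
  then show "openin T (Inl -` W \<inter> topspace T)" using openin_subset[of T U] by (simp add: inf.absorb1)
next
  have "Inl ` topspace T \<in> {Inl ` U |U. openin T U}" by blast
  then show "Inl ` topspace T \<subseteq> \<Union> ({Inl ` U |U. openin T U} \<union>
     {Inl ` C \<union> Inr ` {\<omega> \<in> space_ends T. \<omega> K = C} |K C.
      compactin T K \<and> C \<in> connected_components_of (subtopology T (topspace T - K))})" by blast
qed

text \<open>Half the value of a positive coordinate of \<open>p\<close> bounds a compact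
  neighbourhood of \<open>p\<close>. The component that the end chooses outside it gives the other
  neighbourhood.\<close>

lemma separate_point_end:
  assumes p: "p \<in> P" and \<omega>: "\<omega> \<in> space_ends T"
  shows "\<exists>U V. openin F U \<and> openin F V \<and> Inl p \<in> U \<and> Inr \<omega> \<in> V \<and> disjnt U V"
proof -
  obtain v where v: "v \<in> verts X" "0 < p v" using point_support[OF p] .
  define K where "K = {q \<in> P. p v / 2 \<le> q v}"
  define U where "U = {q \<in> P. p v / 2 < q v}"
  have K: "compactin T K" unfolding K_def using v by (intro compactin_closed_star) auto
  note C = space_ends_component[OF \<omega> K]
  have "openin F (Inl ` U)"
    unfolding U_def by (intro openin_freudenthal_Inl openin_apply_greater)
  moreover have "openin F (Inl ` \<omega> K \<union> Inr ` {\<omega>' \<in> space_ends T. \<omega>' K = \<omega> K})"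
    by (rule openin_freudenthal_end[OF K C])
  moreover have "Inl p \<in> Inl ` U" using p v by (simp add: U_def)
  moreover have "disjnt (Inl ` U) (Inl ` \<omega> K \<union> Inr ` {\<omega>' \<in> space_ends T. \<omega>' K = \<omega> K})"
    using component_off_compact(1)[OF C] by (auto simp: disjnt_iff U_def K_def)
  ultimately show ?thesis using \<omega> by (metis (mono_tags, lifting) UnI2 image_eqI mem_Collect_eq)
qed

lemma separate_ends:
  assumes \<omega>: "\<omega> \<in> space_ends T" "\<omega>' \<in> space_ends T" "\<omega> \<noteq> \<omega>'"
  shows "\<exists>U V. openin F U \<and> openin F V \<and> Inr \<omega> \<in> U \<and> Inr \<omega>' \<in> V \<and> disjnt U V"
proof -
  obtain K where K: "compactin T K" "\<omega> K \<inter> \<omega>' K = {}" using space_ends_eqI \<omega> by blast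
  let ?U = "\<lambda>\<omega>. Inl ` \<omega> K \<union> Inr ` {\<omega>' \<in> space_ends T. \<omega>' K = \<omega> K}"
  have "openin F (?U \<omega>)" "openin F (?U \<omega>')"
    using openin_freudenthal_end[OF K(1) space_ends_component[OF _ K(1)]] \<omega> by blast+
  moreover have "\<omega> K \<noteq> {}" using component_off_compact(3)[OF space_ends_component[OF \<omega>(1) K(1)]] .
  then have "disjnt (?U \<omega>) (?U \<omega>')" using K(2) by (auto simp: disjnt_iff)
  moreover have "Inr \<omega> \<in> ?U \<omega>" "Inr \<omega>' \<in> ?U \<omega>'" using \<omega> by auto
  ultimately show ?thesis by blast
qed

lemma Hausdorff_freudenthal: "Hausdorff_space F"
  unfolding Hausdorff_space_def
proof (intro allI impI)
  fix x y assume xy: "x \<in> topspace F \<and> y \<in> topspace F \<and> x \<noteq> y"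
  show "\<exists>U V. openin F U \<and> openin F V \<and> x \<in> U \<and> y \<in> V \<and> disjnt U V"
  proof (cases x; cases y)
    fix p q assume pq: "x = Inl p" "y = Inl q"
    then have "p \<in> topspace T \<and> q \<in> topspace T \<and> p \<noteq> q" using xy by (auto simp: topspace_freudenthal)
    then have "\<exists>U V. openin T U \<and> openin T V \<and> p \<in> U \<and> q \<in> V \<and> disjnt U V"
      by (rule Hausdorff_one_complex[unfolded Hausdorff_space_def, rule_format])
    then obtain U V where UV: "openin T U" "openin T V" "p \<in> U" "q \<in> V" "disjnt U V" by blast
    have "openin F (Inl ` U)" "openin F (Inl ` V)" using UV openin_freudenthal_Inl by blast+
    moreover have "disjnt (Inl ` U) (Inl ` V)" using UV by (auto simp: disjnt_iff)
    ultimately show ?thesis using pq UV by blast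
  next
    fix p \<omega> assume "x = Inl p" "y = Inr \<omega>"
    then show ?thesis using separate_point_end[of p \<omega>] xy by (auto simp: topspace_freudenthal)
  next
    fix p \<omega> assume "x = Inr \<omega>" "y = Inl p"
    then show ?thesis using separate_point_end[of p \<omega>] xy
      by (auto simp: topspace_freudenthal) (meson disjnt_sym)
  next
    fix \<omega> \<omega>' assume "x = Inr \<omega>" "y = Inr \<omega>'"
    then show ?thesis using separate_ends[of \<omega> \<omega>'] xy by (auto simp: topspace_freudenthal)
  qed
qed

lemma closedin_Inl: "compactin T K \<Longrightarrow> closedin F (Inl ` K)"
  using compactin_imp_closedin[OF Hausdorff_freudenthal image_compactin[OF _ continuous_map_Inl]] .

text \<open>\<open>U\<close> and the complement of \<open>K\<close> are disjoint open sets that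
  cover \<open>D\<close>. With a closed segment or a closed half-star as \<open>K\<close> and its
  interior as \<open>U\<close>, this shows that a circle cannot stop inside an edge or at a
  vertex.\<close>

lemma connectedin_trapped:
  assumes D: "connectedin F D" and U: "openin T U" and K: "compactin T K" and "U \<subseteq> K"
    and "D \<inter> Inl ` K \<subseteq> Inl ` U" "D \<inter> Inl ` U \<noteq> {}"
  shows "D \<subseteq> Inl ` U"
proof -
  have "openin F (topspace F - Inl ` K)" using closedin_Inl[OF K] by (simp add: closedin_def)
  then have "D \<subseteq> Inl ` U \<or> D \<subseteq> topspace F - Inl ` K"
    using connectedin_subset_topspace[OF D] assms
    by (intro connectedin_subset_disjoint_open[OF D openin_freudenthal_Inl[OF U]]) auto
  then show ?thesis using assms by blast
qed

end

section \<open>Which edges a circle through all vertices can use\<close>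

locale graph_circle = lf_graph X + circle_in "freudenthal (one_complex X)" C
  for X :: "'v ugraph" and C +
  assumes verts_in: "v \<in> verts X \<Longrightarrow> Inl (vertex_point v) \<in> C"
begin

text \<open>If the circle met the edge at \<open>u\<close> but not at \<open>w\<close>, then
  removing a point \<open>w'\<close> beyond \<open>u\<close> would trap the connected rest strictly
  between \<open>w\<close> and \<open>w'\<close>, although it contains the vertex
  \<open>x\<close>.\<close>

lemma open_edge_in_less:
  assumes e: "{x, y} \<in> edges X" and uw: "0 < w" "w < u" "u < 1" and u: "Inl (edge_point x y u) \<in> C"
  shows "Inl (edge_point x y w) \<in> C"
proof (rule ccontr)
  assume w: "Inl (edge_point x y w) \<notin> C"
  have inj: "edge_point x y s = edge_point x y t \<longleftrightarrow> s = t" for s t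
    using edge_point_apply(2)[OF edge_neq[OF e]] by metis
  obtain w' where w': "u < w'" "w' < 1" using dense uw by blast
  define D where "D = C - {Inl (edge_point x y w')}"
  have D1: "connectedin F D" unfolding D_def by (rule connectedin_punctured)
  have D2: "openin T (edge_point x y ` {w<..<w'})" using uw w' by (intro open_segment[OF e]) auto
  have D3: "compactin T (edge_point x y ` {w..w'})" using uw w' by (intro compactin_edge[OF e]) auto
  have D4: "D \<inter> Inl ` edge_point x y ` {w..w'} \<subseteq> Inl ` edge_point x y ` {w<..<w'}"
  proof
    fix z assume z: "z \<in> D \<inter> Inl ` edge_point x y ` {w..w'}"
    then obtain t where t: "t \<in> {w..w'}" "z = Inl (edge_point x y t)" by blast
    have "t \<noteq> w" "t \<noteq> w'" using z w t by (auto simp: D_def)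
    then show "z \<in> Inl ` edge_point x y ` {w<..<w'}" using t by auto
  qed
  have "Inl (edge_point x y u) \<in> D" "Inl (edge_point x y u) \<in> Inl ` edge_point x y ` {w<..<w'}"
    using u uw w' inj by (auto simp: D_def)
  then have D5: "D \<inter> Inl ` edge_point x y ` {w<..<w'} \<noteq> {}" by (metis IntI empty_iff)
  have "edge_point x y ` {w<..<w'} \<subseteq> edge_point x y ` {w..w'}" by (intro image_mono) auto
  then have "D \<subseteq> Inl ` edge_point x y ` {w<..<w'}" by (rule connectedin_trapped[OF D1 D2 D3 _ D4 D5])
  moreover have "Inl (edge_point x y 0) \<in> D"
    using verts_in[OF edge_verts(1)[OF e]] inj[of 0 w'] w' uw by (auto simp: D_def)
  ultimately obtain t where "t \<in> {w<..<w'}" "edge_point x y 0 = edge_point x y t" by blast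
  then show False using inj[of 0 t] uw by simp
qed

lemma open_edge_in:
  assumes e: "{x, y} \<in> edges X" and "0 < u" "u < 1" "Inl (edge_point x y u) \<in> C" "0 < w" "w < 1"
  shows "Inl (edge_point x y w) \<in> C"
proof -
  consider "w < u" | "w = u" | "1 - w < 1 - u" by linarith
  then show ?thesis
  proof cases
    case 1
    then show ?thesis using open_edge_in_less assms by blast
  next
    case 3
    have "Inl (edge_point y x (1 - w)) \<in> C"
      using 3 assms edge_point_sym[of x y u]
      by (intro open_edge_in_less[of y x "1 - w" "1 - u"]) (auto simp: insert_commute)
    then show ?thesis using edge_point_sym[of x y w] by simp
  qed (use assms in simp)
qed

text \<open>Otherwise removing the midpoint of the edge from \<open>v\<close> to \<open>y\<close>
  would trap the rest of the circle in the open half-star of \<open>v\<close>, which does not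
  contain \<open>y\<close>.\<close>

lemma second_edge:
  assumes e: "{v, y} \<in> edges X"
  shows "\<exists>z u. {v, z} \<in> edges X \<and> z \<noteq> y \<and> 0 < u \<and> u < 1 \<and> Inl (edge_point v z u) \<in> C"
proof (rule ccontr)
  assume none: "\<not> ?thesis"
  have vy: "v \<noteq> y" using edge_neq[OF e] .
  define D where "D = C - {Inl (edge_point v y (1 / 2))}"
  have D1: "connectedin F D" unfolding D_def by (rule connectedin_punctured)
  have D2: "openin T {p \<in> P. 1 / 2 < p v}" by (rule openin_apply_greater)
  have D3: "compactin T {p \<in> P. 1 / 2 \<le> p v}"
    by (rule compactin_closed_star) (use edge_verts[OF e] in auto)
  have D4: "D \<inter> Inl ` {p \<in> P. 1 / 2 \<le> p v} \<subseteq> Inl ` {p \<in> P. 1 / 2 < p v}"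
  proof
    fix z assume "z \<in> D \<inter> Inl ` {p \<in> P. 1 / 2 \<le> p v}"
    then obtain p where p: "z = Inl p" "p \<in> P" "1 / 2 \<le> p v" "Inl p \<in> C" "p \<noteq> edge_point v y (1 / 2)"
      by (auto simp: D_def)
    \<comment> \<open>A point with coordinate one half at \<open>v\<close> is the midpoint of an
      edge at \<open>v\<close>; by \<open>none\<close> the circle could contain only the one that
      has been removed.\<close>
    have "p v \<noteq> 1 / 2"
    proof
      assume half: "p v = 1 / 2"
      have "\<exists>x. {v, x} \<in> edges X \<and> p = edge_point v x (1 / 2)"
        using p(2)
      proof (cases rule: point_cases)
        case (1 w)
        then show ?thesis using half by (simp add: vertex_point_def split: if_splits)
      next
        case (2 x x' u)
        have "v \<in> {x, x'}" using half edge_point_apply_other[of v x x' u] unfolding 2(5) by auto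
        then consider "v = x" | "v = x'" by blast
        then show ?thesis
        proof cases
          case 1
          then have "u = 1 / 2" using 2 half edge_point_apply(1)[OF 2(2), of u] by simp
          then show ?thesis using 1 2 by blast
        next
          case right: 2
          then have "u = 1 / 2" using 2 half edge_point_apply(2)[OF 2(2), of u] by simp
          then have "p = edge_point v x (1 / 2)"
            using edge_point_sym[of x x' "1 / 2"] unfolding 2(5) \<open>u = 1 / 2\<close> right by simp
          then show ?thesis using 2 right by (auto simp: insert_commute)
        qed
      qed
      then obtain x where "{v, x} \<in> edges X" "p = edge_point v x (1 / 2)" by blast
      moreover have "x = y"
      proof (rule ccontr)
        assume "x \<noteq> y"
        then have "{v, x} \<in> edges X \<and> x \<noteq> y \<and> 0 < (1 / 2 :: real) \<and> (1 / 2 :: real) < 1 \<and>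
          Inl (edge_point v x (1 / 2)) \<in> C"
          using calculation p(4) by simp
        then show False using none by blast
      qed
      ultimately show False using p(5) by simp
    qed
    then show "z \<in> Inl ` {p \<in> P. 1 / 2 < p v}" using p by auto
  qed
  have "vertex_point v v \<noteq> edge_point v y (1 / 2) v" using edge_point_apply(1)[OF vy, of "1/2"] by simp
  then have "vertex_point v \<noteq> edge_point v y (1 / 2)" by metis
  then have m1: "Inl (vertex_point v) \<in> D" using verts_in edge_verts(1)[OF e] by (simp add: D_def)
  have m2: "vertex_point v \<in> {p \<in> P. 1 / 2 < p v}" using edge_verts(1)[OF e] by simp
  have D5: "D \<inter> Inl ` {p \<in> P. 1 / 2 < p v} \<noteq> {}"
    using IntI[OF m1 imageI[OF m2, of Inl]] by (metis empty_iff)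
  have "{p \<in> P. 1 / 2 < p v} \<subseteq> {p \<in> P. 1 / 2 \<le> p v}" by auto
  then have "D \<subseteq> Inl ` {p \<in> P. 1 / 2 < p v}" by (rule connectedin_trapped[OF D1 D2 D3 _ D4 D5])
  moreover have "Inl (vertex_point y) \<in> D"
  proof -
    have "vertex_point y v \<noteq> edge_point v y (1 / 2) v"
      using vy edge_point_apply(1)[OF vy, of "1/2"] by (simp add: vertex_point_def)
    then have "vertex_point y \<noteq> edge_point v y (1 / 2)" by metis
    then show ?thesis using verts_in edge_verts[OF e] by (simp add: D_def)
  qed
  ultimately have "1 / 2 < vertex_point y v" by auto
  then show False using vy by (simp add: vertex_point_def)
qed

text \<open>Without the two ends of the edge at most two connected pieces of the circle remain, but
  the two sides and the open edge would be three disjoint open sets, each containing a point of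
  it.\<close>

lemma separating_edge_not_in:
  assumes e: "{x, y} \<in> edges X"
    and AB: "openin T A" "openin T B" "A \<inter> B = {}" "A \<union> B = P - cell {x, y}"
    and v: "v \<in> verts X" "vertex_point v \<in> A" and w: "w \<in> verts X" "vertex_point w \<in> B"
    and u: "0 < u" "u < 1"
  shows "Inl (edge_point x y u) \<notin> C"
proof
  assume uC: "Inl (edge_point x y u) \<in> C"
  let ?K = "cell {x, y}"
  define Q where "Q = edge_point x y ` {0<..<1}"
  have K: "compactin T ?K" by (rule compactin_cell[OF e])
  have xy: "Inl (vertex_point x) \<in> C" "Inl (vertex_point y) \<in> C"
    using verts_in edge_verts[OF e] by auto
  obtain D1 D2 where D: "connectedin F D1" "connectedin F D2"
    "C - {Inl (vertex_point x), Inl (vertex_point y)} = D1 \<union> D2" by (rule twice_punctured[OF xy])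
  define O1 O2 where "O1 = off_compact T ?K A" and "O2 = off_compact T ?K B"
  define O3 :: "(('v \<Rightarrow> real) + (('v \<Rightarrow> real) set \<Rightarrow> ('v \<Rightarrow> real) set)) set"
    where "O3 = Inl ` Q"
  have AB': "A \<union> B = topspace T - ?K" using AB by simp
  have op: "openin F O1" "openin F O2" "openin F O3"
    using openin_off_compact[OF K AB(1,2,3) AB'] openin_off_compact[OF K AB(2,1)] AB(3) AB'
      openin_freudenthal_Inl[OF open_segment[OF e, of 0 1]]
    unfolding O1_def O2_def O3_def Q_def by (auto simp: Int_commute Un_commute)
  have cover: "O1 \<union> O2 = topspace F - Inl ` ?K" "O1 \<inter> O2 = {}"
    using off_compact_cover[OF K AB(1,2,3) AB'] unfolding O1_def O2_def by auto
  have "{0..1} = insert 0 (insert 1 {0<..<1::real})" by auto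
  then have cell_eq: "?K = insert (vertex_point x) (insert (vertex_point y) Q)"
    by (simp add: cell_pair[OF edge_neq[OF e]] Q_def)
  have disj: "O1 \<inter> O3 = {}" "O2 \<inter> O3 = {}" using cover cell_eq by (auto simp: O3_def)
  have "C \<subseteq> topspace F" by (rule sub)
  then have DO: "D1 \<union> D2 \<subseteq> O1 \<union> O2 \<union> O3"
    unfolding D(3)[symmetric] cover(1) cell_eq O3_def by auto
  have one: "D \<subseteq> O1 \<or> D \<subseteq> O2 \<or> D \<subseteq> O3" if "connectedin F D" "D \<subseteq> O1 \<union> O2 \<union> O3" for D
  proof -
    have "D \<subseteq> O1 \<or> D \<subseteq> O2 \<union> O3"
      using that op cover disj by (intro connectedin_subset_disjoint_open) auto
    moreover have "D \<subseteq> O2 \<or> D \<subseteq> O3" if "D \<subseteq> O2 \<union> O3"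
      using that op disj \<open>connectedin F D\<close> by (intro connectedin_subset_disjoint_open) auto
    ultimately show ?thesis by blast
  qed
  have "D1 \<subseteq> O1 \<or> D1 \<subseteq> O2 \<or> D1 \<subseteq> O3" "D2 \<subseteq> O1 \<or> D2 \<subseteq> O2 \<or> D2 \<subseteq> O3"
    using one D DO by auto
  moreover have "vertex_point v \<notin> ?K" "vertex_point w \<notin> ?K" using AB(4) v w by auto
  then have "Inl (vertex_point v) \<in> O1 \<inter> (D1 \<union> D2)" "Inl (vertex_point w) \<in> O2 \<inter> (D1 \<union> D2)"
    using v w verts_in cell_eq unfolding D(3)[symmetric] by (auto simp: O1_def O2_def off_compact_def)
  moreover have "Inl (edge_point x y u) \<in> O3 \<inter> (D1 \<union> D2)"
  proof -
    have "edge_point x y u \<noteq> edge_point x y 0" "edge_point x y u \<noteq> edge_point x y 1"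
      using u edge_point_apply(2)[OF edge_neq[OF e]] by (metis less_irrefl)+
    then show ?thesis using u uC unfolding D(3)[symmetric] by (auto simp: O3_def Q_def)
  qed
  ultimately show False using cover(2) disj by blast
qed

end

section \<open>A piecewise linear action on a circle\<close>

definition pieces :: "nat \<Rightarrow> nat \<Rightarrow> nat" where
  "pieces m n = (n - 1) * m + 1"

definition rot_a :: "nat \<Rightarrow> real \<Rightarrow> real" where
  "rot_a m t = (t + 1) rmod real m"

text \<open>The arc [m-1, m] comes first, stretched by \<open>pieces m n\<close>, and [0, m-1]
  follows by a shift. The cyclic order is kept; only the cut moves from 0 to m-1.\<close>

definition chart :: "nat \<Rightarrow> nat \<Rightarrow> real \<Rightarrow> real" where
  "chart m n t =
    (if t < real m - 1 then t + real (pieces m n) else (t - (real m - 1)) * real (pieces m n))"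

definition unchart :: "nat \<Rightarrow> nat \<Rightarrow> real \<Rightarrow> real" where
  "unchart m n y =
    (if y < real (pieces m n) then real m - 1 + y / real (pieces m n) else y - real (pieces m n))"

definition rot_b :: "nat \<Rightarrow> nat \<Rightarrow> real \<Rightarrow> real" where
  "rot_b m n t = unchart m n ((chart m n t + real m) rmod real (n * m))"

lemma pieces_pos [simp]: "0 < pieces m n"
  by (simp add: pieces_def)

lemma real_pieces: "1 \<le> n \<Longrightarrow> real (pieces m n) = real n * real m - real m + 1"
  by (simp add: pieces_def of_nat_diff algebra_simps)

lemma rot_a_funpow: "t \<in> {0..<real m} \<Longrightarrow> (rot_a m ^^ k) t = (t + real k) rmod real m"
proof (induction k)
  case (Suc k)
  then have "(rot_a m ^^ Suc k) t = rot_a m ((t + real k) rmod real m)" by simp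
  also have "\<dots> = ((t + real k) rmod real m + 1) rmod real m" by (simp add: rot_a_def)
  also have "\<dots> = (t + real k + 1) rmod real m"
    by (metis rcong_add_right_cancel rcong_def rmod_rmod)
  finally show ?case by (simp add: add_ac)
qed auto

lemma chart_bounds:
  assumes "1 \<le> m" "1 \<le> n" "t \<in> {0..<real m}"
  shows "chart m n t \<in> {0..<real n * real m}" "unchart m n (chart m n t) = t"
proof -
  have p: "real (pieces m n) = real n * real m - real m + 1" "0 < real (pieces m n)"
    by (rule real_pieces[OF assms(2)]) simp
  have 1: "(t - (real m - 1)) * real (pieces m n) < 1 * real (pieces m n)" if "real m - 1 \<le> t"
    using that assms p by (intro mult_strict_right_mono) auto
  have 2: "real (pieces m n) \<le> real n * real m" using p assms by simp
  show "chart m n t \<in> {0..<real n * real m}"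
  proof (cases "t < real m - 1")
    case True
    then show ?thesis using assms p by (simp add: chart_def)
  next
    case False
    then have "(t - (real m - 1)) * real (pieces m n) < real n * real m" using 1 2 by linarith
    then show ?thesis using False p(2) by (simp add: chart_def)
  qed
  show "unchart m n (chart m n t) = t"
    using assms p(2) 1 by (auto simp: chart_def unchart_def)
qed

lemma unchart_bounds:
  assumes "1 \<le> m" "1 \<le> n" "y \<in> {0..<real n * real m}"
  shows "unchart m n y \<in> {0..<real m}" "chart m n (unchart m n y) = y"
proof -
  have p: "real (pieces m n) = real n * real m - real m + 1" "0 < real (pieces m n)"
    by (rule real_pieces[OF assms(2)]) simp
  have m: "1 \<le> real m" using assms by simp
  have "unchart m n y \<in> {0..<real m} \<and> chart m n (unchart m n y) = y"
  proof (cases "y < real (pieces m n)")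
    case True
    then have "y / real (pieces m n) \<in> {0..<1}" using assms p by (simp add: divide_less_eq)
    then show ?thesis using True m p(2) by (simp add: unchart_def chart_def)
  next
    case False
    then show ?thesis using assms p m by (simp add: unchart_def chart_def)
  qed
  then show "unchart m n y \<in> {0..<real m}" "chart m n (unchart m n y) = y" by auto
qed

lemma rot_b_funpow:
  assumes "1 \<le> m" "1 \<le> n" "t \<in> {0..<real m}"
  shows "(rot_b m n ^^ k) t = unchart m n ((chart m n t + real (k * m)) rmod real (n * m))"
proof (induction k)
  case 0
  then show ?case using chart_bounds[OF assms] by simp
next
  case (Suc k)
  let ?y = "(chart m n t + real (k * m)) rmod real (n * m)"
  have "?y \<in> {0..<real n * real m}"
    using rmod_nonneg[of "n * m"] rmod_less[of "n * m"] assms by auto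
  then have "chart m n (unchart m n ?y) = ?y" by (rule unchart_bounds[OF assms(1,2)])
  moreover have "(rot_b m n ^^ Suc k) t = rot_b m n (unchart m n ?y)" using Suc by simp
  ultimately have "(rot_b m n ^^ Suc k) t = unchart m n ((?y + real m) rmod real (n * m))"
    by (simp only: rot_b_def)
  also have "(?y + real m) rmod real (n * m) = (chart m n t + real (k * m) + real m) rmod real (n * m)"
    by (metis rcong_add_right_cancel rcong_def rmod_rmod)
  finally show ?case by (simp add: algebra_simps)
qed

lemma rot_a_bounds: "1 \<le> m \<Longrightarrow> rot_a m t \<in> {0..<real m}"
  by (simp add: rot_a_def rmod_nonneg rmod_less)

lemma rot_b_bounds: "1 \<le> m \<Longrightarrow> 1 \<le> n \<Longrightarrow> rot_b m n t \<in> {0..<real m}"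
  unfolding rot_b_def using rmod_nonneg[of "n * m"] rmod_less[of "n * m"]
  by (intro unchart_bounds) auto

lemma rot_a_order: "t \<in> {0..<real m} \<Longrightarrow> (rot_a m ^^ m) t = t"
  by (subst rot_a_funpow) (auto intro: rmod_unique[of _ _ _ 1])

lemma rot_b_order:
  assumes "1 \<le> m" "1 \<le> n" "t \<in> {0..<real m}"
  shows "(rot_b m n ^^ n) t = t"
proof -
  have "(chart m n t + real (n * m)) rmod real (n * m) = chart m n t"
    using chart_bounds[OF assms] by (intro rmod_unique[of _ _ _ 1]) auto
  then show ?thesis using chart_bounds[OF assms] rot_b_funpow[OF assms] by simp
qed

text \<open>Inverse letters act as the powers m-1 and n-1 of the rotations; these are true inverses
  on [0, m), where the rotations have orders dividing \<open>m\<close> and \<open>n\<close>.\<close>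

fun letter_act :: "nat \<Rightarrow> nat \<Rightarrow> gen \<times> bool \<Rightarrow> real \<Rightarrow> real" where
  "letter_act m n (GenA, True) = rot_a m"
| "letter_act m n (GenA, False) = rot_a m ^^ (m - 1)"
| "letter_act m n (GenB, True) = rot_b m n"
| "letter_act m n (GenB, False) = rot_b m n ^^ (n - 1)"

primrec word_act :: "nat \<Rightarrow> nat \<Rightarrow> gen word \<Rightarrow> real \<Rightarrow> real" where
  "word_act m n [] t = t"
| "word_act m n (l # w) t = letter_act m n l (word_act m n w t)"

lemma word_act_append: "word_act m n (u @ v) t = word_act m n u (word_act m n v t)"
  by (induction u) auto

lemma word_act_replicate: "word_act m n (replicate k l) t = (letter_act m n l ^^ k) t"
  by (induction k) auto

lemma funpow_bounds: "(\<And>t. t \<in> S \<Longrightarrow> f t \<in> S) \<Longrightarrow> t \<in> S \<Longrightarrow> (f ^^ k) t \<in> S"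
  by (induction k) auto

lemma word_act_bounds:
  assumes "1 \<le> m" "1 \<le> n" "t \<in> {0..<real m}"
  shows "word_act m n w t \<in> {0..<real m}"
proof (induction w)
  case (Cons l w)
  obtain x s where "l = (x, s)" by (cases l)
  then show ?case
    using Cons assms rot_a_bounds[of m] rot_b_bounds[of m n]
      funpow_bounds[of "{0..<real m}" "rot_a m" _ "m - 1"] funpow_bounds[of "{0..<real m}" "rot_b m n" _ "n - 1"]
    by (cases x; cases s) (simp_all del: atLeastLessThan_iff)
qed (use assms in auto)

text \<open>The relations hold for the two rotations, hence so do all their consequences. The point
  \<open>t\<close> must vary in the induction, since in \<open>p @ u @ q\<close> the word
  \<open>u\<close> acts at the point to which \<open>q\<close> has moved \<open>t\<close>.\<close>

lemma word_act_pres_eq: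
  assumes "1 \<le> m" "1 \<le> n" "pres_eq (cyclic_relators m n) u v"
  shows "t \<in> {0..<real m} \<Longrightarrow> word_act m n u t = word_act m n v t"
  using assms(3)
proof (induction arbitrary: t rule: pres_eq.induct)
  case (pres_ctxt u v p q)
  then show ?case using word_act_bounds[OF assms(1,2)] by (simp add: word_act_append)
next
  case (pres_cancel x s)
  have a: "rot_a m ((rot_a m ^^ (m - 1)) t) = t" "(rot_a m ^^ (m - 1)) (rot_a m t) = t"
    using rot_a_order[OF pres_cancel] assms(1) funpow_Suc_right[of "m - 1" "rot_a m"]
      funpow.simps(2)[of "m - 1" "rot_a m"] by (simp_all add: fun_eq_iff)
  have b: "rot_b m n ((rot_b m n ^^ (n - 1)) t) = t" "(rot_b m n ^^ (n - 1)) (rot_b m n t) = t"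
    using rot_b_order[OF assms(1,2) pres_cancel] assms(2) funpow_Suc_right[of "n - 1" "rot_b m n"]
      funpow.simps(2)[of "n - 1" "rot_b m n"] by (simp_all add: fun_eq_iff)
  show ?case by (cases x; cases s) (simp_all add: a b del: One_nat_def)
next
  case (pres_relator r)
  then show ?case
    using rot_a_order rot_b_order[OF assms(1,2)]
    by (auto simp: cyclic_relators_def word_act_replicate simp del: atLeastLessThan_iff)
qed auto

section \<open>The arcs between the two ends of an edge of an \<open>m\<close>-gon\<close>

text \<open>What the geometry uses of the group: the two relations, induction by right
  multiplication with \<open>a\<close> and \<open>b\<close>, and the action on [0, m). That elements
  differ is deduced from the action.\<close>

locale circle_action = group G for G :: "('g, 'z) monoid_scheme" (structure) +
  fixes a b :: 'g and m n :: nat and act :: "'g \<Rightarrow> real \<Rightarrow> real"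
  assumes m: "3 \<le> m" and n: "2 \<le> n"
    and a_in [simp, intro]: "a \<in> carrier G" and b_in [simp, intro]: "b \<in> carrier G"
    and a_pow: "a [^] m = \<one>" and b_pow: "b [^] n = \<one>"
    and gen: "\<And>Q x. Q \<one> \<Longrightarrow> (\<And>x. x \<in> carrier G \<Longrightarrow> Q x \<Longrightarrow> Q (x \<otimes> a)) \<Longrightarrow>
      (\<And>x. x \<in> carrier G \<Longrightarrow> Q x \<Longrightarrow> Q (x \<otimes> b)) \<Longrightarrow> x \<in> carrier G \<Longrightarrow> Q x"
    and act_in: "g \<in> carrier G \<Longrightarrow> t \<in> {0..<real m} \<Longrightarrow> act g t \<in> {0..<real m}"
    and act_mult: "g \<in> carrier G \<Longrightarrow> h \<in> carrier G \<Longrightarrow> t \<in> {0..<real m} \<Longrightarrow> act (g \<otimes> h) t = act g (act h t)"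
    and act_one: "t \<in> {0..<real m} \<Longrightarrow> act \<one> t = t"
    and act_a: "t \<in> {0..<real m} \<Longrightarrow> act a t = rot_a m t"
    and act_b: "t \<in> {0..<real m} \<Longrightarrow> act b t = rot_b m n t"
begin

definition c :: 'g where "c = a \<otimes> b"
definition L :: nat where "L = pieces m n"
definition pos :: "'g \<Rightarrow> real" where "pos g = act g 0"

text \<open>The vertices of the \<open>2n\<close>-gon behind the edge from \<open>\<one>\<close> to \<open>a\<close>, in the order of the arc;
  the exponent \<open>s + m - 1\<close> stands for \<open>s - 1\<close>, which would be truncated at \<open>s = 0\<close>.\<close>

definition bp :: "nat \<Rightarrow> 'g" where
  "bp s = a \<otimes> b [^] ((s + m - 1) div m) \<otimes> a [^] (s + m - 1)"

lemma c_in [simp, intro]: "c \<in> carrier G" by (simp add: c_def)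
lemma bp_in [simp, intro]: "bp s \<in> carrier G" by (simp add: bp_def)

lemma L_eq: "L = (n - 1) * m + 1" by (simp add: L_def pieces_def)

lemma L_gt: "m < L" "4 \<le> L"
proof -
  have "1 * m \<le> (n - 1) * m" using n by (intro mult_le_mono1) simp
  then show "m < L" "4 \<le> L" using m L_eq by linarith+
qed

lemma a_pow_mult [simp]: "a [^] (k * m) = \<one>" "a [^] (m * k) = \<one>"
  using a_pow by (metis a_in mult.commute nat_pow_one nat_pow_pow)+

lemma a_pow_mod: "a [^] k = a [^] (k mod m)"
proof -
  have "a [^] k = a [^] (k div m * m + k mod m)" by (simp only: div_mult_mod_eq)
  also have "\<dots> = a [^] (k div m * m) \<otimes> a [^] (k mod m)" by (rule nat_pow_mult[symmetric]) simp
  finally show ?thesis by simp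
qed

lemma a_pow_cong: "k mod m = l mod m \<Longrightarrow> a [^] k = a [^] l"
  by (metis a_pow_mod)

lemma a_pow_pred: "a [^] (m - 1) \<otimes> a = \<one>" "a \<otimes> a [^] (m - 1) = \<one>"
proof -
  have "Suc (m - 1) = m" using m by simp
  then show "a [^] (m - 1) \<otimes> a = \<one>" using a_pow nat_pow_Suc by metis
  show "a \<otimes> a [^] (m - 1) = \<one>" using a_pow nat_pow_Suc2 a_in \<open>Suc (m - 1) = m\<close> by metis
qed

text \<open>The vertices fall into blocks of length \<open>m\<close>: block \<open>j\<close> runs
  once round the m-gon at a b^(j+1), and an ab-edge leads from its last vertex to the first of the
  next block.\<close>

lemma bp_eq:
  assumes "i < m"
  shows "bp (j * m + 1 + i) = a \<otimes> b [^] (j + 1) \<otimes> a [^] i"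
proof -
  have "(j * m + 1 + i + m - 1) div m = j + 1" using assms m by (simp add: add.commute div_add1_eq)
  moreover have "a [^] (j * m + 1 + i + m - 1) = a [^] i"
  proof (rule a_pow_cong)
    have "j * m + 1 + i + m - 1 = i + (j + 1) * m" by simp
    then show "(j * m + 1 + i + m - 1) mod m = i mod m" by (simp only: mod_mult_self1)
  qed
  ultimately show ?thesis by (simp only: bp_def)
qed

lemma bp_0 [simp]: "bp 0 = \<one>"
  using m by (simp add: bp_def) (metis Suc_pred a_in a_pow diff_Suc_1 nat_pow_Suc2 One_nat_def not_less_eq_eq not_gr0 numeral_3_eq_3 zero_le)

text \<open>So \<open>bp (j * m)\<close> is a b^j a^-1, the last vertex of a block.\<close>

lemma bp_mult: "bp (j * m) \<otimes> a = a \<otimes> b [^] j"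
proof -
  have "(j * m + m - 1) div m = j"
    using m by (intro div_nat_eqI) (auto simp: algebra_simps)
  moreover have "a [^] (j * m + m - 1) \<otimes> a = \<one>"
  proof -
    have "Suc (j * m + m - 1) = (j + 1) * m" using m by simp
    then show ?thesis by (metis a_pow_mult(1) nat_pow_Suc)
  qed
  ultimately show ?thesis by (simp add: bp_def m_assoc)
qed

lemma bp_Suc_c: "m dvd s \<Longrightarrow> bp (Suc s) = bp s \<otimes> c"
proof -
  assume "m dvd s"
  then obtain j where j: "s = j * m" by (metis dvd_div_mult_self)
  have "bp (Suc s) = a \<otimes> b [^] (j + 1)" using bp_eq[of 0 j] m by (simp add: j)
  also have "\<dots> = bp (j * m) \<otimes> a \<otimes> b" by (simp add: bp_mult m_assoc)
  finally show ?thesis by (simp add: j c_def m_assoc)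
qed

lemma bp_Suc_a: "\<not> m dvd s \<Longrightarrow> bp (Suc s) = bp s \<otimes> a"
proof -
  assume s: "\<not> m dvd s"
  define i j where "i = (s - 1) mod m" and "j = (s - 1) div m"
  have "s = j * m + 1 + i" "i < m" using s m by (auto simp: i_def j_def) (metis Suc_pred dvd_0_right gr0I)
  moreover have "Suc i < m"
  proof (rule ccontr)
    assume "\<not> Suc i < m"
    then have "Suc i = m" using \<open>i < m\<close> by simp
    then have "s = (j + 1) * m" using \<open>s = j * m + 1 + i\<close> by simp
    then show False using s by simp
  qed
  ultimately show ?thesis using bp_eq[of i j] bp_eq[of "Suc i" j] by (simp add: m_assoc)
qed

text \<open>At the end of a block the a-edge closes the m-gon instead of following the arc; it is
  the edge that this m-gon shares with the 2n-gon.\<close>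

lemma bp_step_back: "bp (j * m + m) \<otimes> a = bp (j * m + 1)"
  using bp_mult[of "j + 1"] bp_eq[of 0 j] m by (simp add: add.commute)

lemma bp_1: "bp (Suc 0) = c" using bp_Suc_c[of 0] by simp

lemma bp_L: "bp L = a"
  using bp_eq[of 0 "n - 1"] b_pow m n by (simp add: L_eq)

text \<open>Since b = a^(m-1) c, the elements \<open>a\<close> and \<open>c\<close> generate too,
  which allows induction along the edges of the graph.\<close>

lemma gen_ac:
  assumes "Q \<one>" and a: "\<And>x. x \<in> carrier G \<Longrightarrow> Q x \<Longrightarrow> Q (x \<otimes> a)"
    and c: "\<And>x. x \<in> carrier G \<Longrightarrow> Q x \<Longrightarrow> Q (x \<otimes> c)" and "x \<in> carrier G"
  shows "Q x"
  using assms(1) a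
proof (rule gen)
  have pow: "Q (x \<otimes> a [^] k)" if "x \<in> carrier G" "Q x" for x and k :: nat
    by (induction k) (use that a in \<open>auto simp flip: m_assoc\<close>)
  fix x assume x: "x \<in> carrier G" "Q x"
  have "x \<otimes> a [^] (m - 1) \<otimes> c = x \<otimes> (a [^] (m - 1) \<otimes> a) \<otimes> b"
    using x by (simp add: c_def m_assoc)
  then have "x \<otimes> b = x \<otimes> a [^] (m - 1) \<otimes> c"
    using x by (simp only: a_pow_pred r_one)
  then show "Q (x \<otimes> b)" using c[OF _ pow[OF x]] x by simp
qed (use assms in auto)

subsection \<open>The action on arcs\<close>

lemma act_a_pow: "t \<in> {0..<real m} \<Longrightarrow> act (a [^] k) t = (t + real k) rmod m"
proof (induction k)
  case (Suc k)
  have "a [^] Suc k = a \<otimes> a [^] k" by (rule nat_pow_Suc2) simp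
  then have "act (a [^] Suc k) t = rot_a m (act (a [^] k) t)"
    using Suc.prems by (simp only: act_mult act_a act_in a_in nat_pow_closed)
  also have "\<dots> = (rot_a m ^^ Suc k) t" using Suc by (simp add: rot_a_funpow)
  finally show ?case by (simp only: rot_a_funpow[OF Suc.prems])
qed (auto simp: act_one)

lemma act_b_pow: "t \<in> {0..<real m} \<Longrightarrow> act (b [^] k) t = unchart m n ((chart m n t + real (k * m)) rmod (real (n * m)))"
proof -
  assume t: "t \<in> {0..<real m}"
  have "act (b [^] k) t = (rot_b m n ^^ k) t"
  proof (induction k)
    case (Suc k)
    have "b [^] Suc k = b \<otimes> b [^] k" by (rule nat_pow_Suc2) simp
    then have "act (b [^] Suc k) t = rot_b m n (act (b [^] k) t)"
      using t by (simp only: act_mult act_b act_in b_in nat_pow_closed)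
    then show ?case using Suc by simp
  qed (use t in \<open>simp add: act_one\<close>)
  then show ?thesis using rot_b_funpow[of m n t k] m n t by simp
qed

text \<open>The power a^i shifts \<open>u\<close> within [0, m-1], where the chart adds
  \<open>L\<close>. The turn by (j+1)m modulo nm gives s + u, which \<open>unchart\<close> places in
  [m-1, m] and \<open>a\<close> finally in [0, 1].\<close>

lemma act_bp_arc:
  assumes s: "s < L" "\<not> m dvd s" and u: "0 \<le> u" "u < 1"
  shows "act (bp s) u = (real s + u) / real L"
proof -
  define i j where "i = (s - 1) mod m" and "j = (s - 1) div m"
  have s_eq: "s = j * m + 1 + i" "i < m"
    using s m by (auto simp: i_def j_def) (metis Suc_pred dvd_0_right gr0I)
  have i: "Suc i < m"
  proof (rule ccontr)
    assume "\<not> Suc i < m"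
    then have "Suc i = m" using \<open>i < m\<close> by simp
    then have "s = (j + 1) * m" using s_eq by simp
    then show False using s by simp
  qed
  have j: "j + 1 < n"
  proof -
    have "j * m < (n - 1) * m" using s s_eq L_eq by linarith
    then have "j < n - 1" by (simp only: mult_less_cancel2)
    then show ?thesis by simp
  qed
  have um: "u \<in> {0..<real m}" using u m by auto
  have 1: "act (a [^] i) u = u + real i"
    using i u um by (simp add: act_a_pow)
  have ui: "u + real i \<in> {0..<real m}" "u + real i < real m - 1" using i u by auto
  have L: "real L = real n * real m - real m + 1" using n by (simp add: L_def real_pieces)
  have s_real: "real s = real j * real m + 1 + real i" using s_eq by simp
  have sL: "real s + u < real L" using s u by linarith
  have 2: "act (b [^] (j + 1)) (u + real i) = real m - 1 + (real s + u) / real L"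
  proof -
    have "chart m n (u + real i) = u + real i + real L" using ui by (simp add: chart_def L_def)
    moreover have "(u + real i + real L + real ((j + 1) * m)) rmod real (n * m) = real s + u"
    proof (rule rmod_unique[of _ _ _ 1])
      have "real L \<le> real n * real m" using L m by simp
      then show "real s + u \<in> {0..<\<bar>real (n * m)\<bar>}" using sL u by auto
      show "u + real i + real L + real ((j + 1) * m) = real s + u + of_int 1 * real (n * m)"
        using L s_real by (simp add: algebra_simps)
    qed
    moreover have "unchart m n (real s + u) = real m - 1 + (real s + u) / real L"
      using sL by (simp add: unchart_def L_def)
    ultimately show ?thesis using act_b_pow[OF ui(1), of "j + 1"] by simp
  qed
  have q: "(real s + u) / real L \<in> {0..<1}" using sL u by auto
  have "bp s = a \<otimes> (b [^] (j + 1) \<otimes> a [^] i)" using bp_eq[of i j] s_eq by (simp add: m_assoc)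
  then have "act (bp s) u = rot_a m (real m - 1 + (real s + u) / real L)"
    using 1 2 um ui act_in[of "b [^] (j + 1)" "u + real i"]
    by (simp add: act_mult act_a act_in del: nat_pow_Suc)
  also have "\<dots> = (real s + u) / real L"
    unfolding rot_a_def using q m by (intro rmod_unique[of _ _ _ 1]) auto
  finally show ?thesis .
qed

text \<open>A piece whose index is a multiple of \<open>m\<close> is an ab-edge and a translate of
  [0, 1/L], the edge from 1 to \<open>c\<close>, rather than of the whole unit arc. This is why
  points of edges appear as \<open>act h (u / real L)\<close>.\<close>

lemma act_bp_edge:
  assumes s: "s < L" "m dvd s" and u: "0 \<le> u" "u < 1"
  shows "act (bp s) (u / real L) = (real s + u) / real L"
proof -
  obtain j where j: "s = j * m" using s by (metis dvd_div_mult_self)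
  have jn: "j < n"
  proof -
    have "j * m < (n - 1) * m + 1" using s j by (simp add: L_eq)
    then have "j * m \<le> (n - 1) * m" by linarith
    then have "j \<le> n - 1" using m by (simp only: mult_le_cancel2)
    then show ?thesis using n by simp
  qed
  have L1: "1 < real L" using L_gt by linarith
  have L: "real L = real n * real m - real m + 1" using n by (simp add: L_def real_pieces)
  have uL: "u / real L \<in> {0..<1}" using u L1 by (auto simp: divide_less_eq)
  then have um: "u / real L \<in> {0..<real m}" using m by auto
  have sL: "real s + u < real L" using s u by linarith
  have 1: "act (a [^] (m - 1)) (u / real L) = real m - 1 + u / real L"
    using act_a_pow[OF um, of "m - 1"] uL m by (simp add: of_nat_diff add.commute)
  have 2: "real m - 1 + u / real L \<in> {0..<real m}" using uL m by auto
  have 3: "act (b [^] j) (real m - 1 + u / real L) = real m - 1 + (real s + u) / real L"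
  proof -
    have "chart m n (real m - 1 + u / real L) = u" using uL L1 by (simp add: chart_def flip: L_def)
    moreover have "(u + real (j * m)) rmod real (n * m) = real s + u"
    proof (rule rmod_unique[of _ _ _ 0])
      have "real L \<le> real n * real m" using L m by simp
      then show "real s + u \<in> {0..<\<bar>real (n * m)\<bar>}" using sL u by auto
    qed (simp add: j)
    moreover have "unchart m n (real s + u) = real m - 1 + (real s + u) / real L"
      using sL by (simp add: unchart_def L_def)
    ultimately show ?thesis using act_b_pow[OF 2, of j] by simp
  qed
  have q: "(real s + u) / real L \<in> {0..<1}" using sL u by auto
  have "bp s \<otimes> a = a \<otimes> b [^] j" using bp_mult j by simp
  have "bp s = a \<otimes> (b [^] j \<otimes> a [^] (m - 1))"
  proof -
    have "bp s = bp s \<otimes> (a \<otimes> a [^] (m - 1))" by (simp only: a_pow_pred r_one bp_in)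
    also have "\<dots> = a \<otimes> (b [^] j \<otimes> a [^] (m - 1))" using \<open>bp s \<otimes> a = a \<otimes> b [^] j\<close> by (simp flip: m_assoc)
    finally show ?thesis .
  qed
  then have "act (bp s) (u / real L) = rot_a m (real m - 1 + (real s + u) / real L)"
    using 1 2 3 um act_in[OF _ 2, of "b [^] j"] by (simp add: act_mult act_a act_in)
  also have "\<dots> = (real s + u) / real L"
    unfolding rot_a_def using q m by (intro rmod_unique[of _ _ _ 1]) auto
  finally show ?thesis .
qed

text \<open>An arc is named by the initial vertex of its a-edge. In every m-gon other than the
  powers of \<open>a\<close>, the edge shared with the 2n-gon nearer to the root is left out: its
  index is a multiple of \<open>m\<close>, and its translate of the unit arc would go the long way
  round.\<close>

inductive arc :: "nat \<Rightarrow> 'g \<Rightarrow> bool" where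
  arc_root: "i < m \<Longrightarrow> arc 0 (a [^] i)"
| arc_step: "arc k g \<Longrightarrow> s < L \<Longrightarrow> \<not> m dvd s \<Longrightarrow> arc (Suc k) (g \<otimes> bp s)"

lemma arc_in: "arc k g \<Longrightarrow> g \<in> carrier G"
  by (induction rule: arc.induct) auto

lemma L_power_pos [simp]: "0 < real L ^ k"
  using L_gt by simp

lemma subdivide:
  assumes "s < L" "0 \<le> u" "u < 1"
  shows "(real s + u) / real L \<in> {0..<1}" "(real s + u) / real L \<in> {0..<real m}"
proof -
  have "real s + u < real L" using assms by linarith
  then show "(real s + u) / real L \<in> {0..<1}" using assms by (simp add: divide_less_eq)
  then show "(real s + u) / real L \<in> {0..<real m}" using m by auto
qed

lemma unit_in: "0 \<le> u \<Longrightarrow> u < 1 \<Longrightarrow> u \<in> {0..<real m}" "0 \<le> u \<Longrightarrow> u < 1 \<Longrightarrow> u / real L \<in> {0..<real m}"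
  using subdivide(2)[of 0 u] L_gt m by auto

lemma act_mult_bp_arc:
  assumes "g \<in> carrier G" "s < L" "\<not> m dvd s" "0 \<le> u" "u < 1"
  shows "act (g \<otimes> bp s) u = act g ((real s + u) / real L)"
  using assms unit_in[OF assms(4,5)] act_bp_arc[OF assms(2-5)] by (simp add: act_mult)

lemma act_mult_bp_edge:
  assumes "g \<in> carrier G" "s < L" "m dvd s" "0 \<le> u" "u < 1"
  shows "act (g \<otimes> bp s) (u / real L) = act g ((real s + u) / real L)"
  using assms unit_in(2)[OF assms(4,5)] act_bp_edge[OF assms(2-5)] by (simp add: act_mult)

lemma pos_mult_bp:
  assumes "g \<in> carrier G" "s < L"
  shows "pos (g \<otimes> bp s) = act g (real s / real L)"
  using act_mult_bp_arc[OF assms, of 0] act_mult_bp_edge[OF assms, of 0] by (cases "m dvd s") (auto simp: pos_def)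

text \<open>Each refinement passes to one piece of the subdivision and so divides the scale by
  \<open>L\<close> once more. On the root arcs i + u stays below \<open>m\<close>, so nothing is
  reduced.\<close>

lemma arc_act:
  assumes "arc k g" "0 \<le> u" "u < 1"
  shows "act g u = pos g + u / real L ^ k"
  using assms
proof (induction arbitrary: u rule: arc.induct)
  case (arc_root i)
  then show ?case using m unit_in[of u] act_a_pow[of u i] act_a_pow[of 0 i] by (simp add: pos_def)
next
  case (arc_step k g s)
  have "act g ((real s + u) / real L) = pos g + (real s + u) / real L / real L ^ k"
    "act g (real s / real L) = pos g + real s / real L / real L ^ k"
    using arc_step.IH subdivide[OF arc_step(2), of u] subdivide[OF arc_step(2), of 0] arc_step.prems by auto
  then show ?case
    using arc_step arc_in pos_mult_bp[of g s] act_mult_bp_arc[of g s u] by (simp add: add_divide_distrib)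
qed

lemma arc_pos_bp:
  assumes "arc k g" "s < L"
  shows "pos (g \<otimes> bp s) = pos g + real s / real L ^ Suc k"
  using pos_mult_bp[OF arc_in[OF assms(1)] assms(2)] arc_act[OF assms(1), of "real s / real L"]
    subdivide[OF assms(2), of 0] by simp

text \<open>The second alternative is the wrap-around: the last arc of a level ends at
  \<open>m\<close>, whereas the vertex there has position 0.\<close>

lemma arc_end:
  "arc k g \<Longrightarrow> pos (g \<otimes> a) = pos g + 1 / real L ^ k \<or> g \<otimes> a = \<one> \<and> pos g + 1 / real L ^ k = real m"
proof (induction rule: arc.induct)
  case (arc_root i)
  have pos_a: "pos (a [^] j) = real j" if "j < m" for j
    using act_a_pow[of 0 j] that by (simp add: pos_def)
  show ?case
  proof (cases "Suc i < m")
    case True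
    then show ?thesis using pos_a[of i] pos_a[of "Suc i"] by simp
  next
    case False
    then have "Suc i = m" using arc_root by simp
    then have "a [^] i \<otimes> a = \<one>" using a_pow nat_pow_Suc by metis
    then show ?thesis using pos_a[OF arc_root] \<open>Suc i = m\<close> by auto
  qed
next
  case (arc_step k g s)
  \<comment> \<open>The index L-1 is a multiple of \<open>m\<close>. A smaller arc is therefore
    never the last piece, and its right end is again an inner division point.\<close>
  have "s \<noteq> L - 1" using arc_step(3) by (auto simp: L_eq)
  then have s: "Suc s < L" using arc_step(2) by simp
  have "g \<otimes> bp s \<otimes> a = g \<otimes> bp (Suc s)"
    using arc_step arc_in[of k g] by (simp add: bp_Suc_a m_assoc)
  then show ?case
    using arc_pos_bp[OF arc_step(1) s] arc_pos_bp[OF arc_step(1,2)] by (simp add: add_divide_distrib)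
qed

text \<open>Arcs of one level are disjoint: the arcs one level up agree by induction, and then s + u
  determines its integer part \<open>s\<close> and its fractional part \<open>u\<close>.\<close>

lemma arc_unique:
  assumes "arc k g" "arc k g'" "0 \<le> u" "u < 1" "0 \<le> u'" "u' < 1" "act g u = act g' u'"
  shows "g = g' \<and> u = u'"
  using assms
proof (induction arbitrary: g' u u' rule: arc.induct)
  case (arc_root i)
  from arc_root(2) obtain i' where i': "i' < m" "g' = a [^] i'" by (cases rule: arc.cases) auto
  have "act (a [^] i) u = u + real i" if "i < m" "0 \<le> u" "u < 1" for i u
    using act_a_pow[OF unit_in(1)[OF that(2,3)], of i] that by simp
  then have "u + real i = u' + real i'" using arc_root i' by metis
  moreover from this have "i = i'" using arc_root by linarith
  ultimately show ?case using i' by simp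
next
  case (arc_step k g s)
  from arc_step(5) obtain g1 s' where g1: "arc k g1" "s' < L" "\<not> m dvd s'" "g' = g1 \<otimes> bp s'"
    by (cases rule: arc.cases) auto
  have "act g ((real s + u) / real L) = act g1 ((real s' + u') / real L)"
    using arc_step(10) act_mult_bp_arc[OF arc_in[OF arc_step(1)] arc_step(2,3,6,7)]
      act_mult_bp_arc[OF arc_in[OF g1(1)] g1(2,3) arc_step(8,9)] g1(4) by simp
  then have "g = g1 \<and> (real s + u) / real L = (real s' + u') / real L"
    using subdivide(1)[OF arc_step(2,6,7)] subdivide(1)[OF g1(2) arc_step(8,9)]
    by (intro arc_step.IH[OF g1(1)]) simp_all
  then have *: "g = g1" "real s + u = real s' + u'" using L_gt by auto
  moreover from this have "s = s'" using arc_step.prems by linarith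
  ultimately show ?case using * g1 by simp
qed

lemma arc_ancestor:
  assumes "arc k g" "0 \<le> u" "u < 1" "k' \<le> k"
  shows "\<exists>g' u'. arc k' g' \<and> 0 \<le> u' \<and> u' < 1 \<and> act g u = act g' u'"
  using assms
proof (induction arbitrary: u rule: arc.induct)
  case (arc_root i)
  then show ?case using arc.arc_root[of i] by auto
next
  case (arc_step k g s)
  show ?case
  proof (cases "k' = Suc k")
    case True
    then show ?thesis using arc_step arc.arc_step by metis
  next
    case False
    then show ?thesis
      using arc_step.IH[of "(real s + u) / real L"] subdivide(1)[OF arc_step(2), of u]
        act_mult_bp_arc[OF arc_in[OF arc_step(1)] arc_step(2,3), of u] arc_step.prems by simp
  qed
qed

text \<open>Both would be pieces of the same arc of level \<open>k\<close> with the same index,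
  which cannot be a multiple of \<open>m\<close> and not one.\<close>

lemma edge_not_in_arc:
  assumes g: "arc k g" and s: "s < L" "m dvd s" and u: "0 \<le> u" "u < 1"
    and g': "arc (Suc k) g'" and u': "0 \<le> u'" "u' < 1"
  shows "act (g \<otimes> bp s) (u / real L) \<noteq> act g' u'"
proof
  assume eq: "act (g \<otimes> bp s) (u / real L) = act g' u'"
  from g' obtain g1 s' where g1: "arc k g1" "s' < L" "\<not> m dvd s'" "g' = g1 \<otimes> bp s'"
    by (cases rule: arc.cases) auto
  have "act g ((real s + u) / real L) = act g1 ((real s' + u') / real L)"
    using eq act_mult_bp_edge[OF arc_in[OF g] s u] act_mult_bp_arc[OF arc_in[OF g1(1)] g1(2,3) u'] g1(4)
    by simp
  then have "g = g1 \<and> (real s + u) / real L = (real s' + u') / real L"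
    using subdivide(1)[OF s(1) u] subdivide(1)[OF g1(2) u'] by (intro arc_unique[OF g g1(1)]) simp_all
  then have "real s + u = real s' + u'" using L_gt by auto
  then have "s = s'" using u u' by linarith
  then show False using s g1 by simp
qed

text \<open>Induction along edges. From a positive multiple of \<open>m\<close> the a-step goes back
  to the start of the block. At \<open>s = 0\<close> the vertex names an arc itself, and the a-step
  leads to the next division point one level up, or round the root m-gon.\<close>

lemma ex_edge:
  assumes "h \<in> carrier G"
  shows "\<exists>k g s. arc k g \<and> s < L \<and> m dvd s \<and> h = g \<otimes> bp s"
proof -
  define Q where "Q h \<longleftrightarrow> (\<exists>k g s. arc k g \<and> s < L \<and> m dvd s \<and> h = g \<otimes> bp s)" for h
  have Q_arc: "Q g" if "arc k g" for k g
    using that L_gt arc_in[OF that] unfolding Q_def by (metis bp_0 dvd_0_right le_eq_less_or_eq less_le_trans r_one zero_le not_gr_zero)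
  \<comment> \<open>If the index is not a multiple of \<open>m\<close>, the ab-edge starting here is
    piece 0 of the finer arc.\<close>
  have Q_bp: "Q (g \<otimes> bp s)" if "arc k g" "s < L" for k g s
    using that Q_arc arc.arc_step Q_def by blast
  have Q_a: "Q (x \<otimes> a)" if "Q x" "x \<in> carrier G" for x
  proof -
    from that(1) obtain k g s where x: "arc k g" "s < L" "m dvd s" "x = g \<otimes> bp s"
      unfolding Q_def by blast
    show ?thesis
    proof (cases "s = 0")
      case False
      obtain j where j: "s = Suc j * m" using x(3) False by (metis dvd_div_mult_self mult_0 not0_implies_Suc)
      then have "x \<otimes> a = g \<otimes> bp (j * m + 1)"
        using bp_step_back[of j] x arc_in by (simp add: m_assoc add.commute)
      moreover have "j * m + 1 < L" using x(2) j m by simp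
      ultimately show ?thesis using Q_bp x(1) by metis
    next
      case True
      then have "x = g" using x arc_in by simp
      from x(1) show ?thesis
      proof (cases rule: arc.cases)
        case (arc_root i)
        have "arc 0 (a [^] Suc i)"
          using arc.arc_root[of "Suc i mod m"] m a_pow_mod[of "Suc i"] by (simp del: nat_pow_Suc)
        then show ?thesis using Q_arc arc_root \<open>x = g\<close> by auto
      next
        case (arc_step k' g' s')
        have "s' \<noteq> L - 1" using arc_step(5) by (auto simp: L_eq)
        then have "Suc s' < L" using arc_step(4) by simp
        moreover have "x \<otimes> a = g' \<otimes> bp (Suc s')"
          using arc_step \<open>x = g\<close> arc_in by (simp add: bp_Suc_a m_assoc)
        ultimately show ?thesis using Q_bp arc_step(3) by metis
      qed
    qed
  qed
  have Q_c: "Q (x \<otimes> c)" if "Q x" "x \<in> carrier G" for x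
  proof -
    from that(1) obtain k g s where x: "arc k g" "s < L" "m dvd s" "x = g \<otimes> bp s"
      unfolding Q_def by blast
    then have xc: "x \<otimes> c = g \<otimes> bp (Suc s)" using arc_in by (simp add: bp_Suc_c m_assoc)
    show ?thesis
    proof (cases "Suc s < L")
      case True
      then show ?thesis using xc Q_bp x(1) by metis
    next
      case False
      then have "x \<otimes> c = g \<otimes> a" using xc x(2) bp_L by (metis Suc_lessI)
      then show ?thesis using Q_a[OF Q_arc[OF x(1)] arc_in[OF x(1)]] by simp
    qed
  qed
  have "Q \<one>" using Q_arc[OF arc.arc_root[of 0]] m by simp
  then have "Q h" by (rule gen_ac) (use Q_a Q_c assms in auto)
  then show ?thesis by (simp add: Q_def)
qed

text \<open>Of two edges of different levels, the deeper one lies in arcs of all levels up to its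
  own, while the other avoids the arcs one level below it. On equal levels the arcs and the indices
  are compared.\<close>

lemma edge_unique:
  assumes "h \<in> carrier G" "h' \<in> carrier G" "0 \<le> u" "u < 1" "0 \<le> u'" "u' < 1"
    and eq: "act h (u / real L) = act h' (u' / real L)"
  shows "h = h' \<and> u = u'"
proof -
  obtain k g s where h: "arc k g" "s < L" "m dvd s" "h = g \<otimes> bp s" using ex_edge[OF assms(1)] by blast
  obtain k' g' s' where h': "arc k' g'" "s' < L" "m dvd s'" "h' = g' \<otimes> bp s'"
    using ex_edge[OF assms(2)] by blast
  have act: "act h (u / real L) = act g ((real s + u) / real L)"
    "act h' (u' / real L) = act g' ((real s' + u') / real L)"
    using act_mult_bp_edge h h' arc_in assms by auto
  note sub = subdivide(1)[OF h(2) assms(3,4)] subdivide(1)[OF h'(2) assms(5,6)]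
  have False if "k < k'"
    using arc_ancestor[OF h'(1), of "(real s' + u') / real L" "Suc k"] sub that act eq h assms
      edge_not_in_arc[OF h(1-3) assms(3,4)] by auto
  moreover have False if "k' < k"
    using arc_ancestor[OF h(1), of "(real s + u) / real L" "Suc k'"] sub that act eq h' assms
      edge_not_in_arc[OF h'(1-3) assms(5,6)] by auto
  ultimately have "k = k'" using linorder_neqE_nat by blast
  then have "g = g' \<and> (real s + u) / real L = (real s' + u') / real L"
    using sub act eq h'(1) by (intro arc_unique[OF h(1)]) simp_all
  then have *: "g = g'" "real s + u = real s' + u'" using L_gt by auto
  moreover from this have "s = s'" using assms by linarith
  ultimately show ?thesis using * h h' by simp
qed

text \<open>These points will be sent to ends; they are the points of [0, m) that lie on no ab-edge,
  and in particular they are not positions of vertices.\<close>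

definition in_arcs :: "real \<Rightarrow> bool" where
  "in_arcs t \<longleftrightarrow> (\<forall>k. \<exists>g u. arc k g \<and> 0 \<le> u \<and> u < 1 \<and> t = act g u)"

lemma edge_not_in_arcs:
  assumes "h \<in> carrier G" "0 \<le> u" "u < 1"
  shows "\<not> in_arcs (act h (u / real L))"
proof -
  obtain k g s where h: "arc k g" "s < L" "m dvd s" "h = g \<otimes> bp s" using ex_edge[OF assms(1)] by blast
  show ?thesis
    using edge_not_in_arc[OF h(1-3) assms(2,3)] h(4) unfolding in_arcs_def by blast
qed

text \<open>As long as \<open>t\<close> has not been found on an edge, the piece of the current arc
  that contains it is an arc of the next level.\<close>

lemma edge_or_in_arcs:
  assumes t: "t \<in> {0..<real m}"
  shows "(\<exists>h u. h \<in> carrier G \<and> 0 \<le> u \<and> u < 1 \<and> t = act h (u / real L)) \<or> in_arcs t"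
proof (rule disjCI)
  assume "\<not> in_arcs t"
  then obtain k where k: "\<not> (\<exists>g u. arc k g \<and> 0 \<le> u \<and> u < 1 \<and> t = act g u)"
    unfolding in_arcs_def by blast
  have "(\<exists>h u. h \<in> carrier G \<and> 0 \<le> u \<and> u < 1 \<and> t = act h (u / real L)) \<or>
    (\<exists>g u. arc k g \<and> 0 \<le> u \<and> u < 1 \<and> t = act g u)" (is "?E \<or> ?A k")
  proof (induction k)
    case 0
    define i where "i = nat \<lfloor>t\<rfloor>"
    have i: "real i \<le> t" "t < real i + 1" "i < m" using t unfolding i_def by (auto simp: nat_less_iff floor_less_iff)
    have "t = act (a [^] i) (t - real i)" using act_a_pow[of "t - real i" i] i t by simp
    then have "?A 0" using i arc_root[of i] by (metis diff_ge_0_iff_ge less_diff_eq add.commute diff_less_eq)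
    then show ?case by blast
  next
    case (Suc k)
    show ?case
    proof (cases ?E)
      case False
      then obtain g u where g: "arc k g" "0 \<le> u" "u < 1" "t = act g u" using Suc by blast
      define s where "s = nat \<lfloor>u * real L\<rfloor>"
      have uL: "0 \<le> u * real L" "u * real L < real L" using g L_gt by auto
      have s: "real s \<le> u * real L" "u * real L < real s + 1" using uL unfolding s_def by linarith+
      have sL: "s < L" using s uL by linarith
      define u' where "u' = u * real L - real s"
      have u': "0 \<le> u'" "u' < 1" using s by (auto simp: u'_def)
      have u: "u = (real s + u') / real L" using L_gt by (simp add: u'_def)
      have "?A (Suc k)"
      proof (cases "m dvd s")
        case True
        then have "t = act (g \<otimes> bp s) (u' / real L)"
          using act_mult_bp_edge[OF arc_in[OF g(1)] sL True u'] g(4) u by simp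
        then show ?thesis using \<open>\<not> ?E\<close> u' arc_in[OF g(1)] bp_in m_closed by blast
      next
        case False
        then have "t = act (g \<otimes> bp s) u'"
          using act_mult_bp_arc[OF arc_in[OF g(1)] sL False u'] g(4) u by simp
        then show ?thesis using arc_step[OF g(1) sL False] u' by blast
      qed
      then show ?thesis by blast
    qed simp
  qed
  then show "\<exists>h u. h \<in> carrier G \<and> 0 \<le> u \<and> u < 1 \<and> t = act h (u / real L)" using k by blast
qed

lemma edge_interval:
  assumes h: "h \<in> carrier G"
  obtains l where "0 < l" "\<And>u. 0 \<le> u \<Longrightarrow> u < 1 \<Longrightarrow> act h (u / real L) = pos h + u * l"
    "pos (h \<otimes> c) = pos h + l \<or> h \<otimes> c = \<one> \<and> pos h + l = real m"
proof -
  obtain k g s where h': "arc k g" "s < L" "m dvd s" "h = g \<otimes> bp s" using ex_edge[OF h] by blast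
  define l where "l = 1 / real L ^ Suc k"
  have pos_h: "pos h = pos g + real s * l" using arc_pos_bp[OF h'(1,2)] h'(4) by (simp add: l_def)
  have "act h (u / real L) = pos h + u * l" if u: "0 \<le> u" "u < 1" for u
    using act_mult_bp_edge[OF arc_in[OF h'(1)] h'(2,3) u] arc_act[OF h'(1), of "(real s + u) / real L"]
      subdivide(1)[OF h'(2) u] h'(4) pos_h by (simp add: l_def add_divide_distrib)
  moreover have "pos (h \<otimes> c) = pos h + l \<or> h \<otimes> c = \<one> \<and> pos h + l = real m"
  proof -
    have hc: "h \<otimes> c = g \<otimes> bp (Suc s)" using h' arc_in by (simp add: bp_Suc_c m_assoc)
    show ?thesis
    proof (cases "Suc s < L")
      case True
      then show ?thesis using arc_pos_bp[OF h'(1) True] hc pos_h by (simp add: l_def add_divide_distrib)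
    next
      case False
      then have "Suc s = L" using h'(2) by simp
      then have "pos h + l = pos g + real L * l" using pos_h by (simp add: algebra_simps flip: \<open>Suc s = L\<close>)
      also have "real L * l = 1 / real L ^ k" using L_gt by (simp add: l_def)
      finally show ?thesis using arc_end[OF h'(1)] hc bp_L \<open>Suc s = L\<close> by simp
    qed
  qed
  moreover have "0 < l" unfolding l_def using L_power_pos by (rule divide_pos_pos[OF zero_less_one])
  ultimately show ?thesis using that by blast
qed

subsection \<open>The vertices on one side of an edge of an \<open>m\<close>-gon\<close>

text \<open>The vertices behind the a-edge from \<open>g\<close>, its two ends included. It is
  defined for all \<open>g\<close> and not only for those naming arcs, which makes it invariant
  under left translation.\<close>

inductive beyond :: "'g \<Rightarrow> 'g \<Rightarrow> bool" where
  beyond_bp: "s \<le> L \<Longrightarrow> beyond g (g \<otimes> bp s)"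
| beyond_step: "s < L \<Longrightarrow> \<not> m dvd s \<Longrightarrow> beyond (g \<otimes> bp s) h \<Longrightarrow> beyond g h"

lemma beyond_in: "beyond g h \<Longrightarrow> g \<in> carrier G \<Longrightarrow> h \<in> carrier G"
  by (induction rule: beyond.induct) auto

lemma beyond_refl: "g \<in> carrier G \<Longrightarrow> beyond g g"
  using beyond_bp[of 0 g] by simp

lemma beyond_a: "beyond g (g \<otimes> a)"
  using beyond_bp[of L g] by (simp add: bp_L)

lemma beyond_c: "beyond g (g \<otimes> c)"
  using beyond_bp[of "Suc 0" g] L_gt by (simp add: bp_1)

lemma beyond_mult:
  "beyond g h \<Longrightarrow> g \<in> carrier G \<Longrightarrow> x \<in> carrier G \<Longrightarrow> beyond (x \<otimes> g) (x \<otimes> h)"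
proof (induction rule: beyond.induct)
  case (beyond_bp s g)
  then show ?case using beyond.beyond_bp[of s "x \<otimes> g"] by (simp add: m_assoc)
next
  case (beyond_step s g h)
  then show ?case using beyond.beyond_step[of s "x \<otimes> g"] by (simp add: m_assoc)
qed

definition adj :: "'g \<Rightarrow> 'g \<Rightarrow> bool" where
  "adj x y \<longleftrightarrow> y = x \<otimes> a \<or> y = x \<otimes> c \<or> x = y \<otimes> a \<or> x = y \<otimes> c"

lemma adj_cancel:
  assumes "x \<in> carrier G" "y \<in> carrier G" "adj x y" "x = z \<otimes> a" "x = w \<otimes> c" "z \<in> carrier G" "w \<in> carrier G"
  shows "y = x \<otimes> a \<or> y = x \<otimes> c \<or> y = z \<or> y = w"
  using assms unfolding adj_def by (metis a_in c_in right_cancel)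

text \<open>The four neighbours of the vertex are obtained by \<open>a\<close>, \<open>c\<close> and
  their inverses. Each is a division point of the same arc or lies on the first or last edge of a
  finer one.\<close>

lemma beyond_adj_bp:
  assumes g: "g \<in> carrier G" and s: "0 < s" "s < L" and y: "adj (g \<otimes> bp s) y" "y \<in> carrier G"
  shows "beyond g y"
proof -
  let ?h = "g \<otimes> bp s"
    obtain r where r: "s = Suc r" using s gr0_conv_Suc by blast
    have 1: "beyond g (?h \<otimes> a)"
    proof (cases "m dvd s")
      case True
      then obtain j where j: "s = Suc j * m" using s by (metis dvd_div_mult_self mult_0 not0_implies_Suc less_irrefl)
      then have "?h \<otimes> a = g \<otimes> bp (j * m + 1)"
        using bp_step_back[of j] g by (simp add: m_assoc add.commute)
      then show ?thesis using beyond.beyond_bp[of "j * m + 1" g] s j m by simp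
    next
      case False
      then have "?h \<otimes> a = g \<otimes> bp (Suc s)" using g by (simp add: bp_Suc_a m_assoc)
      then show ?thesis using beyond.beyond_bp[of "Suc s" g] s by simp
    qed
    have 2: "beyond g (?h \<otimes> c)"
    proof (cases "m dvd s")
      case True
      then have "?h \<otimes> c = g \<otimes> bp (Suc s)" using g by (simp add: bp_Suc_c m_assoc)
      then show ?thesis using beyond.beyond_bp[of "Suc s" g] s by simp
    next
      case False
      then show ?thesis using beyond_step[of s g] beyond_c s by blast
    qed
    have "\<exists>z. z \<in> carrier G \<and> ?h = z \<otimes> a \<and> beyond g z"
    proof (cases "m dvd r")
      case True
      then obtain j where j: "r = j * m" by (metis dvd_div_mult_self)
      have "s \<noteq> L - 1 + 1" using s by simp
      then have "r < (n - 1) * m" using s r by (simp add: L_eq)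
      then have "j < n - 1" unfolding j by (simp only: mult_less_cancel2)
      then have "Suc j * m \<le> (n - 1) * m" by (intro mult_le_mono1) simp
      then have "j * m + m \<le> L" by (simp add: L_eq)
      moreover have "?h = g \<otimes> bp (j * m + m) \<otimes> a"
        using bp_step_back[of j] g r j by (simp add: m_assoc)
      ultimately show ?thesis using beyond.beyond_bp g by blast
    next
      case False
      then have "?h = g \<otimes> bp r \<otimes> a" using g r by (simp add: bp_Suc_a m_assoc)
      then show ?thesis using beyond.beyond_bp[of r g] s g r by (metis bp_in le_eq_less_or_eq less_imp_le Suc_lessD m_closed)
    qed
    then obtain z where z: "z \<in> carrier G" "?h = z \<otimes> a" "beyond g z" by blast
    have "\<exists>w. w \<in> carrier G \<and> ?h = w \<otimes> c \<and> beyond g w"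
    proof (cases "m dvd r")
      case True
      then have "?h = g \<otimes> bp r \<otimes> c" using g r by (simp add: bp_Suc_c m_assoc)
      then show ?thesis using beyond.beyond_bp[of r g] s g r by (metis bp_in le_eq_less_or_eq less_imp_le Suc_lessD m_closed)
    next
      case False
      \<comment> \<open>The last piece of an arc is an ab-edge. Here the arc is the finer one with
        index \<open>r\<close>, which ends at \<open>?h\<close>.\<close>
      have "m dvd L - 1" by (simp add: L_eq)
      then have "bp (L - 1) \<otimes> c = a" using bp_Suc_c[of "L - 1"] bp_L L_gt by simp
      then have "?h = g \<otimes> bp r \<otimes> bp (L - 1) \<otimes> c"
        using g r False by (simp add: bp_Suc_a m_assoc)
      moreover have "beyond g (g \<otimes> bp r \<otimes> bp (L - 1))"
        using beyond_step[OF _ False, of g] beyond.beyond_bp[of "L - 1" "g \<otimes> bp r"] s r by simp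
      moreover have "g \<otimes> bp r \<otimes> bp (L - 1) \<in> carrier G" using g by simp
      ultimately show ?thesis by blast
    qed
    then obtain w where w: "w \<in> carrier G" "?h = w \<otimes> c" "beyond g w" by blast
    have "?h \<in> carrier G" using g by simp
    then show ?thesis using adj_cancel[OF _ y(2,1) z(2) w(2) z(1) w(1)] 1 2 z(3) w(3) by auto
qed

text \<open>The two ends of the a-edge separate the graph. In the inductive step the ends of the
  smaller arc are inner division points of the larger one, so their neighbours are known.\<close>

lemma beyond_adj:
  assumes "beyond g h" "g \<in> carrier G" "adj h y" "y \<in> carrier G"
  shows "h = g \<or> h = g \<otimes> a \<or> beyond g y"
  using assms
proof (induction rule: beyond.induct)
  case (beyond_bp s g)
  consider "s = 0" | "s = L" | "0 < s" "s < L" using beyond_bp(1) by linarith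
  then show ?case by cases (use beyond_bp bp_L beyond_adj_bp in auto)
next
  case (beyond_step s g h)
  have s: "0 < s" using beyond_step(2) by (cases s) auto
  have "s \<noteq> L - 1" using beyond_step(2) by (auto simp: L_eq)
  then have s': "Suc s < L" using beyond_step(1) by simp
  have "g \<otimes> bp s \<otimes> a = g \<otimes> bp (Suc s)" using beyond_step by (simp add: bp_Suc_a m_assoc)
  then consider "h = g \<otimes> bp s" | "h = g \<otimes> bp (Suc s)" | "beyond (g \<otimes> bp s) y"
    using beyond_step by auto
  then show ?case
  proof cases
    case 1
    then show ?thesis using beyond_adj_bp[of g s y] beyond_step s by auto
  next
    case 2
    then show ?thesis using beyond_adj_bp[of g "Suc s" y] beyond_step s' by auto
  next
    case 3
    then show ?thesis using beyond.beyond_step beyond_step(1,2) by blast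
  qed
qed

lemma adj_bp_Suc: "g \<in> carrier G \<Longrightarrow> adj (g \<otimes> bp s) (g \<otimes> bp (Suc s))"
  unfolding adj_def by (cases "m dvd s") (simp_all add: bp_Suc_a bp_Suc_c m_assoc)

lemma beyond_reach_bp:
  assumes "g \<in> carrier G" "s \<le> L"
  shows "(\<lambda>x y. beyond g x \<and> beyond g y \<and> adj x y)\<^sup>*\<^sup>* g (g \<otimes> bp s)"
  using assms(2)
proof (induction s)
  case (Suc s)
  then have "beyond g (g \<otimes> bp s) \<and> beyond g (g \<otimes> bp (Suc s)) \<and> adj (g \<otimes> bp s) (g \<otimes> bp (Suc s))"
    using beyond_bp[of s g] beyond_bp[of "Suc s" g] adj_bp_Suc[OF assms(1)] by simp
  moreover have "(\<lambda>x y. beyond g x \<and> beyond g y \<and> adj x y)\<^sup>*\<^sup>* g (g \<otimes> bp s)" using Suc by simp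
  ultimately show ?case by (rule rtranclp.rtrancl_into_rtrancl[rotated])
qed (simp add: assms)

lemma beyond_reach:
  assumes "beyond g h" "g \<in> carrier G"
  shows "(\<lambda>x y. beyond g x \<and> beyond g y \<and> adj x y)\<^sup>*\<^sup>* g h"
  using assms
proof (induction rule: beyond.induct)
  case (beyond_bp s g)
  then show ?case using beyond_reach_bp by blast
next
  case (beyond_step s g h)
  have "(\<lambda>x y. beyond g x \<and> beyond g y \<and> adj x y)\<^sup>*\<^sup>* g (g \<otimes> bp s)"
    using beyond_step by (intro beyond_reach_bp) simp_all
  moreover have "(\<lambda>x y. beyond g x \<and> beyond g y \<and> adj x y)\<^sup>*\<^sup>* (g \<otimes> bp s) h"
  proof (rule mono_rtranclp[rule_format])
    show "(\<lambda>x y. beyond (g \<otimes> bp s) x \<and> beyond (g \<otimes> bp s) y \<and> adj x y)\<^sup>*\<^sup>* (g \<otimes> bp s) h"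
      using beyond_step by simp
  qed (blast intro: beyond.beyond_step[OF beyond_step(1,2)])
  ultimately show ?case by (rule rtranclp_trans)
qed

text \<open>The vertex \<open>g \<otimes> a\<close> stands apart because the arc is half-open. The
  right end of a finer arc needs no such exception, being an inner division point.\<close>

lemma beyond_cases:
  assumes "beyond g h" "g \<in> carrier G"
  shows "h = g \<otimes> a \<or> (\<exists>u. 0 \<le> u \<and> u < 1 \<and> pos h = act g u)"
  using assms
proof (induction rule: beyond.induct)
  case (beyond_bp s g)
  show ?case
  proof (cases "s = L")
    case False
    then have "s < L" using beyond_bp by simp
    then have "0 \<le> real s / real L \<and> real s / real L < 1 \<and> pos (g \<otimes> bp s) = act g (real s / real L)"
      using pos_mult_bp[OF beyond_bp(2)] by simp
    then show ?thesis by blast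
  qed (use bp_L in simp)
next
  case (beyond_step s g h)
  have "s \<noteq> L - 1" using beyond_step(2) by (auto simp: L_eq)
  then have s': "Suc s < L" using beyond_step(1) by simp
  have "g \<otimes> bp s \<otimes> a = g \<otimes> bp (Suc s)" using beyond_step by (simp add: bp_Suc_a m_assoc)
  then consider "h = g \<otimes> bp (Suc s)" | u where "0 \<le> u" "u < 1" "pos h = act (g \<otimes> bp s) u"
    using beyond_step by auto
  then show ?case
  proof cases
    case 1
    then have "0 \<le> real (Suc s) / real L \<and> real (Suc s) / real L < 1 \<and> pos h = act g (real (Suc s) / real L)"
      using pos_mult_bp[OF beyond_step.prems s'] s' by simp
    then show ?thesis by blast
  next
    case (2 u)
    then have "pos h = act g ((real s + u) / real L)"
      using act_mult_bp_arc[OF beyond_step.prems beyond_step(1,2)] by simp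
    moreover have "0 \<le> (real s + u) / real L \<and> (real s + u) / real L < 1"
      using subdivide(1)[OF beyond_step(1) 2(1,2)] unfolding atLeastLessThan_iff .
    ultimately show ?thesis by blast
  qed
qed

lemma beyond_pos:
  assumes g: "arc k g" and "beyond g h"
  shows "pos g \<le> pos h \<and> pos h \<le> pos g + 1 / real L ^ k \<or> h = \<one> \<and> pos g + 1 / real L ^ k = real m"
  using beyond_cases[OF assms(2) arc_in[OF g]]
proof
  assume "\<exists>u. 0 \<le> u \<and> u < 1 \<and> pos h = act g u"
  then obtain u where u: "0 \<le> u" "u < 1" "pos h = pos g + u / real L ^ k" using arc_act[OF g] by metis
  have "u / real L ^ k \<le> 1 / real L ^ k" using u by (intro divide_right_mono) auto
  then show ?thesis using u by simp
qed (use arc_end[OF g] in auto)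

text \<open>Arcs that share a point are nested: climbing from the deeper one up to level
  \<open>k\<close> arrives at \<open>g\<close> by uniqueness, and \<open>beyond\<close> grows at
  every step.\<close>

lemma arc_beyond_chain:
  assumes "arc k' g'" "arc k g" "k \<le> k'" "0 \<le> u" "u < 1" "0 \<le> u'" "u' < 1" "act g u = act g' u'" "beyond g' h"
  shows "beyond g h"
  using assms
proof (induction arbitrary: u' h rule: arc.induct)
  case (arc_root i)
  then show ?case using arc_unique[of 0 g "a [^] i"] arc.arc_root by auto
next
  case (arc_step k' g' s)
  show ?case
  proof (cases "k = Suc k'")
    case True
    then have "g = g' \<otimes> bp s"
      using arc_unique[of k g "g' \<otimes> bp s" u u'] arc.arc_step[OF arc_step(1-3)] arc_step by blast
    then show ?thesis using arc_step by simp
  next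
    case False
    moreover have "beyond g' h" using beyond_step arc_step by blast
    moreover have "act g u = act g' ((real s + u') / real L)"
      using act_mult_bp_arc[OF arc_in[OF arc_step(1)] arc_step(2,3)] arc_step.prems by metis
    ultimately show ?thesis
      using arc_step.IH[of "(real s + u') / real L" h] arc_step.prems subdivide(1)[OF arc_step(2), of u'] by auto
  qed
qed

text \<open>An edge avoids all arcs below its own level, so it is a piece of an arc of level at
  least \<open>k\<close>; nesting carries its two ends up to \<open>g\<close>.\<close>

lemma edge_beyond_arc:
  assumes h: "h \<in> carrier G" "0 \<le> v" "v < 1" and g: "arc k g" "0 \<le> u" "u < 1"
    and eq: "act h (v / real L) = act g u"
  shows "beyond g h \<and> beyond g (h \<otimes> c)"
proof -
  obtain k' g' s where h': "arc k' g'" "s < L" "m dvd s" "h = g' \<otimes> bp s" using ex_edge[OF h(1)] by blast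
  have "\<not> Suc k' \<le> k"
    using arc_ancestor[OF g, of "Suc k'"] edge_not_in_arc[OF h'(1-3) h(2,3)] eq h'(4) by metis
  then have kk: "k \<le> k'" by simp
  have "act g u = act g' ((real s + v) / real L)"
    using act_mult_bp_edge[OF arc_in[OF h'(1)] h'(2,3) h(2,3)] eq h'(4) by simp
  then have chain: "beyond g x" if "beyond g' x" for x
    using arc_beyond_chain[OF h'(1) g(1) kk g(2,3) _ _ _ that, of "(real s + v) / real L"]
      subdivide(1)[OF h'(2) h(2,3)] by auto
  have "h \<otimes> c = g' \<otimes> bp (Suc s)" using h' arc_in by (simp add: bp_Suc_c m_assoc)
  then show ?thesis using chain beyond_bp[of s g'] beyond_bp[of "Suc s" g'] h' by simp
qed

lemma arc_beyond_root: "arc k g \<Longrightarrow> \<exists>i<m. \<forall>h. beyond g h \<longrightarrow> beyond (a [^] i) h"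
proof (induction rule: arc.induct)
  case (arc_step k g s)
  then show ?case using beyond_step by blast
qed auto

section \<open>Telling small elements apart by their positions\<close>

lemma pos_one: "pos \<one> = 0"
  using m by (simp add: pos_def act_one)

lemma pos_a: "pos a = 1" and pos_aa: "pos (a \<otimes> a) = 2"
  using m act_a_pow[of 0 1] act_a_pow[of 0 2] by (simp_all add: pos_def numeral_2_eq_2)

lemma pos_c: "pos c = 1 / real L"
  using act_bp_arc[of "Suc 0" 0] L_gt m by (simp add: pos_def bp_1)

lemma pos_cc: "pos (c \<otimes> c) = (1 + 1 / real L) / real L"
  using act_bp_arc[of "Suc 0" "1 / real L"] L_gt m pos_c by (simp add: pos_def bp_1 act_mult)

lemma a_neq: "a \<noteq> \<one>" and c_neq: "c \<noteq> \<one>" "c \<noteq> a" and cc_neq: "c \<otimes> c \<noteq> \<one>"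
proof -
  show "a \<noteq> \<one>" using pos_a pos_one by auto
  show "c \<noteq> \<one>" "c \<noteq> a" using pos_c pos_a pos_one L_gt by auto
  have "0 < pos (c \<otimes> c)" using L_gt by (simp add: pos_cc add_pos_pos)
  then show "c \<otimes> c \<noteq> \<one>" using pos_one by auto
qed

text \<open>Translated to the root arc, the vertex has position 2, neither in [0, 1) nor at the end
  1. That 2 is not reduced modulo \<open>m\<close> is where \<open>m\<close> being at least 3
  enters.\<close>

lemma not_beyond_aa:
  assumes "g \<in> carrier G"
  shows "\<not> beyond g (g \<otimes> a \<otimes> a)"
proof
  assume "beyond g (g \<otimes> a \<otimes> a)"
  then have "beyond (inv g \<otimes> g) (inv g \<otimes> (g \<otimes> a \<otimes> a))" using assms by (intro beyond_mult) auto
  moreover have "inv g \<otimes> (g \<otimes> a \<otimes> a) = a \<otimes> a" using assms by (simp flip: m_assoc)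
  ultimately have "beyond \<one> (a \<otimes> a)" using assms by simp
  then consider "a \<otimes> a = a" | u where "0 \<le> u" "u < 1" "pos (a \<otimes> a) = act \<one> u"
    using beyond_cases[of \<one> "a \<otimes> a"] by auto
  then show False by cases (use pos_aa pos_a act_one[OF unit_in(1)] in auto)
qed

end

section \<open>The circle through all vertices\<close>

context circle_action
begin

definition X :: "'g ugraph" where
  "X = cayley_graph G {a, inv a, a \<otimes> b, inv (a \<otimes> b)}"

definition Y :: "'g ugraph" where
  "Y = cayley_graph G {a \<otimes> b, inv (a \<otimes> b)}"

lemma verts_X [simp]: "verts X = carrier G" and verts_Y [simp]: "verts Y = carrier G"
  by (simp_all add: X_def Y_def cayley_graph_def)

lemma inv_mult_eq_iff:
  assumes "x \<in> carrier G" "y \<in> carrier G" "z \<in> carrier G"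
  shows "inv x \<otimes> y = z \<longleftrightarrow> y = x \<otimes> z" "inv x \<otimes> y = inv z \<longleftrightarrow> x = y \<otimes> z"
proof -
  have 1: "inv x \<otimes> y = w \<longleftrightarrow> y = x \<otimes> w" if "w \<in> carrier G" for w
    using assms(1,2) that by (metis inv_solve_left)
  show "inv x \<otimes> y = z \<longleftrightarrow> y = x \<otimes> z" by (rule 1[OF assms(3)])
  show "inv x \<otimes> y = inv z \<longleftrightarrow> x = y \<otimes> z"
    using 1[of "inv z"] assms by (metis inv_closed inv_solve_right)
qed

lemma edges_X: "edges X = {{x, y} |x y. x \<in> carrier G \<and> y \<in> carrier G \<and> adj x y}"
proof -
  have iff: "inv x \<otimes> y \<in> {a, inv a, a \<otimes> b, inv (a \<otimes> b)} \<longleftrightarrow> adj x y"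
    if "x \<in> carrier G" "y \<in> carrier G" for x y
    using inv_mult_eq_iff[OF that a_in] inv_mult_eq_iff[OF that c_in] by (auto simp: adj_def c_def)
  show ?thesis
    unfolding X_def cayley_graph_def ugraph.simps by (intro Collect_cong ex_cong1 conj_cong refl iff)
qed

lemma edges_Y: "edges Y = {{x, x \<otimes> c} |x. x \<in> carrier G}"
proof -
  have iff: "inv x \<otimes> y \<in> {a \<otimes> b, inv (a \<otimes> b)} \<longleftrightarrow> y = x \<otimes> c \<or> x = y \<otimes> c"
    if "x \<in> carrier G" "y \<in> carrier G" for x y
    using inv_mult_eq_iff[OF that c_in] by (auto simp: c_def)
  have "edges Y = {{x, y} |x y. x \<in> carrier G \<and> y \<in> carrier G \<and> (y = x \<otimes> c \<or> x = y \<otimes> c)}"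
    unfolding Y_def cayley_graph_def ugraph.simps by (intro Collect_cong ex_cong1 conj_cong refl iff)
  also have "\<dots> = {{x, x \<otimes> c} |x. x \<in> carrier G}"
  proof (intro subset_antisym subsetI)
    fix e assume "e \<in> {{x, y} |x y. x \<in> carrier G \<and> y \<in> carrier G \<and> (y = x \<otimes> c \<or> x = y \<otimes> c)}"
    then obtain x y where "e = {x, y}" "x \<in> carrier G" "y \<in> carrier G" "y = x \<otimes> c \<or> x = y \<otimes> c" by blast
    then show "e \<in> {{x, x \<otimes> c} |x. x \<in> carrier G}" by (auto simp: insert_commute)
  qed auto
  finally show ?thesis .
qed

lemma adj_sym: "adj x y \<longleftrightarrow> adj y x"
  by (auto simp: adj_def)

lemma edge_iff: "{x, y} \<in> edges X \<longleftrightarrow> x \<in> carrier G \<and> y \<in> carrier G \<and> adj x y"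
  unfolding edges_X using adj_sym by (auto simp: doubleton_eq_iff)

lemma adj_neq:
  assumes "x \<in> carrier G" "y \<in> carrier G" "adj x y"
  shows "x \<noteq> y"
  using assms a_neq c_neq(1) by (auto simp: adj_def)

sublocale gr: lf_graph X
proof
  fix e assume "e \<in> edges X"
  then show "\<exists>x\<in>verts X. \<exists>y\<in>verts X. x \<noteq> y \<and> e = {x, y}"
    using adj_neq by (auto simp: edges_X)
next
  fix v
  have "{e \<in> edges X. v \<in> e} \<subseteq> (\<lambda>y. {v, y}) ` {v \<otimes> a, v \<otimes> c, v \<otimes> inv a, v \<otimes> inv c}"
  proof
    fix e assume "e \<in> {e \<in> edges X. v \<in> e}"
    then obtain y where y: "e = {v, y}" "v \<in> carrier G" "y \<in> carrier G" "adj v y"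
      using adj_sym by (auto simp: edges_X)
    then have "y \<in> {v \<otimes> a, v \<otimes> c, v \<otimes> inv a, v \<otimes> inv c}"
      by (auto simp: adj_def m_assoc)
    then show "e \<in> (\<lambda>y. {v, y}) ` {v \<otimes> a, v \<otimes> c, v \<otimes> inv a, v \<otimes> inv c}" using y by blast
  qed
  then show "finite {e \<in> edges X. v \<in> e}" by (rule finite_subset) simp
qed

lemma a_edge: "g \<in> carrier G \<Longrightarrow> {g, g \<otimes> a} \<in> edges X"
  and c_edge: "g \<in> carrier G \<Longrightarrow> {g, g \<otimes> c} \<in> edges X"
  by (simp_all add: edge_iff adj_def)

section \<open>The two sides of an a-edge in the complex\<close>

definition side :: "'g \<Rightarrow> ('g \<Rightarrow> real) set" where
  "side g = subcomplex X {h. beyond g h}"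

text \<open>What remains of \<open>side g\<close> without the closed a-edge, written as a union of
  open stars so that it is visibly open.\<close>

definition inner :: "'g \<Rightarrow> ('g \<Rightarrow> real) set" where
  "inner g = star X {h. beyond g h \<and> h \<noteq> g \<and> h \<noteq> g \<otimes> a}"

lemma connectedin_side:
  assumes "g \<in> carrier G"
  shows "connectedin gr.T (side g)"
  unfolding side_def
proof (rule gr.connectedin_subcomplex)
  fix h assume "h \<in> {h. beyond g h}"
  then have "(\<lambda>x y. beyond g x \<and> beyond g y \<and> adj x y)\<^sup>*\<^sup>* g h" using beyond_reach assms by blast
  then show "(\<lambda>x y. x \<in> {h. beyond g h} \<and> y \<in> {h. beyond g h} \<and> {x, y} \<in> edges X)\<^sup>*\<^sup>* g h"
    by (rule mono_rtranclp[rule_format, rotated]) (auto simp: edge_iff dest: beyond_in[OF _ assms])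
qed (use assms beyond_refl in auto)

lemma vertex_in_side: "g \<in> carrier G \<Longrightarrow> vertex_point h \<in> side g \<longleftrightarrow> beyond g h"
  using beyond_in by (auto simp: side_def gr.vertex_in_subcomplex)

lemma side_ne: "g \<in> carrier G \<Longrightarrow> vertex_point g \<in> side g"
  by (simp add: vertex_in_side beyond_refl)

lemma side_subset: "side g \<subseteq> gr.P"
  by (auto simp: side_def subcomplex_def)

lemma inner_subset_side:
  assumes g: "g \<in> carrier G"
  shows "inner g \<subseteq> side g"
proof
  fix p assume "p \<in> inner g"
  then obtain w where p: "p \<in> gr.P" and w: "0 < p w" "beyond g w" "w \<noteq> g" "w \<noteq> g \<otimes> a"
    by (auto simp: inner_def star_def)
  have "beyond g z" if z: "p z \<noteq> 0" for z
  proof (cases "z = w")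
    case False
    have "{w, z} \<in> edges X"
      using gr.point_support_pair[OF p w(1), of z] gr.point_pos_iff[OF p, of z] z False by blast
    then show ?thesis using beyond_adj[OF w(2) g] w by (auto simp: edge_iff)
  qed (use w in simp)
  then show "p \<in> side g" using p by (simp add: side_def subcomplex_def)
qed

lemma side_diff_cell:
  assumes g: "g \<in> carrier G"
  shows "inner g = side g - cell {g, g \<otimes> a}"
proof
  have "p w = 0" if "p \<in> cell {g, g \<otimes> a}" "w \<noteq> g" "w \<noteq> g \<otimes> a" for p w
    using that by (simp add: cell_def)
  then have "inner g \<inter> cell {g, g \<otimes> a} = {}" by (force simp: inner_def star_def)
  then show "inner g \<subseteq> side g - cell {g, g \<otimes> a}" using inner_subset_side[OF g] by blast
  have gn: "g \<noteq> g \<otimes> a" using gr.edge_neq[OF a_edge[OF g]] .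
  show "side g - cell {g, g \<otimes> a} \<subseteq> inner g"
  proof
    fix p assume p: "p \<in> side g - cell {g, g \<otimes> a}"
    then have pP: "p \<in> gr.P" using side_subset by blast
    \<comment> \<open>A support consisting only of ends of the a-edge would put the point on the
      removed cell.\<close>
    have "\<exists>w. w \<noteq> g \<and> w \<noteq> g \<otimes> a \<and> p w \<noteq> 0"
      using pP
    proof (cases rule: gr.point_cases)
      case (1 v)
      have "v \<noteq> g" "v \<noteq> g \<otimes> a" using p 1 vertex_in_cell[OF gn] by auto
      then show ?thesis using 1 by (intro exI[of _ v]) simp
    next
      case (2 x y u)
      have nz: "p x \<noteq> 0" "p y \<noteq> 0" using 2 edge_point_apply[OF 2(2), of u] by auto
      have "p \<in> cell {x, y}" using 2 by (simp add: cell_pair)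
      then have "{x, y} \<noteq> {g, g \<otimes> a}" using p by auto
      then have "x \<notin> {g, g \<otimes> a} \<or> y \<notin> {g, g \<otimes> a}" using 2(2) by auto
      then show ?thesis using nz by auto
    qed
    then obtain w where w: "w \<noteq> g" "w \<noteq> g \<otimes> a" "p w \<noteq> 0" by blast
    have "beyond g w" using p w by (simp add: side_def subcomplex_def)
    then show "p \<in> inner g" using w pP gr.point_pos_iff[OF pP] by (auto simp: inner_def star_def)
  qed
qed

lemma side_partition:
  assumes g: "g \<in> carrier G"
  shows "openin gr.T (inner g)" "openin gr.T (gr.P - side g)" "inner g \<inter> (gr.P - side g) = {}"
    "inner g \<union> (gr.P - side g) = gr.P - cell {g, g \<otimes> a}"
proof -
  show "openin gr.T (inner g)" unfolding inner_def by (rule openin_star)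
  show "openin gr.T (gr.P - side g)"
    using gr.closedin_subcomplex unfolding side_def closedin_def by simp
  show "inner g \<inter> (gr.P - side g) = {}" using inner_subset_side[OF g] by blast
  have "cell {g, g \<otimes> a} \<subseteq> side g"
    unfolding side_def using beyond_refl[OF g] beyond_a
    by (intro gr.cell_subcomplex[OF a_edge[OF g]]) auto
  then show "inner g \<union> (gr.P - side g) = gr.P - cell {g, g \<otimes> a}"
    using side_subset side_diff_cell[OF g] by blast
qed

lemma connected_off_edge:
  assumes g: "g \<in> carrier G" and Q: "connectedin gr.T Q" "Q \<inter> cell {g, g \<otimes> a} = {}" "Q \<inter> side g \<noteq> {}"
  shows "Q \<subseteq> side g"
proof -
  have "Q \<subseteq> inner g \<or> Q \<subseteq> gr.P - side g"
    using side_partition[OF g] connectedin_subset_topspace[OF Q(1)] Q(2)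
    by (intro connectedin_subset_disjoint_open[OF Q(1)]) auto
  then show ?thesis using Q(3) inner_subset_side[OF g] by blast
qed

subsection \<open>The end at a point of infinitely many arcs\<close>

definition arc_at :: "real \<Rightarrow> nat \<Rightarrow> 'g \<Rightarrow> bool" where
  "arc_at t k g \<longleftrightarrow> arc k g \<and> (\<exists>u. 0 \<le> u \<and> u < 1 \<and> t = act g u)"

lemma arc_at_arc: "arc_at t k g \<Longrightarrow> arc k g" by (simp add: arc_at_def)

lemma arc_at_in: "arc_at t k g \<Longrightarrow> g \<in> carrier G" using arc_in arc_at_arc by blast

lemma in_arcs_iff: "in_arcs t \<longleftrightarrow> (\<forall>k. \<exists>g. arc_at t k g)"
  by (simp add: in_arcs_def arc_at_def)

lemma arc_at_chain:
  assumes "arc_at t k g" "arc_at t k' g'" "k \<le> k'" "beyond g' h"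
  shows "beyond g h"
proof -
  obtain u u' where u: "0 \<le> u" "u < 1" "t = act g u" "0 \<le> u'" "u' < 1" "t = act g' u'"
    using assms unfolding arc_at_def by blast
  then show ?thesis
    using arc_beyond_chain[OF arc_at_arc[OF assms(2)] arc_at_arc[OF assms(1)] assms(3) _ _ _ _ _ assms(4), of u u']
    by simp
qed

lemma arc_at_side:
  assumes "arc_at t k g" "arc_at t k' g'" "k \<le> k'"
  shows "side g' \<subseteq> side g"
  using arc_at_chain[OF assms] by (auto simp: side_def subcomplex_def)

text \<open>The second alternative covers the vertex 1 at the end of the last arc: its position is
  0, but the arc approaches it at \<open>m\<close>.\<close>

lemma arc_at_dist:
  assumes "arc_at t k g" "beyond g h"
  shows "\<bar>t - pos h\<bar> \<le> 1 / real L ^ k \<or> \<bar>t - real m\<bar> \<le> 1 / real L ^ k"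
proof -
  obtain u where u: "0 \<le> u" "u < 1" "t = pos g + u / real L ^ k"
    using assms(1) arc_act unfolding arc_at_def by metis
  have "u / real L ^ k \<le> 1 / real L ^ k" "0 \<le> u / real L ^ k"
    using u by (auto intro: divide_right_mono)
  then show ?thesis using beyond_pos[OF arc_at_arc[OF assms(1)] assms(2)] u(3) unfolding abs_le_iff by linarith
qed

lemma small_pieces:
  assumes "0 < (d::real)"
  shows "\<exists>k0. \<forall>k\<ge>k0. 1 / real L ^ k < d"
proof -
  have "(\<lambda>k. (1 / real L) ^ k) \<longlonglongrightarrow> 0" using L_gt by (intro LIMSEQ_power_zero) simp
  then have "eventually (\<lambda>k. (1 / real L) ^ k < d) sequentially" using assms by (rule order_tendstoD)
  then show ?thesis by (simp add: eventually_sequentially power_one_over)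
qed

lemma in_arcs_range: "in_arcs t \<Longrightarrow> t \<in> {0..<real m}"
  unfolding in_arcs_def using act_in[OF arc_in unit_in(1)] by blast

text \<open>The point \<open>t\<close> is neither the position of a vertex nor equal to
  \<open>m\<close>, so both distances are positive and eventually exceed the length of the
  arcs.\<close>

lemma in_arcs_avoid:
  assumes t: "in_arcs t" and h: "h \<in> carrier G"
  shows "\<exists>k0. \<forall>k\<ge>k0. \<forall>g. arc_at t k g \<longrightarrow> \<not> beyond g h"
proof -
  have "t \<noteq> pos h" using edge_not_in_arcs[OF h, of 0] t by (auto simp: pos_def)
  then have "0 < min \<bar>t - pos h\<bar> \<bar>t - real m\<bar>" using in_arcs_range[OF t] by auto
  then obtain k0 where "\<forall>k\<ge>k0. 1 / real L ^ k < min \<bar>t - pos h\<bar> \<bar>t - real m\<bar>" using small_pieces by blast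
  then show ?thesis using arc_at_dist by (intro exI[of _ k0]) fastforce
qed

text \<open>A compact set lies in the stars of finitely many vertices, and each of them drops out of
  the shrinking sides.\<close>

lemma in_arcs_avoid_compact:
  assumes t: "in_arcs t" and K: "compactin gr.T K"
  shows "\<exists>k0. \<forall>k\<ge>k0. \<forall>g. arc_at t k g \<longrightarrow> side g \<inter> K = {}"
proof -
  obtain W where W: "finite W" "W \<subseteq> carrier G" "K \<subseteq> star X W"
    using gr.compact_finite_support[OF K] by auto
  have "\<exists>k0. \<forall>k\<ge>k0. \<forall>g. arc_at t k g \<longrightarrow> (\<forall>w\<in>W. \<not> beyond g w)"
    using W(1,2)
  proof (induction W rule: finite_induct)
    case (insert w W)
    then obtain k1 k2 where "\<forall>k\<ge>k1. \<forall>g. arc_at t k g \<longrightarrow> (\<forall>w\<in>W. \<not> beyond g w)"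
      "\<forall>k\<ge>k2. \<forall>g. arc_at t k g \<longrightarrow> \<not> beyond g w" using in_arcs_avoid[OF t, of w] by auto
    then show ?case by (intro exI[of _ "max k1 k2"]) auto
  qed auto
  then obtain k0 where k0: "\<forall>k\<ge>k0. \<forall>g. arc_at t k g \<longrightarrow> (\<forall>w\<in>W. \<not> beyond g w)" by blast
  have "side g \<inter> K = {}" if g: "\<forall>w\<in>W. \<not> beyond g w" for g
  proof -
    have False if p: "p \<in> side g" "p \<in> K" for p
    proof -
      obtain w where "w \<in> W" "0 < p w" using p W(3) by (auto simp: star_def)
      then show False using p(1) g by (auto simp: side_def subcomplex_def)
    qed
    then show ?thesis by blast
  qed
  then show ?thesis using k0 by blast
qed

text \<open>The component into which the sides of the arcs at \<open>t\<close> finally fall. The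
  restriction to compact sets is there because ends are extensional functions.\<close>

definition end_at :: "real \<Rightarrow> ('g \<Rightarrow> real) set \<Rightarrow> ('g \<Rightarrow> real) set" where
  "end_at t = (\<lambda>K\<in>{K. compactin gr.T K}. THE C.
     C \<in> connected_components_of (subtopology gr.T (gr.P - K)) \<and> (\<exists>k g. arc_at t k g \<and> side g \<subseteq> C))"

lemma end_at_eq:
  assumes t: "in_arcs t" and K: "compactin gr.T K"
    and C: "C \<in> connected_components_of (subtopology gr.T (gr.P - K))"
    and g: "arc_at t k g" "side g \<subseteq> C"
  shows "end_at t K = C"
proof -
  have "C' = C" if C': "C' \<in> connected_components_of (subtopology gr.T (gr.P - K))"
    and g': "arc_at t k' g'" "side g' \<subseteq> C'" for C' k' g'
  proof -
    have "side g \<subseteq> side g' \<or> side g' \<subseteq> side g"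
      using arc_at_side[OF g(1) g'(1)] arc_at_side[OF g'(1) g(1)] by linarith
    then have "C \<inter> C' \<noteq> {}"
      using g(2) g'(2) side_ne[OF arc_at_in[OF g(1)]] side_ne[OF arc_at_in[OF g'(1)]] by blast
    then show ?thesis
      using pairwise_disjoint_connected_components_of C C' by (metis disjnt_def pairwiseD)
  qed
  then have "(THE C. C \<in> connected_components_of (subtopology gr.T (gr.P - K)) \<and>
      (\<exists>k g. arc_at t k g \<and> side g \<subseteq> C)) = C"
    using C g by (intro the_equality) blast+
  then show ?thesis using K by (simp add: end_at_def)
qed

text \<open>Deep sides miss \<open>K\<close> and are connected, so each lies in one component; as
  they are nested, it is the same for all.\<close>

lemma end_at_component:
  assumes t: "in_arcs t" and K: "compactin gr.T K"
  shows "end_at t K \<in> connected_components_of (subtopology gr.T (gr.P - K))"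
    "\<exists>k0. \<forall>k\<ge>k0. \<forall>g. arc_at t k g \<longrightarrow> side g \<subseteq> end_at t K"
proof -
  obtain k0 where k0: "\<forall>k\<ge>k0. \<forall>g. arc_at t k g \<longrightarrow> side g \<inter> K = {}"
    using in_arcs_avoid_compact[OF assms] by blast
  have comp: "end_at t K \<in> connected_components_of (subtopology gr.T (gr.P - K)) \<and> side g \<subseteq> end_at t K"
    if g: "arc_at t k g" "k0 \<le> k" for k g
  proof -
    have gG: "g \<in> carrier G" using arc_at_in[OF g(1)] .
    have "side g \<inter> K = {}" using k0 g by blast
    then have "connectedin (subtopology gr.T (gr.P - K)) (side g)"
      using connectedin_side[OF gG] side_subset[of g] by (auto simp: connectedin_subtopology)
    moreover have "subtopology gr.T (gr.P - K) \<noteq> trivial_topology"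
    proof -
      have "vertex_point g \<in> topspace (subtopology gr.T (gr.P - K))"
        using side_ne[OF gG] side_subset[of g] \<open>side g \<inter> K = {}\<close> by auto
      then have "topspace (subtopology gr.T (gr.P - K)) \<noteq> {}" by blast
      then show ?thesis unfolding null_topspace_iff_trivial .
    qed
    ultimately obtain C where "C \<in> connected_components_of (subtopology gr.T (gr.P - K))" "side g \<subseteq> C"
      using exists_connected_component_of_superset by metis
    then show ?thesis using end_at_eq[OF t K _ g(1)] by simp
  qed
  obtain g where "arc_at t k0 g" using t by (auto simp: in_arcs_iff)
  then show "end_at t K \<in> connected_components_of (subtopology gr.T (gr.P - K))" using comp by blast
  show "\<exists>k0. \<forall>k\<ge>k0. \<forall>g. arc_at t k g \<longrightarrow> side g \<subseteq> end_at t K" using comp by blast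
qed

lemma end_at_in:
  assumes t: "in_arcs t"
  shows "end_at t \<in> space_ends gr.T"
proof -
  have "end_at t L' \<subseteq> end_at t K" if K: "compactin gr.T K" "compactin gr.T L'" "K \<subseteq> L'" for K L'
  proof -
    obtain k1 k2 where k: "\<forall>k\<ge>k1. \<forall>g. arc_at t k g \<longrightarrow> side g \<subseteq> end_at t K"
      "\<forall>k\<ge>k2. \<forall>g. arc_at t k g \<longrightarrow> side g \<subseteq> end_at t L'"
      using end_at_component(2)[OF t] K by meson
    obtain g where g: "arc_at t (max k1 k2) g" using t by (auto simp: in_arcs_iff)
    then have "side g \<subseteq> end_at t K" "side g \<subseteq> end_at t L'"
      using k(1)[rule_format, OF max.cobounded1] k(2)[rule_format, OF max.cobounded2] by blast+
    then have "end_at t K \<inter> end_at t L' \<noteq> {}" using side_ne[OF arc_at_in[OF g]] by blast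
    moreover note c = end_at_component(1)[OF t K(1), folded topspace_one_complex]
      and c' = end_at_component(1)[OF t K(2), folded topspace_one_complex]
    moreover have "end_at t L' \<inter> K = {}" using component_off_compact(1)[OF c'] K(3) by blast
    ultimately show ?thesis
      using component_off_compact_maximal[OF c component_off_compact(2)[OF c']] by blast
  qed
  moreover have "end_at t \<in> (\<Pi>\<^sub>E K\<in>{K. compactin gr.T K}. connected_components_of (subtopology gr.T (gr.P - K)))"
    by (rule PiE_I) (simp_all add: end_at_component(1)[OF t], simp add: end_at_def)
  ultimately show ?thesis by (simp add: space_ends_def)
qed

text \<open>The component contains deeper sides, which lie in \<open>side g\<close>, and it cannot
  leave this side without crossing the a-edge in \<open>K\<close>.\<close>

lemma end_at_side:
  assumes t: "in_arcs t" and g: "arc_at t k g" and K: "compactin gr.T K" "cell {g, g \<otimes> a} \<subseteq> K"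
  shows "end_at t K \<subseteq> side g"
proof -
  note c = end_at_component(1)[OF t K(1), folded topspace_one_complex]
  obtain k0 where k0: "\<forall>k\<ge>k0. \<forall>g. arc_at t k g \<longrightarrow> side g \<subseteq> end_at t K"
    using end_at_component(2)[OF t K(1)] by blast
  obtain g' where g': "arc_at t (max k k0) g'" using t by (auto simp: in_arcs_iff)
  have "side g' \<subseteq> end_at t K" "side g' \<subseteq> side g"
    using k0[rule_format, OF max.cobounded2 g'] arc_at_side[OF g g' max.cobounded1] .
  then have "end_at t K \<inter> side g \<noteq> {}" using side_ne[OF arc_at_in[OF g']] by blast
  moreover have "end_at t K \<inter> cell {g, g \<otimes> a} = {}" using component_off_compact(1)[OF c] K(2) by blast
  ultimately show ?thesis
    using connected_off_edge[OF arc_at_in[OF g] component_off_compact(2)[OF c]] by blast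
qed

text \<open>Different points lie in different arcs of some level. For equal ends, the component off
  both a-edges would lie on both sides and contain a vertex whose position belongs to both
  arcs.\<close>

lemma end_at_inj:
  assumes t: "in_arcs t" "in_arcs t'" and eq: "end_at t = end_at t'"
  shows "t = t'"
proof (rule ccontr)
  assume "t \<noteq> t'"
  then have "0 < \<bar>t - t'\<bar>" by simp
  then obtain k where k: "1 / real L ^ k < \<bar>t - t'\<bar>" using small_pieces by blast
  obtain g g' where g: "arc_at t k g" and g': "arc_at t' k g'"
    using t unfolding in_arcs_iff by meson
  have "g \<noteq> g'"
  proof
    assume "g = g'"
    then obtain u u' where u: "0 \<le> u" "u < 1" "t = pos g + u / real L ^ k" "0 \<le> u'" "u' < 1" "t' = pos g + u' / real L ^ k"
      using g g' arc_act unfolding arc_at_def by metis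
    have "\<bar>t - t'\<bar> = \<bar>u - u'\<bar> / real L ^ k" using u by (simp add: diff_divide_distrib[symmetric] abs_divide)
    also have "\<dots> \<le> 1 / real L ^ k" using u by (intro divide_right_mono) auto
    finally show False using k by simp
  qed
  have gG: "g \<in> carrier G" "g' \<in> carrier G" using arc_at_in g g' by blast+
  define K where "K = cell {g, g \<otimes> a} \<union> cell {g', g' \<otimes> a}"
  have K: "compactin gr.T K" "cell {g, g \<otimes> a} \<subseteq> K" "cell {g', g' \<otimes> a} \<subseteq> K"
    unfolding K_def using gr.compactin_cell a_edge gG by (auto intro: compactin_Un)
  have sub: "end_at t K \<subseteq> side g" "end_at t K \<subseteq> side g'"
    using end_at_side[OF t(1) g K(1,2)] end_at_side[OF t(2) g' K(1,3)] eq by auto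
  obtain k0 where k0: "\<forall>k\<ge>k0. \<forall>g. arc_at t k g \<longrightarrow> side g \<subseteq> end_at t K"
    using end_at_component(2)[OF t(1) K(1)] by blast
  obtain h where h: "arc_at t k0 h" using t by (auto simp: in_arcs_iff)
  have hG: "h \<in> carrier G" using arc_at_in[OF h] .
  have hK: "vertex_point h \<in> end_at t K" using k0 h side_ne[OF hG] by blast
  then have bey: "beyond g h" "beyond g' h" using sub vertex_in_side gG by blast+
  have "vertex_point h \<notin> K"
    using component_off_compact(1)[OF end_at_component(1)[OF t(1) K(1), folded topspace_one_complex]] hK by blast
  then have "h \<noteq> g \<otimes> a" "h \<noteq> g' \<otimes> a"
    using vertex_in_cell(2)[OF gr.edge_neq[OF a_edge[OF gG(1)]]] vertex_in_cell(2)[OF gr.edge_neq[OF a_edge[OF gG(2)]]]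
    by (auto simp: K_def)
  then obtain u u' where "0 \<le> u" "u < 1" "pos h = act g u" "0 \<le> u'" "u' < 1" "pos h = act g' u'"
    using beyond_cases[OF bey(1) gG(1)] beyond_cases[OF bey(2) gG(2)] by blast
  then show False using arc_unique[OF arc_at_arc[OF g] arc_at_arc[OF g']] \<open>g \<noteq> g'\<close> by metis
qed


section \<open>The loop and its continuity\<close>

definition seg :: "'g \<Rightarrow> real \<Rightarrow> 'g \<Rightarrow> real" where
  "seg h u = edge_point h (h \<otimes> c) u"

text \<open>The action lives on [0, m), so the value at \<open>m\<close> is prescribed; it closes
  the loop at the vertex 1.\<close>

definition loop :: "real \<Rightarrow> ('g \<Rightarrow> real) + (('g \<Rightarrow> real) set \<Rightarrow> ('g \<Rightarrow> real) set)" where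
  "loop t =
     (if t = real m then Inl (vertex_point \<one>)
      else if in_arcs t then Inr (end_at t)
      else Inl (THE p. \<exists>h u. h \<in> carrier G \<and> 0 \<le> u \<and> u < 1 \<and> t = act h (u / real L) \<and> p = seg h u))"

lemma loop_edge:
  assumes "h \<in> carrier G" "0 \<le> u" "u < 1"
  shows "loop (act h (u / real L)) = Inl (seg h u)"
proof -
  have "act h (u / real L) \<noteq> real m" using act_in[OF assms(1) unit_in(2)[OF assms(2,3)]] by simp
  moreover have "(THE p. \<exists>h' u'. h' \<in> carrier G \<and> 0 \<le> u' \<and> u' < 1 \<and>
    act h (u / real L) = act h' (u' / real L) \<and> p = seg h' u') = seg h u"
    using assms edge_unique[OF assms(1) _ assms(2,3)] by (intro the_equality) blast+
  ultimately show ?thesis using edge_not_in_arcs[OF assms] by (simp add: loop_def)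
qed

lemma loop_end: "in_arcs t \<Longrightarrow> loop t = Inr (end_at t)"
  using in_arcs_range[of t] by (simp add: loop_def)

lemma loop_pos: "h \<in> carrier G \<Longrightarrow> loop (pos h) = Inl (vertex_point h)"
  using loop_edge[of h 0] by (simp add: pos_def seg_def)

lemma loop_m: "loop (real m) = Inl (vertex_point \<one>)"
  by (simp add: loop_def)

text \<open>The formula for the loop reaches the right end of the edge, in the wrap-around case
  through the value at \<open>m\<close>; continuity from the left depends on this.\<close>

lemma loop_interval:
  assumes h: "h \<in> carrier G"
  obtains l where "0 < l" "\<And>u. 0 \<le> u \<Longrightarrow> u < 1 \<Longrightarrow> act h (u / real L) = pos h + u * l"
    "\<And>u. 0 \<le> u \<Longrightarrow> u \<le> 1 \<Longrightarrow> loop (pos h + u * l) = Inl (seg h u)"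
    "pos (h \<otimes> c) = pos h + l \<or> h \<otimes> c = \<one> \<and> pos h + l = real m"
proof -
  obtain l where l: "0 < l" "\<And>u. 0 \<le> u \<Longrightarrow> u < 1 \<Longrightarrow> act h (u / real L) = pos h + u * l"
    "pos (h \<otimes> c) = pos h + l \<or> h \<otimes> c = \<one> \<and> pos h + l = real m" by (rule edge_interval[OF h]) blast
  have hc: "h \<otimes> c \<in> carrier G" using h by simp
  have "loop (pos h + u * l) = Inl (seg h u)" if u: "0 \<le> u" "u \<le> 1" for u
  proof (cases "u < 1")
    case True
    then show ?thesis using loop_edge[OF h u(1)] l(2)[OF u(1)] by simp
  next
    case False
    then have "u = 1" using u by simp
    then show ?thesis using l(3) loop_pos[OF hc] loop_m by (auto simp: seg_def)
  qed
  then show ?thesis using that[of l] l by blast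
qed

lemma seg_path:
  assumes "h \<in> carrier G"
  shows "continuous_map (top_of_set {0..1}) gr.F (Inl \<circ> seg h)"
  unfolding seg_def
  using continuous_map_compose[OF gr.edge_path[OF c_edge[OF assms]] gr.continuous_map_Inl] .

text \<open>Continuity of the edge path, carried over by the affine change of parameter. Only
  parameters of this edge are controlled, so the claim is one-sided at its two ends.\<close>

lemma loop_local:
  assumes h: "h \<in> carrier G" and l: "0 < l" "\<And>u. 0 \<le> u \<Longrightarrow> u \<le> 1 \<Longrightarrow> loop (pos h + u * l) = Inl (seg h u)"
    and W: "openin gr.F W" and u: "0 \<le> u" "u \<le> 1" and uW: "loop (pos h + u * l) \<in> W"
  shows "\<exists>d>0. \<forall>t. pos h \<le> t \<and> t \<le> pos h + l \<and> \<bar>t - (pos h + u * l)\<bar> < d \<longrightarrow> loop t \<in> W"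
proof -
  have "openin (top_of_set {0..1}) {v \<in> topspace (top_of_set {0..1}). (Inl \<circ> seg h) v \<in> W}"
    by (rule openin_continuous_map_preimage[OF seg_path[OF h] W])
  then have "openin (top_of_set {0..1}) {v \<in> {0..1}. Inl (seg h v) \<in> W}" by (simp only: topspace_euclidean_subtopology comp_apply)
  moreover have "u \<in> {v \<in> {0..1}. Inl (seg h v) \<in> W}" using u uW l(2) by simp
  ultimately obtain e where e: "0 < e" "\<And>v. v \<in> {0..1} \<Longrightarrow> dist v u < e \<Longrightarrow> Inl (seg h v) \<in> W"
    unfolding openin_euclidean_subtopology_iff by blast
  have "loop t \<in> W" if t: "pos h \<le> t" "t \<le> pos h + l" "\<bar>t - (pos h + u * l)\<bar> < e * l" for t
  proof -
    define v where "v = (t - pos h) / l"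
    have tv: "t = pos h + v * l" using l(1) by (simp add: v_def)
    have v: "0 \<le> v" "v \<le> 1" using t l(1) by (simp_all add: v_def divide_le_eq)
    have "\<bar>v - u\<bar> * l = \<bar>t - (pos h + u * l)\<bar>" using l(1) unfolding tv by (simp add: abs_mult flip: left_diff_distrib)
    then have "\<bar>v - u\<bar> < e" using t(3) l(1) by (metis mult_less_cancel_right_pos)
    then show ?thesis using e(2)[of v] v l(2)[OF v] tv by (simp add: dist_real_def)
  qed
  then show ?thesis using e(1) l(1) by (intro exI[of _ "e * l"]) simp
qed

text \<open>The two one-sided claims are separate because at a vertex a different ab-edge is
  responsible for each side.\<close>

lemma loop_right:
  assumes t: "t \<in> {0..<real m}" "\<not> in_arcs t" and W: "openin gr.F W" "loop t \<in> W"
  shows "\<exists>d>0. \<forall>t'. t \<le> t' \<and> t' < t + d \<longrightarrow> loop t' \<in> W"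
proof -
  obtain h u where h: "h \<in> carrier G" "0 \<le> u" "u < 1" "t = act h (u / real L)"
    using edge_or_in_arcs[OF t(1)] t(2) by blast
  obtain l where l: "0 < l" "\<And>u. 0 \<le> u \<Longrightarrow> u < 1 \<Longrightarrow> act h (u / real L) = pos h + u * l"
    "\<And>u. 0 \<le> u \<Longrightarrow> u \<le> 1 \<Longrightarrow> loop (pos h + u * l) = Inl (seg h u)"
    using loop_interval[OF h(1)] by metis
  have tu: "t = pos h + u * l" using l(2) h by simp
  obtain d where d: "0 < d" "\<forall>t'. pos h \<le> t' \<and> t' \<le> pos h + l \<and> \<bar>t' - t\<bar> < d \<longrightarrow> loop t' \<in> W"
    using loop_local[OF h(1) l(1,3) W(1) h(2)] h(3) W(2) tu by auto
  have "u * l < 1 * l" using h(3) l(1) by (rule mult_strict_right_mono)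
  then have "0 < min d (pos h + l - t)" using d(1) tu by simp
  moreover have "pos h \<le> t" using tu h(2) l(1) by simp
  then have "loop t' \<in> W" if "t \<le> t' \<and> t' < t + min d (pos h + l - t)" for t'
    using that by (intro d(2)[rule_format]) auto
  ultimately show ?thesis by blast
qed

lemma loop_left:
  assumes t: "t \<in> {0<..real m}" "\<not> in_arcs t" and W: "openin gr.F W" "loop t \<in> W"
  shows "\<exists>d>0. \<forall>t'. t - d < t' \<and> t' \<le> t \<longrightarrow> loop t' \<in> W"
proof -
  have "\<exists>h u l. h \<in> carrier G \<and> 0 < u \<and> u \<le> 1 \<and> 0 < l \<and> t = pos h + u * l \<and>
    (\<forall>u. 0 \<le> u \<and> u \<le> 1 \<longrightarrow> loop (pos h + u * l) = Inl (seg h u))"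
  proof -
    \<comment> \<open>To the left of a vertex lies the edge that starts at h c^-1. The parameter
      \<open>m\<close> is treated as the vertex 1.\<close>
    have at_vertex: ?thesis if h: "h \<in> carrier G" "t = pos h \<or> h = \<one> \<and> t = real m" for h
    proof -
      define h' where "h' = h \<otimes> inv c"
      have h': "h' \<in> carrier G" "h' \<otimes> c = h" using h by (simp_all add: h'_def m_assoc)
      obtain l where l: "0 < l" "\<And>u. 0 \<le> u \<Longrightarrow> u \<le> 1 \<Longrightarrow> loop (pos h' + u * l) = Inl (seg h' u)"
        "pos (h' \<otimes> c) = pos h' + l \<or> h' \<otimes> c = \<one> \<and> pos h' + l = real m"
        using loop_interval[OF h'(1)] by metis
      \<comment> \<open>Together with \<open>0 < t\<close> this excludes the mixed cases, in which
        the vertex 1 is taken once at 0 and once at \<open>m\<close>.\<close>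
      have "0 \<le> pos h'" using act_in[OF h'(1), of 0] m by (simp add: pos_def)
      then have "t = pos h' + l"
        using l(1,3) h(2) h'(2) t(1) pos_one by auto
      then show ?thesis using h' l by (intro exI[of _ h'] exI[of _ 1] exI[of _ l]) simp
    qed
    show ?thesis
    proof (cases "t = real m")
      case True
      then show ?thesis using at_vertex[of \<one>] by simp
    next
      case False
      then have "t \<in> {0..<real m}" using t(1) by simp
      then obtain h u where h: "h \<in> carrier G" "0 \<le> u" "u < 1" "t = act h (u / real L)"
        using edge_or_in_arcs t(2) by blast
      show ?thesis
      proof (cases "u = 0")
        case True
        then show ?thesis using at_vertex[OF h(1)] h(4) by (simp add: pos_def)
      next
        case False
        obtain l where l: "0 < l" "\<And>u. 0 \<le> u \<Longrightarrow> u < 1 \<Longrightarrow> act h (u / real L) = pos h + u * l"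
          "\<And>u. 0 \<le> u \<Longrightarrow> u \<le> 1 \<Longrightarrow> loop (pos h + u * l) = Inl (seg h u)"
          using loop_interval[OF h(1)] by metis
        then show ?thesis
          using h False by (intro exI[of _ h] exI[of _ u] exI[of _ l]) auto
      qed
    qed
  qed
  then obtain h u l where h: "h \<in> carrier G" "0 < u" "u \<le> 1" "0 < l" "t = pos h + u * l"
    "\<And>u. 0 \<le> u \<Longrightarrow> u \<le> 1 \<Longrightarrow> loop (pos h + u * l) = Inl (seg h u)" by blast
  obtain d where d: "0 < d" "\<forall>t'. pos h \<le> t' \<and> t' \<le> pos h + l \<and> \<bar>t' - t\<bar> < d \<longrightarrow> loop t' \<in> W"
    using loop_local[OF h(1,4,6) W(1) less_imp_le[OF h(2)] h(3)] W(2) unfolding h(5)[symmetric] by blast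
  have "u * l \<le> 1 * l" using h(3,4) by (intro mult_right_mono) auto
  moreover have "0 < u * l" using h(2,4) by simp
  ultimately have "0 < min d (u * l)" "t \<le> pos h + l" using d(1) h(5) by auto
  moreover have "loop t' \<in> W" if "t - min d (u * l) < t' \<and> t' \<le> t" for t'
    using that \<open>t \<le> pos h + l\<close> h(5) by (intro d(2)[rule_format]) auto
  ultimately show ?thesis by blast
qed

text \<open>The initial point of an arc is the position of a vertex, so \<open>t\<close> is interior
  to its arcs. Nearby parameters stay in a deep arc, where the loop runs on edges in
  \<open>side g\<close> or through ends with the same component.\<close>

lemma loop_at_end:
  assumes t: "in_arcs t" and K: "compactin gr.T K"
  shows "\<exists>d>0. \<forall>t'. \<bar>t' - t\<bar> < d \<longrightarrow>
    loop t' \<in> Inl ` end_at t K \<union> Inr ` {\<omega> \<in> space_ends gr.T. \<omega> K = end_at t K}"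
proof -
  obtain k where k: "\<forall>g. arc_at t k g \<longrightarrow> side g \<subseteq> end_at t K" using end_at_component(2)[OF t K] by blast
  obtain g where g: "arc_at t k g" using t by (auto simp: in_arcs_iff)
  have ag: "arc k g" and gG: "g \<in> carrier G" using g arc_at_arc arc_at_in by blast+
  have sub: "side g \<subseteq> end_at t K" using k g by blast
  obtain u where u: "0 \<le> u" "u < 1" "t = act g u" using g by (auto simp: arc_at_def)
  have tu: "t = pos g + u / real L ^ k" using arc_act[OF ag] u by simp
  have "u \<noteq> 0" using edge_not_in_arcs[OF gG, of 0] t u by auto
  then have u0: "0 < u" using u by simp
  define d where "d = min u (1 - u) / real L ^ k"
  have "0 < d" unfolding d_def using u0 u(2) by (intro divide_pos_pos L_power_pos) simp
  moreover have "loop t' \<in> Inl ` end_at t K \<union> Inr ` {\<omega> \<in> space_ends gr.T. \<omega> K = end_at t K}"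
    if t': "\<bar>t' - t\<bar> < d" for t'
  proof -
    define u' where "u' = (t' - pos g) * real L ^ k"
    have t'u: "t' = pos g + u' / real L ^ k" using L_gt by (simp add: u'_def)
    have "\<bar>u' - u\<bar> / real L ^ k = \<bar>t' - t\<bar>" unfolding tu t'u by (simp add: abs_divide flip: diff_divide_distrib)
    then have "\<bar>u' - u\<bar> / real L ^ k < min u (1 - u) / real L ^ k" using t' by (simp only: d_def)
    then have "\<bar>u' - u\<bar> < min u (1 - u)" using L_power_pos[of k] by (simp only: divide_less_cancel)
    then have u': "0 \<le> u'" "u' < 1" by linarith+
    have t'g: "t' = act g u'" using arc_act[OF ag u'] t'u by simp
    have t'm: "t' \<in> {0..<real m}" using act_in[OF gG unit_in(1)[OF u']] t'g by simp
    show ?thesis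
    proof (cases "in_arcs t'")
      case True
      have "arc_at t' k g" using ag u' t'g by (auto simp: arc_at_def)
      then have "end_at t' K = end_at t K" using end_at_eq[OF True K end_at_component(1)[OF t K] _ sub] by blast
      then show ?thesis using loop_end[OF True] end_at_in[OF True] by simp
    next
      case False
      then obtain h v where h: "h \<in> carrier G" "0 \<le> v" "v < 1" "t' = act h (v / real L)"
        using edge_or_in_arcs[OF t'm] by blast
      have "beyond g h \<and> beyond g (h \<otimes> c)"
        using edge_beyond_arc[OF h(1-3) ag u'] h(4) t'g by simp
      then have "cell {h, h \<otimes> c} \<subseteq> side g"
        unfolding side_def by (intro gr.cell_subcomplex[OF c_edge[OF h(1)]]) auto
      moreover have "seg h v \<in> cell {h, h \<otimes> c}"
        using h cell_pair[OF gr.edge_neq[OF c_edge[OF h(1)]]] by (auto simp: seg_def)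
      ultimately show ?thesis using loop_edge[OF h(1-3)] h(4) sub by auto
    qed
  qed
  ultimately show ?thesis by blast
qed

lemma loop_edge_in: "h \<in> carrier G \<Longrightarrow> 0 \<le> u \<Longrightarrow> u \<le> 1 \<Longrightarrow> seg h u \<in> gr.P"
  unfolding seg_def by (rule gr.edge_point_in[OF c_edge])

lemma loop_cases:
  assumes "t \<in> {0..real m}"
  obtains "in_arcs t" "loop t = Inr (end_at t)"
  | h u where "h \<in> carrier G" "0 \<le> u" "u \<le> 1" "loop t = Inl (seg h u)" "\<not> in_arcs t"
proof (cases "in_arcs t")
  case True
  then show ?thesis using that loop_end by blast
next
  case False
  show ?thesis
  proof (cases "t = real m")
    case True
    then have "loop t = Inl (seg \<one> 0)" using loop_m by (simp add: seg_def)
    then show ?thesis using that(2)[of \<one> 0] False by simp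
  next
    case m: False
    then have "t \<in> {0..<real m}" using assms by simp
    then obtain h u where "h \<in> carrier G" "0 \<le> u" "u < 1" "t = act h (u / real L)"
      using edge_or_in_arcs False by blast
    then show ?thesis using that(2)[of h u] False loop_edge by simp
  qed
qed

lemma loop_in: "t \<in> {0..real m} \<Longrightarrow> loop t \<in> topspace gr.F"
  by (erule loop_cases) (simp_all add: topspace_freudenthal end_at_in loop_edge_in)

lemma loop_continuous: "continuous_map (top_of_set {0..real m}) gr.F loop"
proof -
  define \<B> where "\<B> = {Inl ` U |U. openin gr.T U} \<union>
      {Inl ` C \<union> Inr ` {\<omega> \<in> space_ends gr.T. \<omega> K = C} |K C.
         compactin gr.T K \<and> C \<in> connected_components_of (subtopology gr.T (topspace gr.T - K))}"
  have F: "gr.F = topology_generated_by \<B>" by (simp only: freudenthal_def \<B>_def)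
  have "openin (top_of_set {0..real m}) (loop -` W \<inter> {0..real m})" if W: "W \<in> \<B>" for W
  proof -
    have oW: "openin gr.F W" unfolding F using W by (rule topology_generated_by_Basis)
    have "\<exists>d>0. \<forall>t'\<in>{0..real m}. dist t' t < d \<longrightarrow> loop t' \<in> W"
      if t: "t \<in> {0..real m}" and tW: "loop t \<in> W" for t
    proof (cases "in_arcs t")
      case True
      then have "Inr (end_at t) \<in> W" using tW loop_end by simp
      \<comment> \<open>A generating open set that contains an end is of the second kind, and its
        component is the one that this end chooses.\<close>
      then obtain K where K: "compactin gr.T K"
        "W = Inl ` end_at t K \<union> Inr ` {\<omega> \<in> space_ends gr.T. \<omega> K = end_at t K}"
        using W by (auto simp: \<B>_def)
      obtain d where "0 < d" "\<forall>t'. \<bar>t' - t\<bar> < d \<longrightarrow> loop t' \<in> W"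
        using loop_at_end[OF True K(1)] unfolding K(2)[symmetric] by blast
      then show ?thesis by (intro exI[of _ d]) (simp add: dist_real_def)
    next
      case False
      have r: "\<exists>d>0. \<forall>t'. t \<le> t' \<and> t' < t + d \<and> t' \<le> real m \<longrightarrow> loop t' \<in> W"
      proof (cases "t = real m")
        case True
        have "loop t' \<in> W" if "t \<le> t'" "t' \<le> real m" for t'
        proof -
          have "t' = t" using that True by simp
          then show ?thesis using tW by simp
        qed
        then show ?thesis by (intro exI[of _ 1]) auto
      next
        case m: False
        then have "t \<in> {0..<real m}" using t by simp
        then show ?thesis using loop_right[OF _ False oW tW] by blast
      qed
      have l: "\<exists>d>0. \<forall>t'. t - d < t' \<and> t' \<le> t \<and> 0 \<le> t' \<longrightarrow> loop t' \<in> W"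
      proof (cases "t = 0")
        case True
        have "loop t' \<in> W" if "t' \<le> t" "0 \<le> t'" for t'
        proof -
          have "t' = t" using that True by simp
          then show ?thesis using tW by simp
        qed
        then show ?thesis by (intro exI[of _ 1]) auto
      next
        case m: False
        then have "t \<in> {0<..real m}" using t by simp
        then show ?thesis using loop_left[OF _ False oW tW] by blast
      qed
      obtain d1 where d1: "0 < d1" "\<forall>t'. t \<le> t' \<and> t' < t + d1 \<and> t' \<le> real m \<longrightarrow> loop t' \<in> W" using r by blast
      obtain d2 where d2: "0 < d2" "\<forall>t'. t - d2 < t' \<and> t' \<le> t \<and> 0 \<le> t' \<longrightarrow> loop t' \<in> W" using l by blast
      have "loop t' \<in> W" if t': "t' \<in> {0..real m}" "dist t' t < min d1 d2" for t'
      proof (cases "t \<le> t'")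
        case True
        then have "t' < t + d1" using t'(2) by (simp add: dist_real_def)
        then show ?thesis using d1(2) True t'(1) by simp
      next
        case False
        then have "t - d2 < t'" using t'(2) by (simp add: dist_real_def)
        then show ?thesis using d2(2) False t'(1) by simp
      qed
      then show ?thesis using d1(1) d2(1) by (intro exI[of _ "min d1 d2"]) simp
    qed
    then show ?thesis unfolding openin_euclidean_subtopology_iff by fastforce
  qed
  moreover have "loop ` {0..real m} \<subseteq> \<Union>\<B>"
    using loop_in unfolding F topology_generated_by_topspace by blast
  ultimately show ?thesis unfolding F continuous_on_generated_topo_iff by simp
qed

text \<open>Comparing supports leaves only \<open>h = h'\<close> or two edges that each start where
  the other ends; the latter would give c c = 1.\<close>

lemma seg_inj:
  assumes h: "h \<in> carrier G" "h' \<in> carrier G" and u: "0 \<le> u" "u < 1" "0 \<le> u'" "u' < 1"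
    and eq: "seg h u = seg h' u'"
  shows "h = h' \<and> u = u'"
proof -
  have n: "h \<noteq> h \<otimes> c" "h' \<noteq> h' \<otimes> c" using gr.edge_neq[OF c_edge] h by blast+
  have app: "seg h u h = 1 - u" "seg h u (h \<otimes> c) = u" "seg h' u' h' = 1 - u'" "seg h' u' (h' \<otimes> c) = u'"
    using edge_point_apply[OF n(1), of u] edge_point_apply[OF n(2), of u'] by (auto simp: seg_def)
  have "h = h' \<or> h = h' \<otimes> c"
    using edge_point_apply_other[of h h' "h' \<otimes> c" u'] app(1) eq u(2) by (auto simp: seg_def)
  moreover have "h' = h \<or> h' = h \<otimes> c"
    using edge_point_apply_other[of h' h "h \<otimes> c" u] app(3) eq u(4) by (auto simp: seg_def)
  moreover have "\<not> (h = h' \<otimes> c \<and> h' = h \<otimes> c)"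
  proof
    assume "h = h' \<otimes> c \<and> h' = h \<otimes> c"
    then have "h = h \<otimes> (c \<otimes> c)" using h by (metis c_in m_assoc)
    then show False using cc_neq h by simp
  qed
  ultimately have "h = h'" by argo
  then have "seg h u (h \<otimes> c) = seg h' u' (h' \<otimes> c)" using fun_cong[OF eq, of "h \<otimes> c"] by simp
  then show ?thesis using app(2,4) \<open>h = h'\<close> by linarith
qed

lemma loop_inj: "inj_on loop {0..<real m}"
proof (rule inj_onI)
  fix t t' assume t: "t \<in> {0..<real m}" "t' \<in> {0..<real m}" and eq: "loop t = loop t'"
  have edge: "\<exists>h u. h \<in> carrier G \<and> 0 \<le> u \<and> u < 1 \<and> t = act h (u / real L) \<and> loop t = Inl (seg h u)"
    if "t \<in> {0..<real m}" "\<not> in_arcs t" for t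
    using edge_or_in_arcs[OF that(1)] that(2) loop_edge by blast
  show "t = t'"
  proof (cases "in_arcs t")
    case True
    then have "in_arcs t'" using edge[OF t(2)] eq loop_end by fastforce
    then show ?thesis using True eq loop_end end_at_inj by simp
  next
    case False
    then have "\<not> in_arcs t'" using edge[OF t(1)] eq loop_end by fastforce
    then show ?thesis using edge[OF t(1) False] edge[OF t(2)] eq seg_inj by (metis sum.inject(1))
  qed
qed


section \<open>Every end is a value of the loop\<close>

definition lives :: "(('g \<Rightarrow> real) set \<Rightarrow> ('g \<Rightarrow> real) set) \<Rightarrow> 'g \<Rightarrow> bool" where
  "lives \<omega> g \<longleftrightarrow> (\<exists>K. compactin gr.T K \<and> \<omega> K \<subseteq> side g)"

text \<open>After the subcomplex on \<open>V\<close> is added to \<open>K\<close>, a point of the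
  chosen component has a support vertex outside \<open>V\<close>, hence lies strictly inside one of
  the sides. The a-edge of this side has been removed, so the component cannot leave it.\<close>

lemma lives_in_one:
  assumes \<omega>: "\<omega> \<in> space_ends gr.T" and K: "compactin gr.T K"
    and V: "finite V" "V \<subseteq> carrier G" and I: "\<And>i. i \<in> I \<Longrightarrow> i \<in> V \<and> i \<otimes> a \<in> V"
    and cover: "\<And>p w. p \<in> \<omega> K \<Longrightarrow> p w \<noteq> 0 \<Longrightarrow> w \<in> carrier G \<Longrightarrow> w \<notin> V \<Longrightarrow> \<exists>i\<in>I. beyond i w"
  shows "\<exists>i\<in>I. lives \<omega> i"
proof -
  define K' where "K' = K \<union> subcomplex X V"
  have K': "compactin gr.T K'"
    unfolding K'_def using gr.compactin_subcomplex[OF V(1)] V(2) by (intro compactin_Un K) auto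
  note C = space_ends_component[OF \<omega> K']
  obtain p where p: "p \<in> \<omega> K'" using component_off_compact(3)[OF C] by blast
  then have pP: "p \<in> gr.P" "p \<notin> subcomplex X V"
    using component_off_compact(1)[OF C] by (auto simp: K'_def)
  then obtain w where w: "p w \<noteq> 0" "w \<notin> V" by (auto simp: subcomplex_def)
  have pw: "0 < p w" using gr.point_pos_iff[OF pP(1)] w(1) by simp
  have wG: "w \<in> carrier G"
    using pP(1)
  proof (cases rule: gr.point_cases)
    case (1 v)
    then show ?thesis using w(1) by (simp add: vertex_point_def split: if_splits)
  next
    case (2 x y u)
    then have "w \<in> {x, y}" using w(1) edge_point_apply_other[of w x y u] by blast
    then show ?thesis using gr.edge_verts[OF 2(1)] by auto
  qed
  have "p \<in> \<omega> K" using space_ends_mono[OF \<omega> K K'] p by (auto simp: K'_def)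
  then obtain i where i: "i \<in> I" "beyond i w" using cover w wG by blast
  have iV: "i \<in> V" "i \<otimes> a \<in> V" using I[OF i(1)] by auto
  have iG: "i \<in> carrier G" using iV V by blast
  have "p \<in> inner i" using pP(1) pw i(2) w(2) iV by (auto simp: inner_def star_def)
  then have "\<omega> K' \<inter> side i \<noteq> {}" using p inner_subset_side[OF iG] by blast
  moreover have "cell {i, i \<otimes> a} \<subseteq> subcomplex X V"
    using iV by (intro gr.cell_subcomplex[OF a_edge[OF iG]]) auto
  then have "\<omega> K' \<inter> cell {i, i \<otimes> a} = {}" using component_off_compact(1)[OF C] by (auto simp: K'_def)
  ultimately have "\<omega> K' \<subseteq> side i"
    using connected_off_edge[OF iG component_off_compact(2)[OF C]] by blast
  then show ?thesis using K' i(1) by (auto simp: lives_def)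
qed

text \<open>Here \<open>V\<close> is the root m-gon. Every vertex is a division point of some arc
  and therefore lies beyond one of the root edges.\<close>

lemma lives_root:
  assumes \<omega>: "\<omega> \<in> space_ends gr.T"
  shows "\<exists>g. arc 0 g \<and> lives \<omega> g"
proof -
  let ?V = "(\<lambda>i. a [^] i) ` {..<m}"
  have "\<exists>i\<in>?V. lives \<omega> i"
  proof (rule lives_in_one[OF \<omega> compactin_empty])
    show "finite ?V" "?V \<subseteq> carrier G" by auto
    fix i assume "i \<in> ?V"
    then obtain j where j: "i = a [^] j" "j < m" by auto
    have "i \<otimes> a = a [^] (Suc j mod m)" using j(1) a_pow_mod[of "Suc j"] by simp
    then show "i \<in> ?V \<and> i \<otimes> a \<in> ?V" using j m by auto
  next
    fix w assume w: "w \<in> carrier G"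
    obtain k g s where g: "arc k g" "s < L" "w = g \<otimes> bp s" using ex_edge[OF w] by blast
    have "beyond g w" using beyond_bp[of s g] g by simp
    then show "\<exists>i\<in>?V. beyond i w" using arc_beyond_root[OF g(1)] by blast
  qed
  then show ?thesis using arc_root by auto
qed

text \<open>Here \<open>V\<close> consists of the division points of the arc; any other vertex
  beyond \<open>g\<close> is beyond a smaller arc by the second clause of
  \<open>beyond\<close>.\<close>

lemma lives_step:
  assumes \<omega>: "\<omega> \<in> space_ends gr.T" and g: "arc k g" "lives \<omega> g"
  shows "\<exists>s. s < L \<and> \<not> m dvd s \<and> lives \<omega> (g \<otimes> bp s)"
proof -
  have gG: "g \<in> carrier G" using arc_in[OF g(1)] .
  obtain K where K: "compactin gr.T K" "\<omega> K \<subseteq> side g" using g(2) by (auto simp: lives_def)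
  let ?V = "(\<lambda>s. g \<otimes> bp s) ` {..L}" and ?I = "(\<lambda>s. g \<otimes> bp s) ` {s. s < L \<and> \<not> m dvd s}"
  have "\<exists>i\<in>?I. lives \<omega> i"
  proof (rule lives_in_one[OF \<omega> K(1)])
    show "finite ?V" "?V \<subseteq> carrier G" using gG by auto
    fix i assume "i \<in> ?I"
    then obtain s where s: "i = g \<otimes> bp s" "s < L" "\<not> m dvd s" by auto
    have "i \<otimes> a = g \<otimes> bp (Suc s)" using s gG by (simp add: bp_Suc_a m_assoc)
    moreover have "s \<in> {..L}" "Suc s \<in> {..L}" using s by auto
    ultimately show "i \<in> ?V \<and> i \<otimes> a \<in> ?V" using s(1) by blast
  next
    fix p w assume p: "p \<in> \<omega> K" "p w \<noteq> 0" and w: "w \<notin> ?V"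
    have "beyond g w" using p K(2) by (auto simp: side_def subcomplex_def)
    then show "\<exists>i\<in>?I. beyond i w" by (cases rule: beyond.cases) (use w in auto)
  qed
  then show ?thesis by auto
qed

text \<open>Dependent choice gives a nested sequence of arcs in whose sides the end lives. The
  supremum of their initial points lies in all of them, and its end meets the given one in every
  component.\<close>

lemma ends_in_loop:
  assumes \<omega>: "\<omega> \<in> space_ends gr.T"
  shows "\<exists>t. in_arcs t \<and> end_at t = \<omega>"
proof -
  have "\<exists>f. \<forall>k. (arc k (f k) \<and> lives \<omega> (f k)) \<and> (\<exists>s. s < L \<and> \<not> m dvd s \<and> f (Suc k) = f k \<otimes> bp s)"
  proof (rule dependent_nat_choice)
    show "\<exists>g. arc 0 g \<and> lives \<omega> g" by (rule lives_root[OF \<omega>])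
    fix g k assume "arc k g \<and> lives \<omega> g"
    then show "\<exists>h. (arc (Suc k) h \<and> lives \<omega> h) \<and> (\<exists>s. s < L \<and> \<not> m dvd s \<and> h = g \<otimes> bp s)"
      using lives_step[OF \<omega>, of k g] arc_step by blast
  qed
  then obtain f where f: "\<And>k. arc k (f k)" "\<And>k. lives \<omega> (f k)"
    "\<And>k. \<exists>s. s < L \<and> \<not> m dvd s \<and> f (Suc k) = f k \<otimes> bp s" by blast
  define x where "x k = pos (f k)" for k
  define r where "r k = x k + 1 / real L ^ k" for k
  have step: "x k \<le> x (Suc k) \<and> r (Suc k) < r k" for k
  proof -
    obtain s where s: "s < L" "\<not> m dvd s" "f (Suc k) = f k \<otimes> bp s" using f(3) by blast
    define l where "l = 1 / real L ^ Suc k"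
    have "0 < l" unfolding l_def using L_power_pos by (rule divide_pos_pos[OF zero_less_one])
    have xs: "x (Suc k) = x k + real s * l" using arc_pos_bp[OF f(1) s(1)] s(3) by (simp add: x_def l_def)
    have L_l: "1 / real L ^ k = real L * l" using L_gt by (simp add: l_def)
    \<comment> \<open>The last piece of an arc is an ab-edge, so the right ends strictly decrease.
      This keeps the limit off the right ends, which the half-open arcs do not contain.\<close>
    have "s \<noteq> L - 1" using s(2) by (auto simp: L_eq)
    then have "real s + 1 < real L" using s(1) by linarith
    then have "(real s + 1) * l < real L * l" using \<open>0 < l\<close> by simp
    then have "r (Suc k) < r k" unfolding r_def L_l l_def[symmetric] xs by (simp add: distrib_right)
    moreover have "0 \<le> real s * l" using \<open>0 < l\<close> by simp
    ultimately show ?thesis using xs by simp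
  qed
  have inc: "x j \<le> x k" if "j \<le> k" for j k using lift_Suc_mono_le[of x j k] step that by blast
  have dec: "r k \<le> r j" if "j \<le> k" for j k
    using lift_Suc_antimono_le[of r j k] step that by (meson less_imp_le)
  have xr: "x k < r k" for k unfolding r_def using divide_pos_pos[OF zero_less_one L_power_pos] by simp
  have xr': "x j \<le> r k" for j k
    using inc[of j k] dec[of k j] xr[of j] xr[of k] by (cases "j \<le> k") auto
  define t where "t = (SUP k. x k)"
  have "x k \<le> t" for k unfolding t_def by (intro cSUP_upper bdd_aboveI2[of _ _ "r 0"] xr') simp
  moreover have "t < r k" for k
  proof -
    have "t \<le> r (Suc k)" unfolding t_def by (intro cSUP_least xr') simp
    then show ?thesis using step[of k] by linarith
  qed
  ultimately have at: "arc_at t k (f k)" for k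
  proof -
    assume *: "\<And>k. x k \<le> t" "\<And>k. t < r k"
    define u where "u = (t - x k) * real L ^ k"
    have "0 \<le> u" using *(1)[of k] by (simp add: u_def)
    moreover have "(t - x k) * real L ^ k < (1 / real L ^ k) * real L ^ k"
      using *(2)[of k] by (intro mult_strict_right_mono L_power_pos) (simp add: r_def)
    then have "u < 1" using L_gt by (simp add: u_def)
    moreover have "t = x k + u / real L ^ k" using L_gt by (simp add: u_def)
    ultimately show ?thesis using f(1) arc_act[OF f(1)] by (auto simp: arc_at_def x_def)
  qed
  then have t: "in_arcs t" by (auto simp: in_arcs_iff)
  have "end_at t = \<omega>"
  proof (rule space_ends_eqI[OF end_at_in[OF t] \<omega>])
    fix K assume K: "compactin gr.T K"
    obtain k where k: "\<forall>g. arc_at t k g \<longrightarrow> side g \<subseteq> end_at t K" using end_at_component(2)[OF t K] by blast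
    obtain K' where K': "compactin gr.T K'" "\<omega> K' \<subseteq> side (f k)" using f(2)[of k] by (auto simp: lives_def)
    have KK: "compactin gr.T (K \<union> K')" using K K'(1) by (rule compactin_Un)
    have "\<omega> (K \<union> K') \<subseteq> \<omega> K" "\<omega> (K \<union> K') \<subseteq> \<omega> K'"
      using space_ends_mono[OF \<omega> K KK] space_ends_mono[OF \<omega> K'(1) KK] by auto
    moreover have "\<omega> (K \<union> K') \<noteq> {}" using component_off_compact(3)[OF space_ends_component[OF \<omega> KK]] .
    moreover have "side (f k) \<subseteq> end_at t K" using k at by blast
    ultimately show "end_at t K \<inter> \<omega> K \<noteq> {}" using K'(2) by blast
  qed
  then show ?thesis using t by blast
qed

section \<open>The image of the loop and the uniqueness of the circle\<close>

lemma points_Y: "complex_points Y = {seg h u |h u. h \<in> carrier G \<and> 0 \<le> u \<and> u \<le> 1}"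
proof -
  have cells: "cell {h, h \<otimes> c} = {seg h u |u. 0 \<le> u \<and> u \<le> 1}" if "h \<in> carrier G" for h
    using cell_pair[OF gr.edge_neq[OF c_edge[OF that]]] by (auto simp: seg_def)
  have "vertex_point ` carrier G \<subseteq> (\<Union>h\<in>carrier G. cell {h, h \<otimes> c})"
    using vertex_in_cell(1)[OF gr.edge_neq[OF c_edge]] by blast
  then have "complex_points Y = (\<Union>h\<in>carrier G. cell {h, h \<otimes> c})"
    unfolding complex_points_def edges_Y verts_Y by blast
  also have "\<dots> = (\<Union>h\<in>carrier G. {seg h u |u. 0 \<le> u \<and> u \<le> 1})" using cells by simp
  also have "\<dots> = {seg h u |h u. h \<in> carrier G \<and> 0 \<le> u \<and> u \<le> 1}" by blast
  finally show ?thesis .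
qed

lemma points_Y_subset: "complex_points Y \<subseteq> gr.P"
  unfolding points_Y using loop_edge_in by auto

lemma loop_image: "loop ` {0..real m} = Inl ` complex_points Y \<union> Inr ` space_ends gr.T"
proof (intro subset_antisym subsetI)
  fix z assume "z \<in> loop ` {0..real m}"
  then obtain t where t: "t \<in> {0..real m}" "z = loop t" by blast
  from t(1) show "z \<in> Inl ` complex_points Y \<union> Inr ` space_ends gr.T"
    by (cases rule: loop_cases) (use t(2) end_at_in points_Y in auto)
next
  fix z assume "z \<in> Inl ` complex_points Y \<union> Inr ` space_ends gr.T"
  then consider h u where "h \<in> carrier G" "0 \<le> u" "u \<le> 1" "z = Inl (seg h u)"
    | \<omega> where "\<omega> \<in> space_ends gr.T" "z = Inr \<omega>" unfolding points_Y by blast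
  then show "z \<in> loop ` {0..real m}"
  proof cases
    case 1
    have pos: "pos x \<in> {0..real m}" if "x \<in> carrier G" for x
      using act_in[OF that, of 0] m by (simp add: pos_def)
    have hc: "h \<otimes> c \<in> carrier G" using 1 by simp
    show ?thesis
    proof (cases "u = 1")
      case True
      then have "z = loop (pos (h \<otimes> c))" using 1 loop_pos[OF hc] by (simp add: seg_def)
      then show ?thesis using pos[OF hc] by blast
    next
      case False
      then have "z = loop (act h (u / real L))" using 1 loop_edge by simp
      moreover have "act h (u / real L) \<in> {0..real m}"
        using act_in[OF 1(1) unit_in(2)[of u]] 1 False by simp
      ultimately show ?thesis by blast
    qed
  next
    case 2
    obtain t where t: "in_arcs t" "end_at t = \<omega>" using ends_in_loop 2 by blast
    then have "z = loop t" using 2 loop_end by simp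
    moreover have "t \<in> {0..real m}" using in_arcs_range[OF t(1)] by simp
    ultimately show ?thesis by blast
  qed
qed

lemma hamiltonian_loop: "hamiltonian_circle X (loop ` {0..real m})"
  unfolding hamiltonian_circle_def
proof (intro conjI ballI)
  show "loop ` {0..real m} \<subseteq> topspace gr.F" using loop_in by blast
  show "subtopology gr.F (loop ` {0..real m}) homeomorphic_space top_of_set (sphere (0::complex) 1)"
  proof (rule loop_homeomorphic_circle[OF gr.Hausdorff_freudenthal loop_continuous _ _ loop_inj])
    show "0 < real m" using m by simp
    show "loop 0 = loop (real m)" using loop_pos[of \<one>] loop_m pos_one by simp
  qed
  fix v assume "v \<in> verts X"
  then have "seg v 0 \<in> complex_points Y" unfolding points_Y by force
  then show "Inl (vertex_point v) \<in> loop ` {0..real m}" unfolding loop_image by (simp add: seg_def)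
qed

text \<open>The initial points of the arcs at \<open>t\<close> are positions of vertices and
  converge to \<open>t\<close>; continuity of the loop carries them into \<open>W\<close>.\<close>

lemma vertex_near_end:
  assumes \<omega>: "\<omega> \<in> space_ends gr.T" and W: "openin gr.F W" "Inr \<omega> \<in> W"
  shows "\<exists>v\<in>carrier G. Inl (vertex_point v) \<in> W"
proof -
  obtain t where t: "in_arcs t" "end_at t = \<omega>" using ends_in_loop[OF \<omega>] by blast
  have tm: "t \<in> {0..real m}" using in_arcs_range[OF t(1)] by simp
  have "openin (top_of_set {0..real m}) {s \<in> topspace (top_of_set {0..real m}). loop s \<in> W}"
    by (rule openin_continuous_map_preimage[OF loop_continuous W(1)])
  then have "openin (top_of_set {0..real m}) {s \<in> {0..real m}. loop s \<in> W}"
    by (simp only: topspace_euclidean_subtopology)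
  moreover have "t \<in> {s \<in> {0..real m}. loop s \<in> W}" using tm W(2) t loop_end by simp
  ultimately obtain e where e: "0 < e" "\<And>s. s \<in> {0..real m} \<Longrightarrow> dist s t < e \<Longrightarrow> loop s \<in> W"
    unfolding openin_euclidean_subtopology_iff by blast
  obtain k where k: "1 / real L ^ k < e" using small_pieces[OF e(1)] by blast
  obtain g where g: "arc_at t k g" using t(1) by (auto simp: in_arcs_iff)
  have gG: "g \<in> carrier G" using arc_at_in[OF g] .
  obtain u where u: "0 \<le> u" "u < 1" "t = pos g + u / real L ^ k"
    using g arc_act unfolding arc_at_def by metis
  have "u / real L ^ k \<le> 1 / real L ^ k" "0 \<le> u / real L ^ k"
    using u by (auto intro: divide_right_mono)
  then have "dist (pos g) t < e" using u(3) k by (simp add: dist_real_def)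
  moreover have "pos g \<in> {0..real m}" using act_in[OF gG, of 0] m by (simp add: pos_def)
  ultimately have "loop (pos g) \<in> W" using e(2) by blast
  then show ?thesis using loop_pos[OF gG] gG by auto
qed

lemma hamiltonian_circle_points:
  assumes C: "hamiltonian_circle X C"
  shows "C \<inter> Inl ` gr.P = Inl ` complex_points Y" "Inr ` space_ends gr.T \<subseteq> C"
proof -
  interpret gc: graph_circle X C
    using C by unfold_locales (auto simp: hamiltonian_circle_def)
  have a_not: "Inl (edge_point g (g \<otimes> a) u) \<notin> C" if g: "g \<in> carrier G" "0 < u" "u < 1" for g u
  proof -
    \<comment> \<open>The witnesses on the two sides of the a-edge: \<open>g \<otimes> c\<close>
      strictly behind it and \<open>g \<otimes> a \<otimes> a\<close> in front of it.\<close>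
    have "vertex_point (g \<otimes> c) \<in> inner g"
      unfolding inner_def star_def using g(1) beyond_c c_neq by (auto intro!: exI[of _ "g \<otimes> c"])
    moreover have "vertex_point (g \<otimes> a \<otimes> a) \<in> gr.P - side g"
      using g(1) not_beyond_aa vertex_in_side by simp
    ultimately show ?thesis
      using gc.separating_edge_not_in[where v = "g \<otimes> c" and w = "g \<otimes> a \<otimes> a",
          OF a_edge[OF g(1)] side_partition[OF g(1)] _ _ _ _ g(2,3)] g(1)
      by simp
  qed
  have a_not': "Inl (edge_point (g \<otimes> a) g u) \<notin> C" if g: "g \<in> carrier G" "0 < u" "u < 1" for g u
    using a_not[of g "1 - u"] g edge_point_sym[of "g \<otimes> a" g u] by simp
  have c_in: "Inl (seg h u) \<in> C" if h: "h \<in> carrier G" "0 < u" "u < 1" for h u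
  proof -
    \<comment> \<open>Some edge at \<open>h\<close> other than the one to h c^-1 must carry points
      of the circle. Both a-edges are excluded, which leaves the edge to h c.\<close>
    have e: "{h, h \<otimes> inv c} \<in> edges X" using h(1) by (simp add: edge_iff adj_def m_assoc)
    obtain z v where z: "{h, z} \<in> edges X" "z \<noteq> h \<otimes> inv c" "0 < v" "v < 1" "Inl (edge_point h z v) \<in> C"
      using gc.second_edge[OF e] by blast
    have zG: "z \<in> carrier G" using z(1) by (simp add: edge_iff)
    have "z \<noteq> h \<otimes> a" using a_not[OF h(1) z(3,4)] z(5) by auto
    moreover have "h \<noteq> z \<otimes> a" using a_not'[OF zG z(3,4)] z(5) by auto
    moreover have "h \<noteq> z \<otimes> c" using z(2) zG by (auto simp: m_assoc)
    ultimately have "z = h \<otimes> c" using z(1) by (auto simp: edge_iff adj_def)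
    then show ?thesis using gc.open_edge_in[OF z(1,3,4,5) h(2,3)] by (simp add: seg_def)
  qed
  have seg_in: "Inl (seg h u) \<in> C" if h: "h \<in> carrier G" "0 \<le> u" "u \<le> 1" for h u
  proof -
    consider "u = 0" | "u = 1" | "0 < u" "u < 1" using h by linarith
    then show ?thesis
    proof cases
      case 1
      then show ?thesis using gc.verts_in[of h] h(1) by (simp add: seg_def)
    next
      case 2
      then show ?thesis using gc.verts_in[of "h \<otimes> c"] h(1) by (simp add: seg_def)
    qed (use c_in h(1) in blast)
  qed
  have in_Y: "p \<in> complex_points Y" if p: "p \<in> gr.P" "Inl p \<in> C" for p
    using p(1)
  proof (cases rule: gr.point_cases)
    case (1 v)
    then have "p = seg v 0" "v \<in> carrier G" by (simp_all add: seg_def)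
    then show ?thesis unfolding points_Y by force
  next
    case (2 x y u)
    have xy: "x \<in> carrier G" "y \<in> carrier G" "adj x y" using 2(1) by (simp_all add: edge_iff)
    have "y \<noteq> x \<otimes> a" using a_not[OF xy(1) 2(3,4)] p(2) 2(5) by auto
    moreover have "x \<noteq> y \<otimes> a" using a_not'[OF xy(2) 2(3,4)] p(2) 2(5) by auto
    ultimately consider "y = x \<otimes> c" | "x = y \<otimes> c" using xy(3) by (auto simp: adj_def)
    then show ?thesis
    proof cases
      case 1
      then have "p = seg x u" using 2(5) by (simp add: seg_def)
      then show ?thesis unfolding points_Y using xy(1) 2(3,4) by force
    next
      case swap: 2
      then have "p = seg y (1 - u)" using 2(5) edge_point_sym[of x y u] by (simp add: seg_def)
      moreover have "0 \<le> 1 - u" "1 - u \<le> 1" using 2(3,4) by auto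
      ultimately show ?thesis unfolding points_Y using xy(2) by blast
    qed
  qed
  show "C \<inter> Inl ` gr.P = Inl ` complex_points Y"
  proof (intro subset_antisym subsetI)
    fix z assume "z \<in> C \<inter> Inl ` gr.P"
    then obtain p where "z = Inl p" "p \<in> gr.P" "Inl p \<in> C" by blast
    then show "z \<in> Inl ` complex_points Y" using in_Y by simp
  next
    fix z :: "('g \<Rightarrow> real) + (('g \<Rightarrow> real) set \<Rightarrow> ('g \<Rightarrow> real) set)"
    assume "z \<in> Inl ` complex_points Y"
    then obtain p where p: "z = Inl p" "p \<in> complex_points Y" by blast
    then have "Inl p \<in> C" using seg_in unfolding points_Y by auto
    then show "z \<in> C \<inter> Inl ` gr.P" using p points_Y_subset by blast
  qed
  \<comment> \<open>A circle is compact, hence closed here, and it contains the vertices, which come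
    arbitrarily near to every end.\<close>
  have clo: "closedin gr.F C" using compactin_imp_closedin[OF gr.Hausdorff_freudenthal gc.compactin_circle] .
  show "Inr ` space_ends gr.T \<subseteq> C"
  proof (rule ccontr)
    assume "\<not> Inr ` space_ends gr.T \<subseteq> C"
    then obtain \<omega> where \<omega>: "\<omega> \<in> space_ends gr.T" "Inr \<omega> \<notin> C" by blast
    have "openin gr.F (topspace gr.F - C)" using clo by (simp add: closedin_def)
    moreover have "Inr \<omega> \<in> topspace gr.F - C" using \<omega> by (simp add: topspace_freudenthal)
    ultimately obtain v where "v \<in> carrier G" "Inl (vertex_point v) \<in> topspace gr.F - C"
      using vertex_near_end[OF \<omega>(1)] by blast
    then show False using gc.verts_in[of v] by simp
  qed
qed

lemma hamiltonian_circle_unique: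
  assumes C: "hamiltonian_circle X C"
  shows "C = loop ` {0..real m}"
proof -
  have "C \<subseteq> Inl ` gr.P \<union> Inr ` space_ends gr.T"
    using C unfolding hamiltonian_circle_def topspace_freudenthal by simp
  then show ?thesis using hamiltonian_circle_points[OF C] unfolding loop_image by blast
qed

lemma two_regular_Y: "two_regular Y"
  unfolding two_regular_def
proof
  fix v assume "v \<in> verts Y"
  then have v: "v \<in> carrier G" by simp
  have "{e \<in> edges Y. v \<in> e} = {{v, v \<otimes> c}, {v \<otimes> inv c, v}}"
  proof (intro subset_antisym subsetI)
    fix e assume "e \<in> {e \<in> edges Y. v \<in> e}"
    then obtain x where x: "x \<in> carrier G" "e = {x, x \<otimes> c}" "v = x \<or> v = x \<otimes> c" by (auto simp: edges_Y)
    have "x = v \<otimes> inv c" if "v = x \<otimes> c" using that x(1) by (simp add: m_assoc)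
    then show "e \<in> {{v, v \<otimes> c}, {v \<otimes> inv c, v}}" using x by auto
  next
    fix e assume "e \<in> {{v, v \<otimes> c}, {v \<otimes> inv c, v}}"
    moreover have "{v \<otimes> inv c, v} = {v \<otimes> inv c, v \<otimes> inv c \<otimes> c}" using v by (simp add: m_assoc)
    ultimately show "e \<in> {e \<in> edges Y. v \<in> e}" using v by (auto simp: edges_Y)
  qed
  \<comment> \<open>The two edges at \<open>v\<close> could coincide only if c c = 1, which
    positions exclude.\<close>
  moreover have "{v, v \<otimes> c} \<noteq> {v \<otimes> inv c, v}"
  proof
    assume "{v, v \<otimes> c} = {v \<otimes> inv c, v}"
    then have "v \<otimes> c = v \<otimes> inv c" using c_neq(1) v by (auto simp: doubleton_eq_iff)
    then have "c = inv c" using v by simp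
    then have "c \<otimes> c = \<one>" using r_inv[OF c_in] by simp
    then show False using cc_neq by simp
  qed
  ultimately show "card {e \<in> edges Y. v \<in> e} = 2" by simp
qed

theorem unique_hamiltonian_circle:
  "(\<exists>!C. hamiltonian_circle X C) \<and> (\<forall>C. hamiltonian_circle X C \<longrightarrow> circle_meets_in X C Y)"
proof (intro conjI allI impI)
  show "\<exists>!C. hamiltonian_circle X C" using hamiltonian_loop hamiltonian_circle_unique by blast
  fix C assume "hamiltonian_circle X C"
  moreover have "spanning_subgraph Y X"
    unfolding spanning_subgraph_def edges_Y using c_edge by auto
  ultimately show "circle_meets_in X C Y"
    using two_regular_Y hamiltonian_circle_points(1) unfolding circle_meets_in_def by blast
qed

end

section \<open>The free product of two cyclic groups\<close>

lemma carrier_presented_group: "carrier (presented_group R) = range (pres_class R)"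
  by (simp add: presented_group_def)

lemma one_presented_group: "\<one>\<^bsub>presented_group R\<^esub> = pres_class R []"
  by (simp add: presented_group_def)

lemma pow_presented_group:
  "pres_class R [l] [^]\<^bsub>presented_group R\<^esub> (k::nat) = pres_class R (replicate k l)"
proof -
  interpret group "presented_group R" by (rule group_presented_group)
  show ?thesis
  proof (induction k)
    case (Suc k)
    then show ?case by (simp add: mult_pres_class replicate_append_same)
  qed (simp add: one_presented_group)
qed

text \<open>By the relators an inverse letter equals a positive power of its generator, so appending
  \<open>a\<close> and \<open>b\<close> reaches the class of every word.\<close>

lemma free_prod_cyclic_induct:
  assumes m: "1 \<le> m" and n: "1 \<le> n"
    and one: "Q \<one>\<^bsub>free_prod_cyclic m n\<^esub>"
    and a: "\<And>x. x \<in> carrier (free_prod_cyclic m n) \<Longrightarrow> Q x \<Longrightarrow> Q (x \<otimes>\<^bsub>free_prod_cyclic m n\<^esub> elt_a m n)"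
    and b: "\<And>x. x \<in> carrier (free_prod_cyclic m n) \<Longrightarrow> Q x \<Longrightarrow> Q (x \<otimes>\<^bsub>free_prod_cyclic m n\<^esub> elt_b m n)"
    and x: "x \<in> carrier (free_prod_cyclic m n)"
  shows "Q x"
proof -
  define R where "R = cyclic_relators m n"
  have a': "Q (pres_class R (w @ [(GenA, True)]))" if "Q (pres_class R w)" for w
    using a[of "pres_class R w"] that
    by (simp add: free_prod_cyclic_def R_def elt_a_def mult_pres_class carrier_presented_group)
  have b': "Q (pres_class R (w @ [(GenB, True)]))" if "Q (pres_class R w)" for w
    using b[of "pres_class R w"] that
    by (simp add: free_prod_cyclic_def R_def elt_b_def mult_pres_class carrier_presented_group)
  have pow: "Q (pres_class R (w @ replicate k (g, True)))" if "Q (pres_class R w)" for w g k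
  proof (induction k)
    case (Suc k)
    then show ?case
      using a'[of "w @ replicate k (g, True)"] b'[of "w @ replicate k (g, True)"]
      by (cases g) (simp_all add: replicate_append_same)
  qed (use that in simp)
  have inv: "pres_eq R [(g, False)] (replicate (k - 1) (g, True))"
    if r: "replicate k (g, True) \<in> R" "1 \<le> k" for g k
  proof -
    have "replicate k (g, True) = (g, True) # replicate (k - 1) (g, True)"
      using r(2) by (cases k) auto
    then have "pres_eq R ([(g, False)] @ (g, True) # replicate (k - 1) (g, True)) ([(g, False)] @ [])"
      using pres_eq_append[OF pres_refl pres_relator[OF r(1)], of "[(g, False)]"] by simp
    moreover have "pres_eq R ([(g, False), (g, \<not> False)] @ replicate (k - 1) (g, True)) ([] @ replicate (k - 1) (g, True))"
      by (rule pres_eq_append[OF pres_cancel pres_refl])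
    ultimately show ?thesis using pres_sym pres_trans by (metis append_Cons append_Nil append_Nil2)
  qed
  have "Q (pres_class R w)" for w
  proof (induction w rule: rev_induct)
    case Nil
    then show ?case using one by (simp add: free_prod_cyclic_def R_def one_presented_group)
  next
    case (snoc l w)
    obtain g s where l: "l = (g, s)" by (cases l)
    define k where "k = (case g of GenA \<Rightarrow> m | GenB \<Rightarrow> n)"
    have "replicate k (g, True) \<in> R" "1 \<le> k"
      using m n by (cases g; simp add: k_def R_def cyclic_relators_def)+
    then have "pres_class R (w @ [(g, False)]) = pres_class R (w @ replicate (k - 1) (g, True))"
      using pres_eq_append[OF pres_refl inv] by (simp add: pres_class_eq_iff)
    then show ?case using pow[OF snoc, of 1 g] pow[OF snoc, of "k - 1" g] l by (cases s) auto
  qed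
  then show ?thesis using x by (auto simp: free_prod_cyclic_def carrier_presented_group R_def)
qed

text \<open>Any representative will do, since equal classes act equally on [0, m).\<close>

definition class_act :: "nat \<Rightarrow> nat \<Rightarrow> gen word set \<Rightarrow> real \<Rightarrow> real" where
  "class_act m n A = word_act m n (SOME w. w \<in> A)"

lemma class_act_pres_class:
  assumes "1 \<le> m" "1 \<le> n" "t \<in> {0..<real m}"
  shows "class_act m n (pres_class (cyclic_relators m n) u) t = word_act m n u t"
proof -
  let ?A = "pres_class (cyclic_relators m n) u"
  have "u \<in> ?A" by (simp add: pres_class_def pres_refl)
  then have "(SOME w. w \<in> ?A) \<in> ?A" by (rule someI)
  then have "pres_eq (cyclic_relators m n) u (SOME w. w \<in> ?A)" by (simp add: pres_class_def)
  then show ?thesis using word_act_pres_eq[OF assms(1,2) _ assms(3)] by (simp add: class_act_def)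
qed

lemma circle_action_free_prod_cyclic:
  assumes "3 \<le> m" "2 \<le> n"
  shows "circle_action (free_prod_cyclic m n) (elt_a m n) (elt_b m n) m n (class_act m n)"
proof -
  have mn: "1 \<le> m" "1 \<le> n" using assms by auto
  let ?R = "cyclic_relators m n"
  interpret group "free_prod_cyclic m n" unfolding free_prod_cyclic_def by (rule group_presented_group)
  note defs = free_prod_cyclic_def elt_a_def elt_b_def carrier_presented_group one_presented_group
    pow_presented_group mult_pres_class pres_class_eq_iff
  note act = class_act_pres_class[OF mn]
  show ?thesis
  proof unfold_locales
    show "elt_a m n [^]\<^bsub>free_prod_cyclic m n\<^esub> m = \<one>\<^bsub>free_prod_cyclic m n\<^esub>"
      "elt_b m n [^]\<^bsub>free_prod_cyclic m n\<^esub> n = \<one>\<^bsub>free_prod_cyclic m n\<^esub>"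
      by (simp_all add: defs pres_relator cyclic_relators_def)
    fix g h t assume "g \<in> carrier (free_prod_cyclic m n)" "h \<in> carrier (free_prod_cyclic m n)"
      and t: "t \<in> {0..<real m}"
    then obtain u v where uv: "g = pres_class ?R u" "h = pres_class ?R v" by (auto simp: defs)
    show "class_act m n (g \<otimes>\<^bsub>free_prod_cyclic m n\<^esub> h) t = class_act m n g (class_act m n h t)"
      using act[OF t] act[OF word_act_bounds[OF mn t]] uv by (simp add: defs word_act_append)
  next
    fix g t assume "g \<in> carrier (free_prod_cyclic m n)" and t: "t \<in> {0..<real m}"
    then obtain u where "g = pres_class ?R u" by (auto simp: defs)
    then show "class_act m n g t \<in> {0..<real m}" using act[OF t] word_act_bounds[OF mn t] by simp
  next
    fix Q :: "gen word set \<Rightarrow> bool" and x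
    assume "Q \<one>\<^bsub>free_prod_cyclic m n\<^esub>"
      and "\<And>x. x \<in> carrier (free_prod_cyclic m n) \<Longrightarrow> Q x \<Longrightarrow> Q (x \<otimes>\<^bsub>free_prod_cyclic m n\<^esub> elt_a m n)"
      and "\<And>x. x \<in> carrier (free_prod_cyclic m n) \<Longrightarrow> Q x \<Longrightarrow> Q (x \<otimes>\<^bsub>free_prod_cyclic m n\<^esub> elt_b m n)"
      and "x \<in> carrier (free_prod_cyclic m n)"
    then show "Q x" by (rule free_prod_cyclic_induct[OF mn])
  qed (use assms act in \<open>auto simp: defs simp del: atLeastLessThan_iff\<close>)
qed

theorem theorem4p2:
  fixes m n :: nat
  assumes "m \<ge> 3" and "n \<ge> 2"
  shows "let G = free_prod_cyclic m n; a = elt_a m n; b = elt_b m n;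
             X = cayley_graph G {a, inv\<^bsub>G\<^esub> a, a \<otimes>\<^bsub>G\<^esub> b, inv\<^bsub>G\<^esub> (a \<otimes>\<^bsub>G\<^esub> b)};
             Y = cayley_graph G {a \<otimes>\<^bsub>G\<^esub> b, inv\<^bsub>G\<^esub> (a \<otimes>\<^bsub>G\<^esub> b)}
         in (\<exists>!C. hamiltonian_circle X C) \<and>
            (\<forall>C. hamiltonian_circle X C \<longrightarrow> circle_meets_in X C Y)"
proof -
  interpret circle_action "free_prod_cyclic m n" "elt_a m n" "elt_b m n" m n "class_act m n"
    using circle_action_free_prod_cyclic[OF assms] .
  show ?thesis
    using unique_hamiltonian_circle unfolding X_def Y_def Let_def .
qed

end
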